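(* Let $F$ be a non-archimedean local field and $G=\mathrm{PGL}(2,F)$. a) For every integer $k\ge 0$ the following sequence of $G$-modules is exact: $$C^0_c(\tilde X_k,\mathbb C)\xrightarrow{\ d\ }C^1_c(\tilde X_k,\mathbb C)\xrightarrow{\ \mathcal R_k\ }C^0_c(\tilde{\mathcal A}).$$ In other words, $\mathcal R_k$ induces an injective map $\bar{\mathcal R}_k: H^1_c(\tilde X_k,\mathbb C)\to C^0_c(\tilde{\mathcal A})$. b) Moreover $$\bigcup_{k\ge 0}\bar{\mathcal R}_k\bigl(H^1_c(\tilde X_k,\mathbb C)\bigr)=C^0_c(\tilde{\mathcal A}).$$
   Context: Let $X$ be the Bruhat-Tits tree of $G$. For $k\ge 0$, a $k$-path in $X$ is an injective sequence $(s_0,\dots,s_k)$ of vertices with $\{s_i,s_{i+1}\}$ an edge of $X$ for $0\le i\le k-1$. The directed graph $\tilde X_k$ has as vertex set $\tilde X_k^0$ the set of $k$-paths and as edge set $\tilde X_k^1$ the set of $(k+1)$-paths; the edge $a=(t_0,\dots,t_{k+1})$ has head $a^+=(t_1,\dots,t_{k+1})$ and tail $a^-=(t_0,\dots,t_k)$. $G$ acts naturally on $\tilde X_k$. $C^i_c(\tilde X_k,\mathbb C)$, $i=0,1$, is the space of finitely supported complex functions on $\tilde X_k^i$; $df(a)=f(a^+)-f(a^-)$; $H^1_c(\tilde X_k,\mathbb C)=C^1_c(\tilde X_k,\mathbb C)/dC^0_c(\tilde X_k,\mathbb C)$. An oriented apartment of $X$ is a pair $\tilde A=(A,\epsilon)$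 where $A$ is an apartment of $X$ (a doubly infinite line in $X$) and $\epsilon$ is one of its two orientations (directions). $\tilde{\mathcal A}$ is the set of oriented apartments; as a $G$-set it is isomorphic to $G/T$, where $T$ is the diagonal torus of $G$, and it is given the topology corresponding to the quotient topology of $G/T$. $C^0_c(\tilde{\mathcal A})$ is the space of locally constant complex functions with compact support on $\tilde{\mathcal A}$. For $\tilde A\in\tilde{\mathcal A}$, the corresponding apartment $\tilde A_k$ of $\tilde X_k$ is the subgraph whose edges (resp. vertices) are the $(k+1)$-paths (resp. $k$-paths) contained in $A$ whose orientation is compatible with that of $\tilde A$; $\tilde A^1$ denotes its set of edges when $k$ is fixed. The geodesic Radon transform is $$\mathcal R_k:C^1_c(\tilde X_k,\mathbb C)\to C_c^0(\tilde{\mathcal A}),\qquad \mathcal R_k(\omega)(\tilde A)=\sum_{a\in\tilde A^1}\omega(a).$$ It takes values in $C_c^0(\tilde{\mathcal A})$ and is $G$-equivariant. *)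

theory Defs
  imports "HOL-Analysis.Analysis" "HOL-Algebra.Coset"
begin

section \<open>Non-archimedean local fields\<close>

definition uniformizer :: "('a::field \<Rightarrow> real) \<Rightarrow> 'a \<Rightarrow> bool" where
  "uniformizer av w \<longleftrightarrow> 0 < av w \<and> av w < 1 \<and> (\<forall>x. av x < 1 \<longrightarrow> av x \<le> av w)"

text \<open>A field that is complete for a (nontrivial) discrete non-archimedean absolute value and has
  finite residue field. The existence of a uniformizer says that the value group is discrete and
  nontrivial.\<close>

locale nonarch_local_field =
  fixes av :: "'a::field \<Rightarrow> real"
  assumes av_nonneg: "0 \<le> av x"
    and av_eq_0_iff: "av x = 0 \<longleftrightarrow> x = 0"
    and av_mult: "av (x * y) = av x * av y"
    and av_ultrametric: "av (x + y) \<le> max (av x) (av y)"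
    and ex_uniformizer: "\<exists>w. uniformizer av w"
    and av_complete: "Metric_space.mcomplete UNIV (\<lambda>x y. av (x - y))"
    and finite_residue_field:
      "finite ({x. av x \<le> 1} // {(x, y). av x \<le> 1 \<and> av y \<le> 1 \<and> av (x - y) < 1})"

definition field_topology :: "('a::field \<Rightarrow> real) \<Rightarrow> 'a topology" where
  "field_topology av = Metric_space.mtopology UNIV (\<lambda>x y. av (x - y))"


section \<open>Quotient topologies\<close>

definition quotient_topology :: "'x topology \<Rightarrow> ('x \<Rightarrow> 'y) \<Rightarrow> 'y topology" where
  "quotient_topology X f =
     topology (\<lambda>U. U \<subseteq> f ` topspace X \<and> openin X {x \<in> topspace X. f x \<in> U})"

lemma openin_quotient_topology:
  "openin (quotient_topology X f) U \<longleftrightarrow>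
     U \<subseteq> f ` topspace X \<and> openin X {x \<in> topspace X. f x \<in> U}"
proof -
  have "istopology (\<lambda>U. U \<subseteq> f ` topspace X \<and> openin X {x \<in> topspace X. f x \<in> U})"
    unfolding istopology_def
  proof (intro conjI allI impI)
    fix S T
    assume S: "S \<subseteq> f ` topspace X \<and> openin X {x \<in> topspace X. f x \<in> S}"
      and T: "T \<subseteq> f ` topspace X \<and> openin X {x \<in> topspace X. f x \<in> T}"
    show "S \<inter> T \<subseteq> f ` topspace X" using S by blast
    have "{x \<in> topspace X. f x \<in> S \<inter> T} =
        {x \<in> topspace X. f x \<in> S} \<inter> {x \<in> topspace X. f x \<in> T}" by blast
    then show "openin X {x \<in> topspace X. f x \<in> S \<inter> T}" using S T by auto
  next
    fix K
    assume K: "\<forall>S\<in>K. S \<subseteq> f ` topspace X \<and> openin X {x \<in> topspace X. f x \<in> S}"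
    show "\<Union>K \<subseteq> f ` topspace X" using K by blast
    have "{x \<in> topspace X. f x \<in> \<Union>K} = (\<Union>S\<in>K. {x \<in> topspace X. f x \<in> S})" by blast
    then show "openin X {x \<in> topspace X. f x \<in> \<Union>K}" using K by auto
  qed
  then show ?thesis unfolding quotient_topology_def by (simp add: topology_inverse')
qed

lemma quotient_map_quotient_topology: "quotient_map X (quotient_topology X f) f"
proof -
  have "{x \<in> topspace X. f x \<in> f ` topspace X} = topspace X" by blast
  then have "openin (quotient_topology X f) (f ` topspace X)"
    by (simp add: openin_quotient_topology)
  then have "topspace (quotient_topology X f) = f ` topspace X"
    by (meson openin_quotient_topology openin_subset openin_topspace subset_antisym)
  then show ?thesis by (auto simp: quotient_map_def openin_quotient_topology)
qed


section \<open>The group PGL(2,F), its torus, and their topologies\<close>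

definition GL2 :: "('a::field^2^2) monoid" where
  "GL2 = \<lparr>carrier = {A. invertible A}, mult = (**), one = mat 1\<rparr>"

definition scalars :: "('a::field^2^2) set" where
  "scalars = {mat c | c. c \<noteq> 0}"

definition PGL2 :: "('a::field^2^2) set monoid" where
  "PGL2 = GL2 Mod scalars"

definition torus :: "('a::field^2^2) set set" where
  "torus = {scalars #>\<^bsub>GL2\<^esub> A | A. A \<in> carrier GL2 \<and> A $ 1 $ 2 = 0 \<and> A $ 2 $ 1 = 0}"

definition GL2_topology :: "('a::field \<Rightarrow> real) \<Rightarrow> ('a^2^2) topology" where
  "GL2_topology av = pullback_topology (carrier GL2) (\<lambda>A (i, j). A $ i $ j)
     (product_topology (\<lambda>_. field_topology av) UNIV)"

definition PGL2_topology :: "('a::field \<Rightarrow> real) \<Rightarrow> ('a^2^2) set topology" where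
  "PGL2_topology av = quotient_topology (GL2_topology av) (\<lambda>A. scalars #>\<^bsub>GL2\<^esub> A)"

definition G_mod_T_topology :: "('a::field \<Rightarrow> real) \<Rightarrow> ('a^2^2) set set topology" where
  "G_mod_T_topology av = quotient_topology (PGL2_topology av) (\<lambda>g. g <#\<^bsub>PGL2\<^esub> torus)"


section \<open>The Bruhat-Tits tree\<close>

definition std_lattice :: "('a::field \<Rightarrow> real) \<Rightarrow> ('a^2) set" where
  "std_lattice av = {x. \<forall>i. av (x $ i) \<le> 1}"

text \<open>A lattice is the span, over the valuation ring, of a basis of \<open>F\<^sup>2\<close> (the columns of \<open>B\<close>).\<close>

definition is_lattice :: "('a::field \<Rightarrow> real) \<Rightarrow> ('a^2) set \<Rightarrow> bool" where
  "is_lattice av L \<longleftrightarrow> (\<exists>B :: 'a^2^2. invertible B \<and> L = (\<lambda>x. B *v x) ` std_lattice av)"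

definition homothety_class :: "('a::field^2) set \<Rightarrow> ('a^2) set set" where
  "homothety_class L = {(\<lambda>x. c *s x) ` L | c. c \<noteq> 0}"

type_synonym 'a vertex = "('a^2) set set"

definition vertices :: "('a::field \<Rightarrow> real) \<Rightarrow> 'a vertex set" where
  "vertices av = homothety_class ` {L. is_lattice av L}"

definition adjacent :: "('a::field \<Rightarrow> real) \<Rightarrow> 'a vertex \<Rightarrow> 'a vertex \<Rightarrow> bool" where
  "adjacent av s t \<longleftrightarrow> s \<in> vertices av \<and> t \<in> vertices av \<and>
     (\<exists>L\<in>s. \<exists>M\<in>t. \<exists>w. uniformizer av w \<and> (\<lambda>x. w *s x) ` L \<subset> M \<and> M \<subset> L)"

text \<open>An element of \<open>PGL2\<close> is a coset of matrices; any of its members sends a homothety class of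
  lattices onto the same homothety class.\<close>

definition vertex_act :: "('a::field^2^2) set \<Rightarrow> 'a vertex \<Rightarrow> 'a vertex" where
  "vertex_act g s = (\<Union>A\<in>g. (\<lambda>L. (\<lambda>x. A *v x) ` L) ` s)"


section \<open>Paths\<close>

text \<open>\<open>paths av k\<close> is the vertex set of the directed graph \<open>X\<^sub>k\<close>, and \<open>paths av (Suc k)\<close> its edge
  set; the edge \<open>a\<close> has head \<open>tl a\<close> and tail \<open>butlast a\<close>.\<close>

definition paths :: "('a::field \<Rightarrow> real) \<Rightarrow> nat \<Rightarrow> 'a vertex list set" where
  "paths av k = {p. length p = Suc k \<and> distinct p \<and> set p \<subseteq> vertices av \<and>
     (\<forall>i<k. adjacent av (p ! i) (p ! Suc i))}"


section \<open>Oriented apartments\<close>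

text \<open>An oriented apartment is a pair of the vertex set of a doubly infinite line and the set of
  its edges, directed according to one of the two directions.\<close>

type_synonym 'a oriented_apartment = "'a vertex set \<times> ('a vertex \<times> 'a vertex) set"

definition oriented_apartments :: "('a::field \<Rightarrow> real) \<Rightarrow> 'a oriented_apartment set" where
  "oriented_apartments av =
     {(range \<gamma>, range (\<lambda>i. (\<gamma> i, \<gamma> (i + 1)))) | \<gamma> :: int \<Rightarrow> 'a vertex.
        inj \<gamma> \<and> (\<forall>i. adjacent av (\<gamma> i) (\<gamma> (i + 1)))}"

definition apartment_act ::
    "('a::field^2^2) set \<Rightarrow> 'a oriented_apartment \<Rightarrow> 'a oriented_apartment" where
  "apartment_act g A =
     (vertex_act g ` fst A, (\<lambda>(s, t). (vertex_act g s, vertex_act g t)) ` snd A)"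

definition std_vertex :: "('a::field \<Rightarrow> real) \<Rightarrow> 'a \<Rightarrow> 'a vertex" where
  "std_vertex av a = homothety_class {x. av (x $ 1) \<le> av a \<and> av (x $ 2) \<le> 1}"

text \<open>The apartment stabilized by the diagonal torus, with one of its orientations.\<close>

definition std_apartment :: "('a::field \<Rightarrow> real) \<Rightarrow> 'a oriented_apartment" where
  "std_apartment av =
     ({std_vertex av a | a. a \<noteq> 0},
      {(std_vertex av a, std_vertex av (w * a)) | a w. a \<noteq> 0 \<and> uniformizer av w})"

text \<open>The topology of \<open>G/T\<close>, transported by the bijection that sends an oriented apartment \<open>A\<close> to
  the coset of all \<open>g\<close> mapping the standard oriented apartment to \<open>A\<close>.\<close>

definition apartment_topology :: "('a::field \<Rightarrow> real) \<Rightarrow> 'a oriented_apartment topology" where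
  "apartment_topology av = pullback_topology (oriented_apartments av)
     (\<lambda>A. {g \<in> carrier PGL2. apartment_act g (std_apartment av) = A}) (G_mod_T_topology av)"

definition apartment_paths ::
    "('a::field \<Rightarrow> real) \<Rightarrow> nat \<Rightarrow> 'a oriented_apartment \<Rightarrow> 'a vertex list set" where
  "apartment_paths av k A = {p \<in> paths av k. set p \<subseteq> fst A \<and> (\<forall>i<k. (p ! i, p ! Suc i) \<in> snd A)}"


section \<open>Complex G-modules of functions\<close>

text \<open>A function on a set \<open>S\<close> is represented by its extension by zero.\<close>

definition translate ::
    "('g, 'm) monoid_scheme \<Rightarrow> ('g \<Rightarrow> 'x \<Rightarrow> 'x) \<Rightarrow> 'x set \<Rightarrow> 'g \<Rightarrow> ('x \<Rightarrow> complex) \<Rightarrow> 'x \<Rightarrow> complex" where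
  "translate G \<alpha> S g f = (\<lambda>x. if x \<in> S then f (\<alpha> (inv\<^bsub>G\<^esub> g) x) else 0)"

definition fun_subspace :: "('x \<Rightarrow> complex) set \<Rightarrow> bool" where
  "fun_subspace V \<longleftrightarrow> (\<lambda>_. 0) \<in> V \<and> (\<forall>f\<in>V. \<forall>h\<in>V. (\<lambda>x. f x + h x) \<in> V) \<and>
     (\<forall>c. \<forall>f\<in>V. (\<lambda>x. c * f x) \<in> V)"

definition fun_linear ::
    "('x \<Rightarrow> complex) set \<Rightarrow> ('y \<Rightarrow> complex) set \<Rightarrow> (('x \<Rightarrow> complex) \<Rightarrow> 'y \<Rightarrow> complex) \<Rightarrow> bool" where
  "fun_linear V W \<phi> \<longleftrightarrow> \<phi> ` V \<subseteq> W \<and>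
     (\<forall>f\<in>V. \<forall>h\<in>V. \<phi> (\<lambda>x. f x + h x) = (\<lambda>y. \<phi> f y + \<phi> h y)) \<and>
     (\<forall>c. \<forall>f\<in>V. \<phi> (\<lambda>x. c * f x) = (\<lambda>y. c * \<phi> f y))"

definition G_module ::
    "('g, 'm) monoid_scheme \<Rightarrow> ('g \<Rightarrow> ('x \<Rightarrow> complex) \<Rightarrow> 'x \<Rightarrow> complex) \<Rightarrow> ('x \<Rightarrow> complex) set \<Rightarrow> bool" where
  "G_module G \<rho> V \<longleftrightarrow> group G \<and> fun_subspace V \<and> (\<forall>g\<in>carrier G. fun_linear V V (\<rho> g)) \<and>
     (\<forall>f\<in>V. \<rho> \<one>\<^bsub>G\<^esub> f = f) \<and>
     (\<forall>g\<in>carrier G. \<forall>h\<in>carrier G. \<forall>f\<in>V. \<rho> (g \<otimes>\<^bsub>G\<^esub> h) f = \<rho> g (\<rho> h f))"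

definition G_hom ::
    "('g, 'm) monoid_scheme \<Rightarrow> ('g \<Rightarrow> ('x \<Rightarrow> complex) \<Rightarrow> 'x \<Rightarrow> complex) \<Rightarrow> ('x \<Rightarrow> complex) set \<Rightarrow>
      ('g \<Rightarrow> ('y \<Rightarrow> complex) \<Rightarrow> 'y \<Rightarrow> complex) \<Rightarrow> ('y \<Rightarrow> complex) set \<Rightarrow>
      (('x \<Rightarrow> complex) \<Rightarrow> 'y \<Rightarrow> complex) \<Rightarrow> bool" where
  "G_hom G \<rho> V \<sigma> W \<phi> \<longleftrightarrow> G_module G \<rho> V \<and> G_module G \<sigma> W \<and> fun_linear V W \<phi> \<and>
     (\<forall>g\<in>carrier G. \<forall>f\<in>V. \<phi> (\<rho> g f) = \<sigma> g (\<phi> f))"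

definition path_rep ::
    "('a::field \<Rightarrow> real) \<Rightarrow> nat \<Rightarrow> ('a^2^2) set \<Rightarrow> ('a vertex list \<Rightarrow> complex) \<Rightarrow> 'a vertex list \<Rightarrow> complex" where
  "path_rep av k = translate PGL2 (\<lambda>g. map (vertex_act g)) (paths av k)"

definition apartment_rep ::
    "('a::field \<Rightarrow> real) \<Rightarrow> ('a^2^2) set \<Rightarrow> ('a oriented_apartment \<Rightarrow> complex) \<Rightarrow> 'a oriented_apartment \<Rightarrow> complex" where
  "apartment_rep av = translate PGL2 apartment_act (oriented_apartments av)"


section \<open>Cochains, cohomology and the geodesic Radon transform\<close>

text \<open>The finitely supported functions on \<open>paths av k\<close>: the 0-cochains of \<open>X\<^sub>k\<close>,
  and the 1-cochains of \<open>X\<^sub>j\<close> for \<open>k = Suc j\<close>.\<close>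

definition path_funs :: "('a::field \<Rightarrow> real) \<Rightarrow> nat \<Rightarrow> ('a vertex list \<Rightarrow> complex) set" where
  "path_funs av k = {f. {x. f x \<noteq> 0} \<subseteq> paths av k \<and> finite {x. f x \<noteq> 0}}"

abbreviation C0c :: "('a::field \<Rightarrow> real) \<Rightarrow> nat \<Rightarrow> ('a vertex list \<Rightarrow> complex) set" where
  "C0c av k \<equiv> path_funs av k"

abbreviation C1c :: "('a::field \<Rightarrow> real) \<Rightarrow> nat \<Rightarrow> ('a vertex list \<Rightarrow> complex) set" where
  "C1c av k \<equiv> path_funs av (Suc k)"

definition coboundary ::
    "('a::field \<Rightarrow> real) \<Rightarrow> nat \<Rightarrow> ('a vertex list \<Rightarrow> complex) \<Rightarrow> 'a vertex list \<Rightarrow> complex" where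
  "coboundary av k f = (\<lambda>a. if a \<in> paths av (Suc k) then f (tl a) - f (butlast a) else 0)"

definition H1c :: "('a::field \<Rightarrow> real) \<Rightarrow> nat \<Rightarrow> ('a vertex list \<Rightarrow> complex) set set" where
  "H1c av k = C1c av k // {(\<omega>, \<eta>). \<omega> \<in> C1c av k \<and> \<eta> \<in> C1c av k \<and>
     (\<lambda>a. \<omega> a - \<eta> a) \<in> coboundary av k ` C0c av k}"

definition apartment_funs :: "('a::field \<Rightarrow> real) \<Rightarrow> ('a oriented_apartment \<Rightarrow> complex) set" where
  "apartment_funs av = {f. {A. f A \<noteq> 0} \<subseteq> oriented_apartments av \<and>
     (\<forall>A\<in>oriented_apartments av. \<exists>U. openin (apartment_topology av) U \<and> A \<in> U \<and> (\<forall>B\<in>U. f B = f A)) \<and>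
     compactin (apartment_topology av) (apartment_topology av closure_of {A. f A \<noteq> 0})}"

text \<open>The sum over all edges of the apartment has finitely many nonzero terms
  because \<open>\<omega>\<close> is finitely supported.\<close>

definition radon ::
    "('a::field \<Rightarrow> real) \<Rightarrow> nat \<Rightarrow> ('a vertex list \<Rightarrow> complex) \<Rightarrow> 'a oriented_apartment \<Rightarrow> complex" where
  "radon av k \<omega> = (\<lambda>A. if A \<in> oriented_apartments av
     then \<Sum>a | a \<in> apartment_paths av (Suc k) A \<and> \<omega> a \<noteq> 0. \<omega> a else 0)"

definition radon_bar ::
    "('a::field \<Rightarrow> real) \<Rightarrow> nat \<Rightarrow> ('a vertex list \<Rightarrow> complex) set \<Rightarrow> 'a oriented_apartment \<Rightarrow> complex" where
  "radon_bar av k c = the_elem (radon av k ` c)"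

end

(* Vertices of the tree are identified with closed balls of F, so that adjacency means inclusion of
   balls with consecutive radii and a non-backtracking path that once descends descends forever.
   Hence non-backtracking paths are injective, and completeness of F makes PGL(2,F) transitive on
   oriented apartments, with oriented apartments sharing a long segment with the standard one being
   its translates by matrices near 1.

   Exactness: if the Radon transform of w vanishes, the sum of w over the backward half of a line
   ending in a k-path s is minus the sum over any forward half starting from s, so it depends on s
   only. This function of s is a primitive of w. It is finitely supported because it vanishes
   unless s lies on a geodesic between vertices met by the support of w.

   Image: the oriented apartments through a path form a compact open set, these sets are a basis of
   the topology, and their indicator functions are the Radon transforms of Dirac cochains. Koenig's
   lemma on two-sided extensions of a path then decomposes every locally constant compactly
   supported function into such indicators. *)

theory Submission
  imports Defs "HOL-Library.Groups_Big_Fun"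
begin

text \<open>A line is defined by two local conditions, adjacency and absence of backtracking;
  injectivity is a consequence. This makes cutting and gluing cheap: two half-lines join to a line
  as soon as they agree at the junction and leave it through different vertices. Extension of paths
  to lines, uniqueness of geodesics and well-definedness of the primitive all come from such
  gluings.

  Coordinates are used only near the standard apartment: an arbitrary edge is moved to the balls of
  radius 1 and \<open>rad 1\<close> around 0, and whatever is claimed is computed there.

  The topology on apartments is reached through three passages, from GL2 to PGL2, to G/T and to
  apartments. To undo them, the fibre of the orbit map over an apartment must be shown to be exactly
  a coset of the torus; openness then becomes an epsilon condition on matrix entries.

  The level k needed for a function depends on how finely it varies, since Dirac cochains at level k
  give indicators of paths with k+2 vertices. Apartments through different edges overlap, so a
  function is decomposed by subtracting its restrictions one edge at a time.\<close>

section \<open>The absolute value\<close>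

context nonarch_local_field
begin

definition unif :: 'a where "unif = (SOME w. uniformizer av w)"

lemma uniformizer_unif: "uniformizer av unif"
  unfolding unif_def by (rule someI_ex[OF ex_uniformizer])

lemma av_unif_pos: "0 < av unif" and av_unif_less_1: "av unif < 1"
  and av_less_1_iff: "av x < 1 \<longleftrightarrow> av x \<le> av unif"
  using uniformizer_unif unfolding uniformizer_def by force+

lemma av_uniformizer: "uniformizer av w \<Longrightarrow> av w = av unif"
  using uniformizer_unif unfolding uniformizer_def by (meson order_antisym)

lemma unif_nonzero [simp]: "unif \<noteq> 0"
  using av_unif_pos av_eq_0_iff by (metis less_irrefl)

lemma av_0 [simp]: "av 0 = 0"
  by (simp add: av_eq_0_iff)

lemma av_pos_iff: "0 < av x \<longleftrightarrow> x \<noteq> 0"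
  using av_nonneg[of x] av_eq_0_iff[of x] by linarith

lemma av_1 [simp]: "av 1 = 1"
proof -
  have "av 1 * av 1 = av 1 * 1" using av_mult[of 1 1] by simp
  moreover have "av 1 \<noteq> 0" by (simp add: av_eq_0_iff)
  ultimately show ?thesis by (metis mult_cancel_left)
qed

lemma av_minus [simp]: "av (- x) = av x"
proof -
  have "av (-1) * av (-1) = 1" using av_mult[of "-1" "-1"] by simp
  then have "av (-1) = 1"
    by (metis abs_of_nonneg av_nonneg real_sqrt_abs2 real_sqrt_one)
  then show ?thesis using av_mult[of "-1" x] by simp
qed

lemma av_minus_commute: "av (x - y) = av (y - x)"
  using av_minus[of "x - y"] by simp

lemma av_add_le: "av x \<le> c \<Longrightarrow> av y \<le> c \<Longrightarrow> av (x + y) \<le> c"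
  using av_ultrametric[of x y] by linarith

lemma av_diff_le: "av x \<le> c \<Longrightarrow> av y \<le> c \<Longrightarrow> av (x - y) \<le> c"
  using av_add_le[of x c "- y"] by simp

lemma av_add_less: "av x < c \<Longrightarrow> av y < c \<Longrightarrow> av (x + y) < c"
  using av_ultrametric[of x y] by linarith

lemma av_diff_trans: "av (x - y) \<le> c \<Longrightarrow> av (y - z) \<le> c \<Longrightarrow> av (x - z) \<le> c"
  using av_add_le[of "x - y" c "y - z"] by simp

text \<open>Isosceles principle: the reverse inequality comes from writing \<open>x\<close> as
  \<open>(x + y) + (- y)\<close>.\<close>

lemma av_add_eq: "av y < av x \<Longrightarrow> av (x + y) = av x"
  using av_ultrametric[of x y] av_ultrametric[of "x + y" "- y"] by simp

lemma av_inverse: "av (inverse x) = inverse (av x)"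
proof (cases "x = 0")
  case False
  then have "av x * av (inverse x) = 1" using av_mult[of x "inverse x"] by simp
  then show ?thesis by (metis inverse_unique)
qed simp

lemma av_divide: "av (x / y) = av x / av y"
  by (simp add: divide_inverse av_mult av_inverse)

lemma av_power: "av (x ^ n) = av x ^ n"
  by (induction n) (simp_all add: av_mult)

lemma av_power_int: "av (x powi n) = av x powi n"
  by (simp add: power_int_def av_power av_inverse power_inverse)

text \<open>These are exactly the nonzero values of \<open>av\<close>. Since
  \<open>av unif < 1\<close>, the radius decreases as the index grows, which is why the order rules
  below reverse the inequality.\<close>

definition rad :: "int \<Rightarrow> real" where "rad i = av unif powi i"

lemma rad_pos [simp]: "0 < rad i"
  unfolding rad_def using av_unif_pos by simp

lemma rad_neq_0 [simp]: "rad i \<noteq> 0"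
  using rad_pos[of i] by linarith

lemma rad_nonneg [simp]: "0 \<le> rad i"
  using rad_pos[of i] by linarith

lemma rad_0 [simp]: "rad 0 = 1"
  by (simp add: rad_def)

lemma rad_1: "rad 1 = av unif"
  by (simp add: rad_def)

lemma rad_add: "rad (i + j) = rad i * rad j"
  unfolding rad_def using av_unif_pos by (simp add: power_int_add)

lemma rad_minus: "rad (- i) = inverse (rad i)"
  unfolding rad_def by (simp add: power_int_minus)

lemma av_unif_powi: "av (unif powi i) = rad i"
  by (simp add: rad_def av_power_int)

lemma unif_powi_nonzero [simp]: "unif powi i \<noteq> 0"
  by simp

lemma rad_less_iff [simp]: "rad i < rad j \<longleftrightarrow> j < i"
proof -
  have *: "rad i < rad j" if "j < i" for i j
  proof -
    have "rad i = rad j * av unif ^ nat (i - j)"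
      using that rad_add[of j "i - j"] by (simp add: rad_def power_int_def)
    moreover have "av unif ^ nat (i - j) < 1"
      using that av_unif_less_1 av_unif_pos by (intro power_less_one_iff[THEN iffD2]) auto
    ultimately show ?thesis using rad_pos[of j] by simp
  qed
  show ?thesis using *[of i j] *[of j i] by (metis less_asym less_irrefl linorder_neqE)
qed

lemma rad_le_iff [simp]: "rad i \<le> rad j \<longleftrightarrow> j \<le> i"
  using rad_less_iff[of j i] by linarith

lemma rad_eq_iff [simp]: "rad i = rad j \<longleftrightarrow> i = j"
  using rad_le_iff[of j i] rad_le_iff[of i j] by (metis order_antisym order_refl)

lemma rad_eq_1_iff [simp]: "rad i = 1 \<longleftrightarrow> i = 0"
  using rad_eq_iff[of i 0] by simp

lemma rad_le_1_iff [simp]: "rad i \<le> 1 \<longleftrightarrow> 0 \<le> i"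
  using rad_le_iff[of i 0] by simp

lemma one_le_rad_iff [simp]: "1 \<le> rad i \<longleftrightarrow> i \<le> 0"
  using rad_le_iff[of 0 i] by simp

lemma rad_arbitrarily_small: "0 < e \<Longrightarrow> \<exists>n. rad (int n) < e"
  unfolding rad_def using real_arch_pow_inv[of e "av unif"] av_unif_less_1 by simp

lemma rad_arbitrarily_large: "\<exists>n. c < rad (- int n)"
proof -
  have "0 < inverse (max c 0 + 1)" by simp
  then obtain n where "rad (int n) < inverse (max c 0 + 1)"
    using rad_arbitrarily_small by blast
  then have "max c 0 + 1 < inverse (rad (int n))"
    by (metis inverse_inverse_eq inverse_less_iff_less less_imp_inverse_less rad_pos)
  then show ?thesis by (intro exI[of _ n]) (simp add: rad_minus)
qed

lemma av_less_1_rad: "av x < 1 \<longleftrightarrow> av x \<le> rad 1"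
  by (simp add: rad_1 av_less_1_iff)

text \<open>Discreteness in usable form: no value lies strictly between \<open>rad (i + 1)\<close>
  and \<open>rad i\<close>. Dividing by \<open>unif powi i\<close> reduces this to the maximality of
  a uniformizer among values below 1.\<close>

lemma av_less_rad: "av x < rad i \<longleftrightarrow> av x \<le> rad (i + 1)"
proof -
  have "av x < rad i \<longleftrightarrow> av (x / unif powi i) < 1"
    by (simp add: av_divide av_unif_powi divide_less_eq)
  also have "\<dots> \<longleftrightarrow> av x \<le> rad (i + 1)"
    by (simp add: av_less_1_rad rad_add[of i 1]) (simp add: av_divide av_unif_powi divide_le_eq mult.commute)
  finally show ?thesis .
qed

lemma av_eq_rad:
  assumes "x \<noteq> 0"
  obtains i where "av x = rad i"
proof -
  have x: "0 < av x" using assms by (simp add: av_pos_iff)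
  obtain m where m: "av x < rad (- int m)" using rad_arbitrarily_large by blast
  obtain n where n: "rad (int n) < av x" using rad_arbitrarily_small x by blast
  \<comment> \<open>If the bound \<open>av x \<le> rad i\<close> never broke down between
    \<open>- int m\<close> and \<open>int n\<close>, it would propagate upward to
    \<open>int n\<close>, against the choice of \<open>n\<close>.\<close>
  have "\<exists>i. - int m \<le> i \<and> i < int n \<and> av x \<le> rad i \<and> \<not> av x \<le> rad (i + 1)"
  proof (rule ccontr)
    assume a: "\<not> ?thesis"
    have mn: "- int m \<le> int n" using m n by (metis less_trans nle_le rad_le_iff not_less)
    have "j \<le> int n \<longrightarrow> av x \<le> rad j" if "- int m \<le> j" for j
      using that
    proof (induction j rule: int_ge_induct)
      case base then show ?case using m by simp
    next
      case (step j) then show ?case using a by auto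
    qed
    then show False using mn n by (meson linorder_not_less order_refl)
  qed
  then obtain i where "av x \<le> rad i" "\<not> av x \<le> rad (i + 1)" by blast
  then have "av x = rad i" using av_less_rad[of x i] by linarith
  then show thesis by (rule that)
qed

end

section \<open>Two by two matrices\<close>

definition mat2 :: "'a::zero \<Rightarrow> 'a \<Rightarrow> 'a \<Rightarrow> 'a \<Rightarrow> 'a^2^2" where
  "mat2 a b c d = vector [vector [a, b], vector [c, d]]"

lemma mat2_nth [simp]:
  fixes a :: "'a::zero"
  shows "mat2 a b c d $ 1 $ 1 = a" "mat2 a b c d $ 1 $ 2 = b"
    "mat2 a b c d $ 2 $ 1 = c" "mat2 a b c d $ 2 $ 2 = d"
  by (simp_all add: mat2_def)

lemma mat2_eqI:
  assumes "A $ 1 $ 1 = B $ 1 $ 1" "A $ 1 $ 2 = B $ 1 $ 2" "A $ 2 $ 1 = B $ 2 $ 1" "A $ 2 $ 2 = B $ 2 $ 2"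
  shows "A = (B :: 'a^2^2)"
  using assms by (simp add: vec_eq_iff forall_2)

lemma mult_vec_2:
  fixes A :: "'a::semiring_1^2^2"
  shows "(A *v x) $ i = A $ i $ 1 * x $ 1 + A $ i $ 2 * x $ 2"
  by (simp add: matrix_vector_mult_def sum_2)

lemma matrix_mult_2:
  fixes A B :: "'a::semiring_1^2^2"
  shows "(A ** B) $ i $ j = A $ i $ 1 * B $ 1 $ j + A $ i $ 2 * B $ 2 $ j"
  by (simp add: matrix_matrix_mult_def sum_2)

lemma mat_1_nth_2 [simp]:
  "(mat c :: 'a::zero^2^2) $ 1 $ 1 = c" "(mat c :: 'a^2^2) $ 1 $ 2 = 0"
  "(mat c :: 'a^2^2) $ 2 $ 1 = 0" "(mat c :: 'a^2^2) $ 2 $ 2 = c"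
  by (simp_all add: mat_def)

lemma invertible_mat2:
  fixes a :: "'a::field"
  assumes "a * d - b * c \<noteq> 0"
  shows "invertible (mat2 a b c d)"
proof -
  define e where "e = a * d - b * c"
  have e: "e \<noteq> 0" "a * d = e + b * c" "d * a = e + b * c" using assms by (simp_all add: e_def algebra_simps)
  let ?B = "mat2 (d / e) (- b / e) (- c / e) (a / e)"
  have "mat2 a b c d ** ?B = mat 1" "?B ** mat2 a b c d = mat 1"
    using e by (auto intro!: mat2_eqI simp: matrix_mult_2 add_divide_distrib mult.commute)
  then show ?thesis unfolding invertible_def by blast
qed

lemma vector_eqI_2: "x $ 1 = y $ 1 \<Longrightarrow> x $ 2 = y $ 2 \<Longrightarrow> x = (y :: 'b^2)"
  by (simp add: vec_eq_iff forall_2)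

text \<open>Used to compute images of lattices under bijections: one membership equivalence and
  surjectivity replace two inclusions.\<close>

lemma image_eqI_mem_iff: "(\<And>x. f x \<in> B \<longleftrightarrow> x \<in> A) \<Longrightarrow> (\<And>y. \<exists>x. y = f x) \<Longrightarrow> f ` A = B"
proof (intro equalityI subsetI)
  fix y assume mem: "\<And>x. f x \<in> B \<longleftrightarrow> x \<in> A" and surj: "\<And>y. \<exists>x. y = f x" and y: "y \<in> B"
  obtain x where "y = f x" using surj by blast
  then show "y \<in> f ` A" using mem[of x] y by blast
qed auto

lemma invertible_cancel:
  fixes M :: "'a::field^2^2"
  assumes "invertible M"
  obtains N where "invertible N" "M ** N = mat 1" "N ** M = mat 1"
  using assms unfolding invertible_def by blast

lemma homothety_class_scale:
  fixes L :: "('a::field^2) set"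
  assumes "c \<noteq> 0"
  shows "homothety_class ((*s) c ` L) = homothety_class L"
proof -
  have "(*s) d ` (*s) c ` L = (*s) (d * c) ` L" for d
    by (simp add: image_image)
  then have "homothety_class ((*s) c ` L) = {(*s) (d * c) ` L | d. d \<noteq> 0}"
    by (simp add: homothety_class_def)
  also have "\<dots> = {(*s) d ` L | d. d \<noteq> 0}"
  proof (intro equalityI subsetI)
    fix A assume "A \<in> {(*s) d ` L | d. d \<noteq> 0}"
    then obtain d where "d \<noteq> 0" "A = (*s) d ` L" by blast
    then have "A = (*s) ((d / c) * c) ` L" "d / c \<noteq> 0" using assms by simp_all
    then show "A \<in> {(*s) (d * c) ` L | d. d \<noteq> 0}" by blast
  qed (use assms in auto)
  finally show ?thesis by (simp add: homothety_class_def)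
qed

lemma homothety_class_self: "L \<in> homothety_class (L :: ('a::field^2) set)"
  unfolding homothety_class_def by (auto intro!: exI[of _ 1])

lemma homothety_class_eqE:
  fixes L :: "('a::field^2) set"
  assumes "homothety_class L = homothety_class M"
  obtains c where "c \<noteq> 0" "L = (*s) c ` M"
  using homothety_class_self[of L] assms unfolding homothety_class_def by auto

section \<open>The tree of balls\<close>

text \<open>Matrix-level form of \<open>vertex_act\<close>; the two agree on vertices by
  \<open>vertex_act_proj\<close>, so cosets can be avoided until the group PGL2 itself is
  needed.\<close>

definition vact :: "'a::field^2^2 \<Rightarrow> 'a vertex \<Rightarrow> 'a vertex" where
  "vact M s = (\<lambda>L. (*v) M ` L) ` s"

lemma vact_mult: "vact (M ** N) s = vact M (vact N s)"
  by (simp add: vact_def image_image matrix_vector_mul_assoc)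

lemma vact_1 [simp]: "vact (mat 1) s = s"
  by (simp add: vact_def)

lemma vact_homothety_class: "vact M (homothety_class L) = homothety_class ((*v) M ` L)"
proof -
  have "(*v) M ` (*s) c ` L = (*s) c ` (*v) M ` L" for c
    by (simp add: image_image vector_scalar_commute)
  then show ?thesis unfolding vact_def homothety_class_def by (auto simp: image_iff) metis+
qed

lemma vact_cancel: "N ** M = mat 1 \<Longrightarrow> vact N (vact M s) = s"
  by (simp flip: vact_mult)

lemma vact_eq_iff:
  assumes "invertible M"
  shows "vact M s = vact M t \<longleftrightarrow> s = t"
  using assms by (metis invertible_cancel vact_cancel)

lemma inj_matrix_vector_mult:
  fixes M :: "'a::field^2^2"
  assumes "invertible M"
  shows "inj ((*v) M)"
  by (rule invertible_cancel[OF assms]) (metis injI matrix_vector_mul_assoc matrix_vector_mul_lid)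

text \<open>The Weyl element: it reverses the standard apartment, hence transfers statements about
  one of its ends to the other.\<close>

definition weyl :: "'a::field^2^2" where "weyl = mat2 0 1 1 0"

lemma invertible_weyl: "invertible (weyl :: 'a::field^2^2)"
  unfolding weyl_def by (rule invertible_mat2) simp

lemma weyl_weyl: "weyl ** weyl = (mat 1 :: 'a::field^2^2)"
  by (rule mat2_eqI) (simp_all add: weyl_def matrix_mult_2)

context nonarch_local_field
begin

text \<open>The span over the valuation ring of the columns (\<open>unif powi i\<close>, 0) and
  (\<open>b\<close>, 1). It depends on \<open>b\<close> only up to \<open>rad i\<close>, as a closed
  ball does on its centre.\<close>

definition lat :: "'a \<Rightarrow> int \<Rightarrow> ('a^2) set" where
  "lat b i = {x. av (x $ 1 - b * x $ 2) \<le> rad i \<and> av (x $ 2) \<le> 1}"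

text \<open>The vertex \<open>bvert b i\<close> stands for the closed ball in \<open>F\<close> with centre \<open>b\<close> and radius \<open>rad i\<close>;
  the standard apartment consists of the balls with centre \<open>0\<close>.\<close>

definition bvert :: "'a \<Rightarrow> int \<Rightarrow> 'a vertex" where
  "bvert b i = homothety_class (lat b i)"

lemma std_vertex_bvert: "av a = rad i \<Longrightarrow> std_vertex av a = bvert 0 i"
  by (simp add: std_vertex_def bvert_def lat_def)

lemma std_lattice_lat: "std_lattice av = lat 0 0"
  by (auto simp: std_lattice_def lat_def forall_2)

text \<open>The matrix acts on balls as the affine map taking t to a t + c: it moves the centre
  accordingly and multiplies the radius by \<open>av a\<close>.\<close>

lemma lat_affine_image:
  assumes a: "av a = rad j"
  shows "(*v) (mat2 a c 0 1) ` lat b i = lat (a * b + c) (j + i)"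
proof -
  have a0: "a \<noteq> 0" using a by auto
  have eq: "a * x + c * y - (a * b + c) * y = a * (x - b * y)" for x y
    by (simp add: algebra_simps)
  have "(*v) (mat2 a c 0 1) x \<in> lat (a * b + c) (j + i) \<longleftrightarrow> x \<in> lat b i" for x
    by (simp add: lat_def mult_vec_2 eq) (simp add: av_mult a rad_add)
  moreover have "\<exists>x. y = mat2 a c 0 1 *v x" for y
    using a0 by (intro exI[of _ "vector [(y $ 1 - c * y $ 2) / a, y $ 2]"])
      (auto intro!: vector_eqI_2 simp: mult_vec_2)
  ultimately show ?thesis by (rule image_eqI_mem_iff)
qed

lemma vact_affine:
  "av a = rad j \<Longrightarrow> vact (mat2 a c 0 1) (bvert b i) = bvert (a * b + c) (j + i)"
  by (simp add: bvert_def vact_homothety_class lat_affine_image)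

lemma vact_translation: "vact (mat2 1 c 0 1) (bvert b i) = bvert (b + c) i"
  using vact_affine[of 1 0] by simp

text \<open>Swapping the coordinates of \<open>lat 0 i\<close> yields a lattice that is not itself
  \<open>lat 0 (- i)\<close>, but its multiple by \<open>unif powi i\<close>.\<close>

lemma vact_weyl: "vact weyl (bvert 0 i) = bvert 0 (- i)"
proof -
  have "(*v) weyl x \<in> (*s) (unif powi i) ` lat 0 (- i) \<longleftrightarrow> x \<in> lat 0 i" for x
  proof -
    have "(*v) weyl x \<in> (*s) (unif powi i) ` lat 0 (- i) \<longleftrightarrow>
        inverse (unif powi i) *s (weyl *v x) \<in> lat 0 (- i)"
    proof
      assume "inverse (unif powi i) *s (weyl *v x) \<in> lat 0 (- i)"
      then have "unif powi i *s (inverse (unif powi i) *s (weyl *v x))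
          \<in> (*s) (unif powi i) ` lat 0 (- i)" by (rule imageI)
      then show "(*v) weyl x \<in> (*s) (unif powi i) ` lat 0 (- i)" by simp
    qed (auto simp: image_iff)
    also have "\<dots> \<longleftrightarrow> x \<in> lat 0 i"
    proof -
      have "inverse (rad i) * t \<le> inverse (rad i) \<longleftrightarrow> t \<le> 1"
        "inverse (rad i) * t \<le> 1 \<longleftrightarrow> t \<le> rad i" for t
        using rad_pos[of i] by (simp_all add: field_simps del: rad_pos)
      then show ?thesis
        by (auto simp: lat_def weyl_def mult_vec_2 av_mult av_inverse av_unif_powi rad_minus)
    qed
    finally show ?thesis .
  qed
  moreover have "\<exists>x. y = weyl *v x" for y :: "'a^2"
    by (intro exI[of _ "weyl *v y"]) (simp add: matrix_vector_mul_assoc weyl_weyl)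
  ultimately have "(*v) weyl ` lat 0 i = (*s) (unif powi i) ` lat 0 (- i)"
    by (rule image_eqI_mem_iff)
  then show ?thesis
    by (simp add: bvert_def vact_homothety_class homothety_class_scale)
qed

lemma lat_eq:
  assumes "av (b - b') \<le> rad i"
  shows "lat b i = lat b' i"
proof -
  have "lat b i \<subseteq> lat b' i" if "av (b - b') \<le> rad i" for b b'
  proof
    fix x assume x: "x \<in> lat b i"
    have "av ((b - b') * x $ 2) \<le> rad i * 1"
      unfolding av_mult using that x by (intro mult_mono) (auto simp: lat_def av_nonneg)
    then have "av ((x $ 1 - b * x $ 2) + (b - b') * x $ 2) \<le> rad i"
      using x by (intro av_add_le) (auto simp: lat_def)
    then show "x \<in> lat b' i" using x by (simp add: lat_def algebra_simps)
  qed
  then show ?thesis using assms av_minus_commute[of b b'] by (metis order_antisym)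
qed

text \<open>A homothety between the two lattices is tested on their generators: the vectors with
  second entry 1 force the factor \<open>c\<close> to have absolute value 1 and bound the distance
  of the centres, those with second entry 0 force equal radii.\<close>

lemma bvert_eq_iff: "bvert b i = bvert b' j \<longleftrightarrow> i = j \<and> av (b - b') \<le> rad i"
proof
  assume "bvert b i = bvert b' j"
  then obtain c where c: "c \<noteq> 0" and eq: "lat b i = (*s) c ` lat b' j"
    unfolding bvert_def by (rule homothety_class_eqE)
  have mem: "x \<in> lat b i \<longleftrightarrow> inverse c *s x \<in> lat b' j" for x
  proof
    assume "inverse c *s x \<in> lat b' j"
    then have "c *s (inverse c *s x) \<in> lat b i" unfolding eq by (rule imageI)
    then show "x \<in> lat b i" using c by simp
  qed (use c in \<open>auto simp: eq\<close>)
  have "inverse c *s vector [b, 1] \<in> lat b' j"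
    unfolding mem[symmetric] by (simp add: lat_def)
  then have 1: "inverse (av c) \<le> 1" and b: "av (inverse c * b - b' * inverse c) \<le> rad j"
    by (simp_all add: lat_def av_inverse)
  have "c *s vector [b', 1] \<in> lat b i"
    unfolding mem using c by (simp add: lat_def)
  then have "av c \<le> 1" by (simp add: lat_def)
  with 1 c have c1: "av c = 1"
    by (metis av_pos_iff inverse_le_1_iff not_less order_antisym)
  have "inverse c *s vector [unif powi i, 0] \<in> lat b' j"
    unfolding mem[symmetric] by (simp add: lat_def av_unif_powi)
  then have ij: "j \<le> i" by (simp add: lat_def av_mult av_inverse c1 av_unif_powi)
  have "c *s vector [unif powi j, 0] \<in> lat b i"
    unfolding mem using c by (simp add: lat_def av_unif_powi)
  then have ji: "i \<le> j" by (simp add: lat_def av_mult c1 av_unif_powi)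
  have "inverse c * b - b' * inverse c = inverse c * (b - b')" by (simp add: algebra_simps)
  then show "i = j \<and> av (b - b') \<le> rad i" using b ij ji by (simp add: av_mult av_inverse c1)
next
  assume "i = j \<and> av (b - b') \<le> rad i"
  then show "bvert b i = bvert b' j" using lat_eq[of b b' i] by (auto simp: bvert_def)
qed

section \<open>Lattices as modules over the valuation ring\<close>

lemma is_lattice_std: "is_lattice av (lat 0 0)"
  unfolding is_lattice_def
  by (intro exI[of _ "mat 1"]) (simp add: std_lattice_lat invertible_def)

lemma is_lattice_image: "invertible M \<Longrightarrow> is_lattice av L \<Longrightarrow> is_lattice av ((*v) M ` L)"
  unfolding is_lattice_def
  by (auto simp: image_image matrix_vector_mul_assoc intro: invertible_mult)

lemma is_lattice_scale:
  assumes "c \<noteq> 0" "is_lattice av L"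
  shows "is_lattice av ((*s) c ` L)"
proof -
  have "mat2 c 0 0 c *v x = c *s x" for x
    by (rule vector_eqI_2) (simp_all add: mult_vec_2)
  then show ?thesis
    using is_lattice_image[of "mat2 c 0 0 c" L] assms by (simp add: invertible_mat2)
qed

lemma lattice_add:
  assumes "is_lattice av L" "x \<in> L" "y \<in> L"
  shows "x + y \<in> L"
proof -
  obtain B where B: "L = (*v) B ` std_lattice av" using assms(1) by (auto simp: is_lattice_def)
  then obtain x' y' where "x' \<in> std_lattice av" "y' \<in> std_lattice av" "x = B *v x'" "y = B *v y'"
    using assms by blast
  then show ?thesis unfolding B
    by (intro image_eqI[of _ _ "x' + y'"])
      (auto simp: matrix_vector_right_distrib std_lattice_def av_add_le)
qed

lemma lattice_scale:
  assumes "is_lattice av L" "x \<in> L" "av c \<le> 1"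
  shows "c *s x \<in> L"
proof -
  obtain B where B: "L = (*v) B ` std_lattice av" using assms(1) by (auto simp: is_lattice_def)
  then obtain x' where "x' \<in> std_lattice av" "x = B *v x'"
    using assms by blast
  then show ?thesis unfolding B using assms(3)
    by (intro image_eqI[of _ _ "c *s x'"])
      (auto simp: vector_scalar_commute std_lattice_def av_mult av_nonneg mult_le_one)
qed

lemma lattice_diff:
  assumes "is_lattice av L" "x \<in> L" "y \<in> L"
  shows "x - y \<in> L"
  using lattice_add[OF assms(1,2) lattice_scale[OF assms(1,3), of "- 1"]]
  by (simp add: vector_sneg_minus1[symmetric])

lemma vertexD:
  assumes "s \<in> vertices av" "L \<in> s"
  shows "is_lattice av L" "s = homothety_class L"
proof -
  obtain L' c where "is_lattice av L'" "s = homothety_class L'" "c \<noteq> 0" "L = (*s) c ` L'"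
    using assms by (auto simp: vertices_def homothety_class_def)
  then show "is_lattice av L" "s = homothety_class L"
    by (simp_all add: is_lattice_scale homothety_class_scale)
qed

lemma vertex_transitive:
  assumes "s \<in> vertices av"
  obtains M where "invertible M" "s = vact M (bvert 0 0)"
  using assms by (auto simp: vertices_def is_lattice_def bvert_def std_lattice_lat vact_homothety_class)

lemma bvert_vertex: "bvert b i \<in> vertices av"
proof -
  have "is_lattice av (lat b i)"
    using is_lattice_image[OF invertible_mat2 is_lattice_std, of "unif powi i" 1 b 0]
    by (simp add: lat_affine_image[OF av_unif_powi] invertible_mat2)
  then show ?thesis by (simp add: vertices_def bvert_def)
qed

lemma vact_vertex: "invertible M \<Longrightarrow> s \<in> vertices av \<Longrightarrow> vact M s \<in> vertices av"
  by (auto simp: vertices_def vact_homothety_class intro!: imageI is_lattice_image)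

section \<open>Adjacency in ball coordinates\<close>

lemma adjacent_vertices: "adjacent av s t \<Longrightarrow> s \<in> vertices av" "adjacent av s t \<Longrightarrow> t \<in> vertices av"
  by (simp_all add: adjacent_def)

text \<open>The chain w L, M, L of proper inclusions continues to w M, w L, M, so the pair (M, w L)
  witnesses the reverse adjacency.\<close>

lemma adjacent_sym:
  assumes "adjacent av s t" shows "adjacent av t s"
proof -
  obtain L M w where *: "L \<in> s" "M \<in> t" "uniformizer av w" "(*s) w ` L \<subset> M" "M \<subset> L"
    and V: "s \<in> vertices av" "t \<in> vertices av"
    using assms by (auto simp: adjacent_def)
  have w: "w \<noteq> 0" using *(3) by (auto simp: uniformizer_def)
  then have "inj ((*s) w :: 'a^2 \<Rightarrow> _)" by (simp add: inj_on_def)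
  then have "(*s) w ` M \<subset> (*s) w ` L" using *(5)
    by (simp add: inj_image_subset_iff inj_image_eq_iff psubset_eq)
  moreover have "(*s) w ` L \<in> s"
    using vertexD(2)[OF V(1) *(1)] homothety_class_scale[OF w] homothety_class_self by metis
  ultimately show ?thesis unfolding adjacent_def using *(2-4) V
    by (intro conjI bexI[of _ M] bexI[of _ "(*s) w ` L"] exI[of _ w]) assumption+
qed

lemma adjacent_vact:
  assumes M: "invertible M" and "adjacent av s t"
  shows "adjacent av (vact M s) (vact M t)"
proof -
  obtain L N w where *: "L \<in> s" "N \<in> t" "uniformizer av w" "(*s) w ` L \<subset> N" "N \<subset> L"
    and V: "s \<in> vertices av" "t \<in> vertices av"
    using assms(2) by (auto simp: adjacent_def)
  note inj = inj_image_subset_iff[OF inj_matrix_vector_mult[OF M]]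
    inj_image_eq_iff[OF inj_matrix_vector_mult[OF M]]
  have "(*s) w ` (*v) M ` L = (*v) M ` (*s) w ` L"
    by (simp add: image_image vector_scalar_commute)
  then have "(*s) w ` (*v) M ` L \<subset> (*v) M ` N" "(*v) M ` N \<subset> (*v) M ` L"
    using *(4,5) by (simp_all add: psubset_eq inj)
  moreover have "(*v) M ` L \<in> vact M s" "(*v) M ` N \<in> vact M t"
    using *(1,2) by (auto simp: vact_def)
  ultimately show ?thesis
    unfolding adjacent_def using *(3) V vact_vertex[OF M]
    by (intro conjI bexI[of _ "(*v) M ` L"] bexI[of _ "(*v) M ` N"] exI[of _ w]) auto
qed

lemma adjacent_vact_iff:
  assumes "invertible M"
  shows "adjacent av (vact M s) (vact M t) \<longleftrightarrow> adjacent av s t"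
  using assms by (metis adjacent_vact invertible_cancel vact_cancel)

lemma mem_scale_lat_0:
  assumes "uniformizer av w"
  shows "x \<in> (*s) w ` lat 0 0 \<longleftrightarrow> av (x $ 1) \<le> rad 1 \<and> av (x $ 2) \<le> rad 1"
proof
  assume "x \<in> (*s) w ` lat 0 0"
  then show "av (x $ 1) \<le> rad 1 \<and> av (x $ 2) \<le> rad 1"
    using av_uniformizer[OF assms] by (auto simp: lat_def av_mult rad_1 mult_left_le av_nonneg)
next
  assume x: "av (x $ 1) \<le> rad 1 \<and> av (x $ 2) \<le> rad 1"
  have "av w = rad 1" "w \<noteq> 0"
    using av_uniformizer[OF assms] assms by (auto simp: rad_1 uniformizer_def)
  then have "inverse w *s x \<in> lat 0 0" "x = w *s (inverse w *s x)" using x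
    using av_unif_pos by (simp_all add: lat_def av_mult av_inverse rad_1) (simp_all add: field_simps)
  then show "x \<in> (*s) w ` lat 0 0" by (rule rev_image_eqI)
qed

text \<open>Modulo \<open>w\<close>, such a lattice is a line in the plane over the residue field.
  It is spanned either by some (b, 1), giving a ball of radius \<open>rad 1\<close>, or by (1, 0),
  giving the ball of the next larger radius.\<close>

lemma lattice_between:
  assumes w: "uniformizer av w" and M: "is_lattice av M" and lo: "(*s) w ` lat 0 0 \<subset> M" and up: "M \<subset> lat 0 0"
  shows "homothety_class M = bvert 0 (- 1) \<or> (\<exists>b. av b \<le> 1 \<and> homothety_class M = bvert b 1)"
proof -
  have lo': "x \<in> M" if "av (x $ 1) \<le> rad 1" "av (x $ 2) \<le> rad 1" for x
    using that lo mem_scale_lat_0[OF w] by blast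
  have up': "av (x $ 1) \<le> 1 \<and> av (x $ 2) \<le> 1" if "x \<in> M" for x
    using that up by (auto simp: lat_def)
  \<comment> \<open>Two such vectors are independent modulo \<open>w\<close> and generate all of
    \<open>lat 0 0\<close>, which contradicts the proper inclusion.\<close>
  have e1: False if e1: "x \<in> M" "av (x $ 1) = 1" "x $ 2 = 0" "y \<in> M" "av (y $ 2) = 1" for x y
  proof -
    have "z \<in> M" if "z \<in> lat 0 0" for z
    proof -
      let ?z = "z - (z $ 2 / y $ 2) *s y"
      have nz: "x $ 1 \<noteq> 0" "y $ 2 \<noteq> 0" using e1 by auto
      have z2: "av (z $ 2 / y $ 2) \<le> 1" using that e1(5) by (simp add: lat_def av_divide)
      then have zy: "(z $ 2 / y $ 2) *s y \<in> M" by (rule lattice_scale[OF M e1(4)])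
      have "av (?z $ 1) \<le> 1" using that up'[OF zy] by (auto simp: lat_def intro: av_diff_le)
      then have "av (?z $ 1 / x $ 1) \<le> 1" using e1(2) by (simp add: av_divide)
      then have "(?z $ 1 / x $ 1) *s x \<in> M" by (rule lattice_scale[OF M e1(1)])
      moreover have "z = (?z $ 1 / x $ 1) *s x + (z $ 2 / y $ 2) *s y"
        using nz e1(3) by (intro vector_eqI_2) (simp_all add: field_simps)
      ultimately show ?thesis using lattice_add[OF M _ zy] by metis
    qed
    then show False using up by blast
  qed
  show ?thesis
  proof (cases "\<exists>m\<in>M. av (m $ 2) = 1")
    case True
    then obtain m where m: "m \<in> M" "av (m $ 2) = 1" by blast
    \<comment> \<open>The slope of the line: rescaling \<open>m\<close> by a unit turns it into
      (\<open>b\<close>, 1).\<close>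
    define b where "b = m $ 1 / m $ 2"
    have nz: "m $ 2 \<noteq> 0" using m by auto
    have b: "av b \<le> 1" using up'[OF m(1)] m(2) by (simp add: b_def av_divide)
    define v :: "'a^2" where "v = vector [b, 1]"
    have v: "v \<in> M"
    proof -
      have "v = inverse (m $ 2) *s m"
        using nz by (intro vector_eqI_2) (simp_all add: v_def b_def field_simps)
      then show ?thesis using lattice_scale[OF M m(1), of "inverse (m $ 2)"] m(2)
        by (simp add: av_inverse)
    qed
    have "x \<in> M \<longleftrightarrow> x \<in> lat b 1" for x
    proof
      assume x: "x \<in> lat b 1"
      let ?y = "vector [x $ 1 - b * x $ 2, 0] :: 'a^2"
      have "x = ?y + (x $ 2) *s v"
        by (intro vector_eqI_2) (simp_all add: v_def algebra_simps)
      moreover have "(x $ 2) *s v \<in> M" using x by (intro lattice_scale[OF M v]) (simp add: lat_def)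
      moreover have "?y \<in> M" using x by (intro lo') (simp_all add: lat_def)
      ultimately show "x \<in> M" using lattice_add[OF M] by metis
    next
      assume x: "x \<in> M"
      have x2: "(x $ 2) *s v \<in> M" using up'[OF x] by (intro lattice_scale[OF M v]) simp
      let ?y = "x - (x $ 2) *s v"
      have y: "?y \<in> M" by (rule lattice_diff[OF M x x2])
      have "av (?y $ 1) \<noteq> 1" using e1[OF y _ _ m] by (auto simp: v_def)
      moreover have "av (?y $ 1) \<le> 1" using up'[OF y] by blast
      ultimately have "av (?y $ 1) < 1" by linarith
      then have "av (?y $ 1) \<le> rad 1" unfolding av_less_1_rad .
      then show "x \<in> lat b 1" using up'[OF x] by (simp add: lat_def v_def mult.commute)
    qed
    then have "M = lat b 1" by blast
    then show ?thesis using b by (auto simp: bvert_def)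
  next
    case False
    then have m2: "av (m $ 2) \<le> rad 1" if "m \<in> M" for m
      using that up'[OF that] av_less_1_rad[of "m $ 2"] by force
    obtain m where m: "m \<in> M" "m \<notin> (*s) w ` lat 0 0" using lo by blast
    then have "\<not> av (m $ 1) \<le> rad 1" using m2[OF m(1)] mem_scale_lat_0[OF w] by blast
    then have m1: "av (m $ 1) = 1" using up'[OF m(1)] av_less_1_rad[of "m $ 1"] by force
    then have nz: "m $ 1 \<noteq> 0" by auto
    \<comment> \<open>No second coordinate is a unit here, so the line is the one spanned by (1, 0);
      the resulting lattice is \<open>unif\<close> times \<open>lat 0 (- 1)\<close>.\<close>
    have "x \<in> M \<longleftrightarrow> av (x $ 1) \<le> 1 \<and> av (x $ 2) \<le> rad 1" for x
    proof
      assume x: "av (x $ 1) \<le> 1 \<and> av (x $ 2) \<le> rad 1"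
      let ?c = "x $ 1 / m $ 1"
      have c: "av ?c \<le> 1" using x m1 by (simp add: av_divide)
      have cm: "?c *s m \<in> M" by (rule lattice_scale[OF M m(1) c])
      then have "x - ?c *s m \<in> M"
        using m2[OF cm] x nz by (intro lo') (simp_all add: av_diff_le)
      then have "(x - ?c *s m) + ?c *s m \<in> M" using cm by (rule lattice_add[OF M])
      then show "x \<in> M" by simp
    qed (use up' m2 in blast)
    moreover have "x \<in> (*s) unif ` lat 0 (- 1) \<longleftrightarrow> av (x $ 1) \<le> 1 \<and> av (x $ 2) \<le> rad 1" for x
    proof
      assume "x \<in> (*s) unif ` lat 0 (- 1)"
      then show "av (x $ 1) \<le> 1 \<and> av (x $ 2) \<le> rad 1"
        using av_unif_pos by (auto simp: lat_def av_mult rad_1 mult_left_le rad_minus field_simps)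
    next
      assume x: "av (x $ 1) \<le> 1 \<and> av (x $ 2) \<le> rad 1"
      then have "inverse unif *s x \<in> lat 0 (- 1)" "x = unif *s (inverse unif *s x)"
        using av_unif_pos
        by (simp_all add: lat_def av_mult av_inverse rad_1 rad_minus) (simp_all add: field_simps)
      then show "x \<in> (*s) unif ` lat 0 (- 1)" by (rule rev_image_eqI)
    qed
    ultimately have "M = (*s) unif ` lat 0 (- 1)" by blast
    then show ?thesis by (simp add: bvert_def homothety_class_scale)
  qed
qed

lemma adjacent_bvert_0_child:
  assumes "av b \<le> 1" shows "adjacent av (bvert 0 0) (bvert b 1)"
proof -
  have "lat b 1 \<subseteq> lat 0 0"
  proof
    fix x assume x: "x \<in> lat b 1"
    then have "av (x $ 1 - b * x $ 2) \<le> 1"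
      using rad_le_1_iff[of 1] by (auto simp: lat_def intro: order_trans)
    moreover have "av (b * x $ 2) \<le> 1"
      using x assms by (auto simp: lat_def av_mult av_nonneg mult_le_one)
    ultimately have "av ((x $ 1 - b * x $ 2) + b * x $ 2) \<le> 1" by (rule av_add_le)
    then show "x \<in> lat 0 0" using x by (simp add: lat_def)
  qed
  moreover have "vector [1, 0] \<in> lat 0 0 - lat b 1" by (simp add: lat_def)
  moreover have "(*s) unif ` lat 0 0 \<subseteq> lat b 1"
  proof
    fix x assume "x \<in> (*s) unif ` lat 0 0"
    then have x: "av (x $ 1) \<le> rad 1" "av (x $ 2) \<le> rad 1"
      unfolding mem_scale_lat_0[OF uniformizer_unif] by auto
    then have "av (b * x $ 2) \<le> 1 * rad 1"
      unfolding av_mult using assms by (intro mult_mono) (auto simp: av_nonneg)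
    then have "av (x $ 1 - b * x $ 2) \<le> rad 1" using x by (intro av_diff_le) auto
    moreover have "av (x $ 2) \<le> 1"
      using x(2) rad_le_1_iff[of 1] by linarith
    ultimately show "x \<in> lat b 1" by (simp add: lat_def)
  qed
  moreover have "vector [b, 1] \<in> lat b 1 - (*s) unif ` lat 0 0"
    unfolding Diff_iff mem_scale_lat_0[OF uniformizer_unif] by (simp add: lat_def)
  ultimately show ?thesis
    unfolding adjacent_def using uniformizer_unif bvert_vertex
    by (intro conjI bexI[of _ "lat 0 0"] bexI[of _ "lat b 1"] exI[of _ unif])
      (auto simp: bvert_def homothety_class_self)
qed

text \<open>The neighbours of a ball are its parent, the next larger ball, and its children, the
  balls one level smaller inside it.\<close>

lemma adjacent_bvert_0:
  "adjacent av (bvert 0 0) t \<longleftrightarrow> t = bvert 0 (- 1) \<or> (\<exists>b. av b \<le> 1 \<and> t = bvert b 1)"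
proof
  assume a: "adjacent av (bvert 0 0) t"
  then obtain L M w where *: "L \<in> bvert 0 0" "M \<in> t" "uniformizer av w" "(*s) w ` L \<subset> M" "M \<subset> L"
    by (auto simp: adjacent_def)
  have t: "is_lattice av M" "t = homothety_class M"
    using vertexD[OF adjacent_vertices(2)[OF a] *(2)] by auto
  obtain c where c: "c \<noteq> 0" "L = (*s) c ` lat 0 0"
    using *(1) by (auto simp: bvert_def homothety_class_def)
  \<comment> \<open>Rescaling both lattices by the same factor keeps the inclusions, so
    \<open>L\<close> may be taken to be \<open>lat 0 0\<close>.\<close>
  let ?c = "inverse c"
  have inj: "inj ((*s) ?c :: 'a^2 \<Rightarrow> _)" using c(1) by (simp add: inj_on_def)
  have cL: "(*s) ?c ` L = lat 0 0" "(*s) ?c ` (*s) w ` L = (*s) w ` lat 0 0"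
    using c by (simp_all add: image_image field_simps)
  have "(*s) ?c ` (*s) w ` L \<subset> (*s) ?c ` M" "(*s) ?c ` M \<subset> (*s) ?c ` L"
    using *(4,5) by (simp_all add: psubset_eq inj_image_subset_iff[OF inj] inj_image_eq_iff[OF inj])
  then have "(*s) w ` lat 0 0 \<subset> (*s) ?c ` M" "(*s) ?c ` M \<subset> lat 0 0"
    unfolding cL by auto
  from lattice_between[OF *(3) _ this]
  show "t = bvert 0 (- 1) \<or> (\<exists>b. av b \<le> 1 \<and> t = bvert b 1)"
    using c(1) t is_lattice_scale[of ?c M] homothety_class_scale[of ?c M] by simp
next
  assume "t = bvert 0 (- 1) \<or> (\<exists>b. av b \<le> 1 \<and> t = bvert b 1)"
  \<comment> \<open>The parent needs no separate computation: \<open>weyl\<close> exchanges it with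
    the child centred at 0.\<close>
  moreover have "adjacent av (bvert 0 0) (bvert 0 (- 1))"
    using adjacent_vact[OF invertible_weyl adjacent_bvert_0_child[of 0]] by (simp add: vact_weyl)
  ultimately show "adjacent av (bvert 0 0) t" using adjacent_bvert_0_child by blast
qed

lemma adjacent_bvert:
  "adjacent av (bvert b i) t \<longleftrightarrow> t = bvert b (i - 1) \<or> (\<exists>b'. av (b' - b) \<le> rad i \<and> t = bvert b' (i + 1))"
proof -
  let ?u = "unif powi i"
  \<comment> \<open>The affine map taking t to (t - b) divided by \<open>unif powi i\<close>; it
    sends \<open>bvert b i\<close> to \<open>bvert 0 0\<close>.\<close>
  define N where "N = mat2 (inverse ?u) (- b * inverse ?u) 0 1"
  have inv: "invertible N" unfolding N_def by (rule invertible_mat2) simp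
  have N: "vact N (bvert c j) = bvert (inverse ?u * (c - b)) (j - i)" for c j
    using vact_affine[of "inverse ?u" "- i" "- b * inverse ?u" c j]
    by (simp add: N_def av_inverse av_unif_powi rad_minus algebra_simps)
  have "adjacent av (bvert b i) t \<longleftrightarrow> adjacent av (bvert 0 0) (vact N t)"
    by (subst adjacent_vact_iff[OF inv, of "bvert b i" t, symmetric]) (simp add: N)
  also have "\<dots> \<longleftrightarrow> vact N t = vact N (bvert b (i - 1)) \<or>
     (\<exists>b'. av (b' - b) \<le> rad i \<and> vact N t = vact N (bvert b' (i + 1)))"
  proof -
    have "(\<exists>b. av b \<le> 1 \<and> P b) \<longleftrightarrow> (\<exists>b'. av (b' - b) \<le> rad i \<and> P (inverse ?u * (b' - b)))" for P
    proof
      assume "\<exists>b. av b \<le> 1 \<and> P b"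
      then obtain c where "av c \<le> 1" "P c" by blast
      then show "\<exists>b'. av (b' - b) \<le> rad i \<and> P (inverse ?u * (b' - b))"
        by (intro exI[of _ "?u * c + b"]) (simp add: av_mult av_unif_powi mult_left_le flip: mult.assoc)
    next
      assume "\<exists>b'. av (b' - b) \<le> rad i \<and> P (inverse ?u * (b' - b))"
      then obtain b' where "av (b' - b) \<le> rad i" "P (inverse ?u * (b' - b))" by blast
      then show "\<exists>b. av b \<le> 1 \<and> P b"
        by (intro exI[of _ "inverse ?u * (b' - b)"])
          (simp add: av_mult av_inverse av_unif_powi, simp add: field_simps)
    qed
    from this[of "\<lambda>c. vact N t = bvert c 1"] show ?thesis by (simp add: adjacent_bvert_0 N)
  qed
  finally show ?thesis by (simp add: vact_eq_iff[OF inv])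
qed

text \<open>After \<open>s\<close> is moved to the unit ball, \<open>t\<close> is its parent or a
  child. The first case is turned into the second by \<open>weyl\<close>; a child with centre
  \<open>b\<close> is brought to centre 0 by a translation, which keeps the unit ball because
  \<open>av b \<le> 1\<close>.\<close>

lemma edge_transitive:
  assumes "adjacent av s t"
  obtains M where "invertible M" "vact M s = bvert 0 0" "vact M t = bvert 0 1"
proof -
  obtain B where B: "invertible B" "s = vact B (bvert 0 0)"
    using adjacent_vertices(1)[OF assms] by (rule vertex_transitive)
  obtain N where N: "invertible N" "N ** B = mat 1" using invertible_cancel[OF B(1)] by metis
  have s: "vact N s = bvert 0 0" using B N by (simp add: vact_cancel)
  then have "adjacent av (bvert 0 0) (vact N t)" using adjacent_vact[OF N(1) assms] by simp
  then consider "vact N t = bvert 0 (- 1)" | b where "av b \<le> 1" "vact N t = bvert b 1"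
    unfolding adjacent_bvert_0 by blast
  then show thesis
  proof cases
    case 1
    then show thesis using s N(1)
      by (intro that[of "weyl ** N"]) (simp_all add: vact_mult vact_weyl invertible_mult invertible_weyl)
  next
    case 2
    have "invertible (mat2 1 (- b) 0 1)" by (rule invertible_mat2) simp
    moreover have "bvert (- b) 0 = bvert 0 0" using 2(1) by (simp add: bvert_eq_iff)
    ultimately show thesis using s N(1) 2
      by (intro that[of "mat2 1 (- b) 0 1 ** N"]) (simp_all add: vact_mult vact_translation invertible_mult)
  qed
qed

text \<open>Local finiteness comes from the finite residue field: a child \<open>bvert b 1\<close>
  of the unit ball depends only on the residue class of \<open>b\<close>.\<close>

lemma finite_neighbours: "finite {t. adjacent av s t}"
proof (cases "s \<in> vertices av")
  case True
  then obtain B where B: "invertible B" "s = vact B (bvert 0 0)" by (rule vertex_transitive)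
  let ?R = "{(x, y). av x \<le> 1 \<and> av y \<le> 1 \<and> av (x - y) < 1}"
  let ?Q = "{x. av x \<le> 1} // ?R"
  have "bvert b 1 \<in> (\<lambda>C. bvert (SOME c. c \<in> C) 1) ` ?Q" if b: "av b \<le> 1" for b
  proof -
    let ?C = "?R `` {b}"
    have "b \<in> ?C" using b by simp
    then have "(SOME c. c \<in> ?C) \<in> ?C" by (rule someI)
    then have "av (b - (SOME c. c \<in> ?C)) < 1" by blast
    then have "bvert b 1 = bvert (SOME c. c \<in> ?C) 1" by (simp only: bvert_eq_iff av_less_1_rad)
    moreover have "?C \<in> ?Q" using b by (intro quotientI) simp
    ultimately show ?thesis by blast
  qed
  then have "{t. adjacent av (bvert 0 0) t} \<subseteq> insert (bvert 0 (- 1)) ((\<lambda>C. bvert (SOME c. c \<in> C) 1) ` ?Q)"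
    unfolding adjacent_bvert_0 by blast
  then have "finite {t. adjacent av (bvert 0 0) t}"
    by (rule finite_subset) (intro finite.insertI finite_imageI finite_residue_field)
  moreover have "{t. adjacent av s t} \<subseteq> vact B ` {t. adjacent av (bvert 0 0) t}"
  proof
    fix t assume "t \<in> {t. adjacent av s t}"
    moreover obtain N where N: "N ** B = mat 1" "B ** N = mat 1" "invertible N"
      using invertible_cancel[OF B(1)] by metis
    ultimately have "adjacent av (bvert 0 0) (vact N t)" "t = vact B (vact N t)"
      using adjacent_vact[OF N(3), of s t] B(2) by (simp_all add: vact_cancel)
    then show "t \<in> vact B ` {t. adjacent av (bvert 0 0) t}" by blast
  qed
  ultimately show ?thesis by (meson finite_imageI finite_subset)
next
  case False
  then have "{t. adjacent av s t} = {}" using adjacent_vertices(1) by blast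
  then show ?thesis by simp
qed

text \<open>Each vertex has at least three neighbours, the images of the parent and of the children
  centred at 0 and 1, so two can be excluded.\<close>

lemma ex_other_neighbour:
  assumes "s \<in> vertices av"
  shows "\<exists>t. adjacent av s t \<and> t \<noteq> u \<and> t \<noteq> v"
proof -
  obtain B where B: "invertible B" "s = vact B (bvert 0 0)" using assms by (rule vertex_transitive)
  let ?f = "\<lambda>t. vact B t"
  have "adjacent av s (?f (bvert 0 (- 1)))" "adjacent av s (?f (bvert 0 1))" "adjacent av s (?f (bvert 1 1))"
    unfolding B(2) adjacent_vact_iff[OF B(1)] adjacent_bvert_0
    by (auto intro: exI[of _ "0::'a"] exI[of _ "1::'a"])
  moreover have "distinct [?f (bvert 0 (- 1)), ?f (bvert 0 1), ?f (bvert 1 1)]"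
    by (simp add: vact_eq_iff[OF B(1)] bvert_eq_iff)
  ultimately show ?thesis by (metis distinct_length_2_or_more)
qed

section \<open>Non-backtracking paths and their ends\<close>

lemma metric_space_av: "Metric_space UNIV (\<lambda>x y. av (x - y))"
proof
  show "av (x - z) \<le> av (x - y) + av (y - z)" for x y z
    using av_ultrametric[of "x - y" "y - z"] av_nonneg[of "x - y"] av_nonneg[of "y - z"] by simp
qed (simp_all add: av_nonneg av_minus_commute av_eq_0_iff)

text \<open>The second conjunct carries the induction: if the next step is not to the parent, it is
  to a child, and the parent of that child is the ball just left. The guard \<open>i < n\<close> is
  there because the path stops at \<open>n\<close>.\<close>

lemma descending_path:
  fixes \<rho> :: "nat \<Rightarrow> 'a vertex"
  assumes adj: "\<And>i. i < n \<Longrightarrow> adjacent av (\<rho> i) (\<rho> (Suc i))"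
    and nb: "\<And>i. i + 2 \<le> n \<Longrightarrow> \<rho> i \<noteq> \<rho> (i + 2)"
    and start: "\<rho> 0 = bvert 0 0" "\<rho> 1 \<noteq> bvert 0 (- 1)"
    and i: "i \<le> n"
  shows "\<exists>b. \<rho> i = bvert b (int i) \<and> (i < n \<longrightarrow> \<rho> (Suc i) \<noteq> bvert b (int i - 1))"
  using i
proof (induction i)
  case 0
  then show ?case using start by (intro exI[of _ 0]) simp
next
  case (Suc i)
  then obtain b where b: "\<rho> i = bvert b (int i)" "\<rho> (Suc i) \<noteq> bvert b (int i - 1)" by auto
  then obtain b' where b': "av (b' - b) \<le> rad (int i)" "\<rho> (Suc i) = bvert b' (int i + 1)"
    using adj[of i] Suc.prems adjacent_bvert[of b "int i" "\<rho> (Suc i)"] by auto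
  have "bvert b (int i) = bvert b' (int i)"
    using b'(1) by (simp add: bvert_eq_iff av_minus_commute[of b])
  then show ?case using b(1) b'(2) nb[of i] by (intro exI[of _ b']) (auto simp: add.commute)
qed

text \<open>With the first edge normalised to point downward, the last vertex has radius exponent
  \<open>n\<close>, hence differs from the first.\<close>

lemma nonbacktracking_ends_neq:
  fixes \<rho> :: "nat \<Rightarrow> 'a vertex"
  assumes adj: "\<And>i. i < n \<Longrightarrow> adjacent av (\<rho> i) (\<rho> (Suc i))"
    and nb: "\<And>i. i + 2 \<le> n \<Longrightarrow> \<rho> i \<noteq> \<rho> (i + 2)"
    and n: "0 < n"
  shows "\<rho> 0 \<noteq> \<rho> n"
proof -
  obtain M where M: "invertible M" "vact M (\<rho> 0) = bvert 0 0" "vact M (\<rho> 1) = bvert 0 1"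
    using edge_transitive[of "\<rho> 0" "\<rho> 1"] adj[of 0] n by auto
  have "\<exists>b. vact M (\<rho> n) = bvert b (int n) \<and> (n < n \<longrightarrow> vact M (\<rho> (Suc n)) \<noteq> bvert b (int n - 1))"
    using descending_path[of n "\<lambda>i. vact M (\<rho> i)" n] M adj nb
    by (simp add: adjacent_vact vact_eq_iff bvert_eq_iff)
  then obtain b where "vact M (\<rho> n) = bvert b (int n)" by blast
  then have "vact M (\<rho> n) \<noteq> vact M (\<rho> 0)" using n M(2) by (simp add: bvert_eq_iff)
  then show ?thesis by metis
qed

text \<open>A descending ray is a nested sequence of balls whose centres form a Cauchy sequence; the
  limit is a common centre. This is the place where completeness of the field enters.\<close>

lemma descending_ray:
  fixes \<rho> :: "nat \<Rightarrow> 'a vertex"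
  assumes adj: "\<And>i. adjacent av (\<rho> i) (\<rho> (Suc i))"
    and nb: "\<And>i. \<rho> i \<noteq> \<rho> (i + 2)"
    and start: "\<rho> 0 = bvert 0 0" "\<rho> 1 \<noteq> bvert 0 (- 1)"
  obtains y where "\<And>i. \<rho> i = bvert y (int i)"
proof -
  have "\<exists>b. \<rho> i = bvert b (int i)" for i
    using descending_path[of i \<rho> i] assms by blast
  then obtain b where b: "\<And>i. \<rho> i = bvert (b i) (int i)" by metis
  have diff_step: "av (b (Suc i) - b i) \<le> rad (int i)" for i
  proof -
    have "bvert (b (Suc i)) (int (Suc i)) \<noteq> bvert (b i) (int i - 1)"
      by (simp add: bvert_eq_iff)
    then obtain b' where b': "av (b' - b i) \<le> rad (int i)"
        "bvert (b (Suc i)) (int (Suc i)) = bvert b' (int i + 1)"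
      using adj[of i] unfolding b adjacent_bvert by blast
    then have "av (b (Suc i) - b') \<le> rad (int i)"
      by (auto simp: bvert_eq_iff intro: order_trans)
    then show ?thesis using b'(1) by (rule av_diff_trans)
  qed
  have cauchy: "av (b j - b i) \<le> rad (int i)" if "i \<le> j" for i j
    using that
  proof (induction j rule: dec_induct)
    case (step j)
    have "av (b (Suc j) - b j) \<le> rad (int i)"
      using step.hyps diff_step[of j] rad_le_iff[of "int j" "int i"] by linarith
    then show ?case using step.IH by (rule av_diff_trans)
  qed simp
  interpret M: Metric_space UNIV "\<lambda>x y. av (x - y)" by (rule metric_space_av)
  have "M.MCauchy b"
    unfolding M.MCauchy_def
  proof (intro conjI allI impI)
    fix e :: real assume "0 < e"
    then obtain N where N: "rad (int N) < e" using rad_arbitrarily_small by blast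
    show "\<exists>N. \<forall>n n'. N \<le> n \<longrightarrow> N \<le> n' \<longrightarrow> av (b n - b n') < e"
    proof (intro exI allI impI)
      fix n n' assume "N \<le> n" "N \<le> n'"
      then have "av (b n - b n') \<le> rad (int N)"
        using cauchy[of N n] cauchy[of N n'] av_minus_commute by (metis av_diff_trans)
      then show "av (b n - b n') < e" using N by linarith
    qed
  qed simp
  then obtain y where y: "limitin M.mtopology b y sequentially"
    using av_complete unfolding M.mcomplete_def by blast
  have "\<rho> i = bvert y (int i)" for i
  proof -
    obtain N where "\<And>n. N \<le> n \<Longrightarrow> av (b n - y) < rad (int i)"
      using y rad_pos[of "int i"] unfolding M.limit_metric_sequentially by blast
    \<comment> \<open>The index is large enough both for closeness to the limit and for comparison
      with \<open>b i\<close>.\<close>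
    then have "av (b (max N i) - y) \<le> rad (int i)" by (meson less_imp_le max.cobounded1)
    moreover have "av (b i - b (max N i)) \<le> rad (int i)"
      using cauchy[of i "max N i"] av_minus_commute by (metis max.cobounded2)
    ultimately have "av (b i - y) \<le> rad (int i)" by (metis av_diff_trans)
    then show ?thesis by (simp add: b bvert_eq_iff)
  qed
  then show thesis by (rule that)
qed

text \<open>The matrix is the translation by \<open>y\<close> after the lower triangular
  \<open>mat2 (1 - y * z) 0 z 1\<close>. The latter has unit diagonal entries and integral
  \<open>z\<close>, so it preserves \<open>lat 0 (int i)\<close> for every natural number
  \<open>i\<close>.\<close>

lemma vact_unipotents:
  assumes yz: "av (y * z) < 1" and z: "av z \<le> 1"
  shows "vact (mat2 1 y z 1) (bvert 0 (int i)) = bvert y (int i)"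
proof -
  let ?d = "1 - y * z"
  have d: "av ?d = 1" using yz av_add_eq[of "- (y * z)" 1] by simp
  then have d0: "?d \<noteq> 0" by (metis av_0 zero_neq_one)
  have le1: "t \<le> 1" if "t \<le> rad (int i)" for t using that rad_le_1_iff[of "int i"] by linarith
  have fwd: "mat2 a 0 c 1 *v x \<in> lat 0 (int i)"
    if "av a \<le> 1" "av c \<le> 1" "x \<in> lat 0 (int i)" for a c x
  proof -
    have "av (a * x $ 1) \<le> 1 * rad (int i)" "av (c * x $ 1) \<le> 1 * rad (int i)"
      unfolding av_mult using that by (intro mult_mono; simp add: lat_def av_nonneg)+
    then show ?thesis using that by (auto simp: lat_def mult_vec_2 le1 intro: av_add_le)
  qed
  have "(*v) (mat2 ?d 0 z 1) ` lat 0 (int i) = lat 0 (int i)"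
  proof (intro equalityI subsetI)
    fix x assume x: "x \<in> lat 0 (int i)"
    have "mat2 (inverse ?d) 0 (- z * inverse ?d) 1 *v x \<in> lat 0 (int i)"
      using d z by (intro fwd[OF _ _ x]) (simp_all add: av_mult av_inverse)
    moreover have "x = mat2 ?d 0 z 1 *v (mat2 (inverse ?d) 0 (- z * inverse ?d) 1 *v x)"
      using d0 by (intro vector_eqI_2) (simp_all add: mult_vec_2)
    ultimately show "x \<in> (*v) (mat2 ?d 0 z 1) ` lat 0 (int i)" by (rule rev_image_eqI)
  qed (use fwd d z in force)
  then have "vact (mat2 ?d 0 z 1) (bvert 0 (int i)) = bvert 0 (int i)"
    by (simp add: bvert_def vact_homothety_class)
  moreover have "mat2 1 y z 1 = mat2 1 y 0 1 ** mat2 ?d 0 z 1"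
    by (rule mat2_eqI) (simp_all add: matrix_mult_2)
  ultimately show ?thesis by (simp add: vact_mult vact_translation)
qed

section \<open>Lines\<close>

text \<open>Stated locally so that it can be checked at a junction. By \<open>line_iff_inj\<close>
  these are the parametrisations that occur in \<open>oriented_apartments\<close>.\<close>

definition line :: "(int \<Rightarrow> 'a vertex) \<Rightarrow> bool" where
  "line \<gamma> \<longleftrightarrow> (\<forall>i. adjacent av (\<gamma> i) (\<gamma> (i + 1)) \<and> \<gamma> i \<noteq> \<gamma> (i + 2))"

lemma line_inj: assumes "line \<gamma>" shows "inj \<gamma>"
proof -
  have "\<gamma> i \<noteq> \<gamma> j" if "i < j" for i j
  proof -
    have "adjacent av (\<gamma> (i + int l)) (\<gamma> (i + int (Suc l)))"
      "\<gamma> (i + int l) \<noteq> \<gamma> (i + int (l + 2))" for l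
      using assms spec[of "\<lambda>i. adjacent av (\<gamma> i) (\<gamma> (i + 1)) \<and> \<gamma> i \<noteq> \<gamma> (i + 2)" "i + int l"]
      by (simp_all add: line_def ac_simps)
    then have "\<gamma> (i + int 0) \<noteq> \<gamma> (i + int (nat (j - i)))"
      using that by (intro nonbacktracking_ends_neq[of _ "\<lambda>l. \<gamma> (i + int l)"]) simp_all
    then show ?thesis using that by simp
  qed
  then show ?thesis by (metis injI linorder_neqE)
qed

lemma line_iff_inj: "line \<gamma> \<longleftrightarrow> inj \<gamma> \<and> (\<forall>i. adjacent av (\<gamma> i) (\<gamma> (i + 1)))"
  using line_inj[of \<gamma>] by (auto simp: line_def dest: injD)

lemma line_eq_iff: "line \<gamma> \<Longrightarrow> \<gamma> i = \<gamma> j \<longleftrightarrow> i = j"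
  using line_inj by (auto dest: injD)

lemma line_shift: "line \<gamma> \<Longrightarrow> line (\<lambda>i. \<gamma> (i + c))"
proof -
  assume "line \<gamma>"
  then have "adjacent av (\<gamma> (i + c)) (\<gamma> (i + c + 1)) \<and> \<gamma> (i + c) \<noteq> \<gamma> (i + c + 2)" for i
    by (simp add: line_def)
  then show ?thesis by (simp add: line_def ac_simps)
qed

lemma line_uminus: "line \<gamma> \<Longrightarrow> line (\<lambda>i. \<gamma> (- i))"
proof -
  assume "line \<gamma>"
  then have *: "adjacent av (\<gamma> i) (\<gamma> (i + 1))" "\<gamma> i \<noteq> \<gamma> (i + 2)" for i
    by (simp_all add: line_def)
  show ?thesis unfolding line_def
    using *(1)[of "- (i + 1)" for i, THEN adjacent_sym] *(2)[of "- (i + 2)" for i] by force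
qed

lemma line_vact: "invertible M \<Longrightarrow> line \<gamma> \<Longrightarrow> line (\<lambda>i. vact M (\<gamma> i))"
  by (simp add: line_def adjacent_vact vact_eq_iff)

lemma line_std: "line (bvert 0)"
  by (simp add: line_def adjacent_bvert bvert_eq_iff) (use rad_nonneg in \<open>force intro: exI[of _ 0]\<close>)

text \<open>The two ends of \<open>\<eta>\<close> are read off by \<open>descending_ray\<close>, the
  backward one after applying \<open>weyl\<close>; they are the parameters \<open>y\<close> and
  \<open>z\<close>. Agreement with the standard line up to \<open>n\<close> and down to
  \<open>- int m\<close> bounds them, and \<open>0 < n\<close> ensures
  \<open>av (y * z) < 1\<close>.\<close>

lemma line_near_std:
  assumes \<eta>: "line \<eta>" and std: "\<And>i. - int m \<le> i \<Longrightarrow> i \<le> int n \<Longrightarrow> \<eta> i = bvert 0 i"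
    and n: "0 < n"
  obtains y z where "av y \<le> rad (int n)" "av z \<le> rad (int m)"
    "\<And>i. \<eta> i = vact (mat2 1 y z 1) (bvert 0 i)"
proof -
  have \<eta>01: "\<eta> 0 = bvert 0 0" "\<eta> 1 = bvert 0 1" using std n by auto
  have adj: "adjacent av (\<eta> i) (\<eta> (i + 1))" and nb: "\<eta> i \<noteq> \<eta> (i + 2)" for i
    using \<eta> by (simp_all add: line_def)
  obtain y where y: "\<And>i. \<eta> (int i) = bvert y (int i)"
  proof (rule descending_ray[of "\<lambda>i. \<eta> (int i)"])
    fix i :: nat
    show "adjacent av (\<eta> (int i)) (\<eta> (int (Suc i)))" using adj[of "int i"] by (simp add: add.commute)
    show "\<eta> (int i) \<noteq> \<eta> (int (i + 2))" using nb[of "int i"] by (simp add: add.commute)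
    show "\<eta> (int 1) \<noteq> bvert 0 (- 1)" by (simp add: \<eta>01 bvert_eq_iff)
  qed (simp_all add: \<eta>01)
  have "line (\<lambda>i. vact weyl (\<eta> (- i)))"
    by (intro line_vact[OF invertible_weyl] line_uminus[OF \<eta>])
  then have adj': "adjacent av (vact weyl (\<eta> (- i))) (vact weyl (\<eta> (- (i + 1))))"
    and nb': "vact weyl (\<eta> (- i)) \<noteq> vact weyl (\<eta> (- (i + 2)))" for i
    by (simp_all add: line_def)
  have start: "vact weyl (\<eta> (- int 1)) \<noteq> bvert 0 (- 1)"
  proof -
    have "vact weyl (\<eta> (- 1)) \<noteq> vact weyl (\<eta> 1)"
      using nb[of "- 1"] by (simp add: vact_eq_iff[OF invertible_weyl])
    then show ?thesis by (simp add: \<eta>01 vact_weyl)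
  qed
  obtain z where z: "\<And>i. vact weyl (\<eta> (- int i)) = bvert z (int i)"
  proof (rule descending_ray[of "\<lambda>i. vact weyl (\<eta> (- int i))"])
    fix i :: nat
    show "adjacent av (vact weyl (\<eta> (- int i))) (vact weyl (\<eta> (- int (Suc i))))"
      using adj'[of "int i"] by (simp add: algebra_simps)
    show "vact weyl (\<eta> (- int i)) \<noteq> vact weyl (\<eta> (- int (i + 2)))"
      using nb'[of "int i"] by (simp add: algebra_simps)
  qed (use start in \<open>simp_all add: \<eta>01 vact_weyl\<close>)
  have avy: "av y \<le> rad (int n)"
    using y[of n] std[of "int n"] by (simp add: bvert_eq_iff)
  have avz: "av z \<le> rad (int m)"
    using z[of m] std[of "- int m"] by (simp add: bvert_eq_iff vact_weyl)
  have y1: "av y < 1"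
    using avy n rad_less_iff[of "int n" 0] by simp
  have z1: "av z \<le> 1"
    using avz rad_le_1_iff[of "int m"] by linarith
  have yz: "av (y * z) < 1" "av (z * y) < 1"
    using y1 z1 av_nonneg[of y] by (simp_all add: av_mult mult_left_le mult_right_le_one_le mult.commute order_le_less_trans[of _ "av y"])
  have "\<eta> i = vact (mat2 1 y z 1) (bvert 0 i)" for i
  proof (cases "0 \<le> i")
    case True
    then show ?thesis using y[of "nat i"] vact_unipotents[OF yz(1) z1, of "nat i"] by simp
  next
    case False
    define j where "j = nat (- i)"
    have i: "i = - int j" using False by (simp add: j_def)
    \<comment> \<open>Conjugation by \<open>weyl\<close> exchanges \<open>y\<close> and
      \<open>z\<close>, so the forward computation also settles negative indices.\<close>
    have "mat2 1 y z 1 = weyl ** mat2 1 z y 1 ** weyl"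
      by (rule mat2_eqI) (simp_all add: matrix_mult_2 weyl_def)
    then have "vact (mat2 1 y z 1) (bvert 0 i) = vact weyl (bvert z (int j))"
      using y1 vact_unipotents[OF yz(2), of j] by (simp add: i vact_mult vact_weyl)
    then show ?thesis unfolding z[symmetric] i by (simp flip: vact_mult add: weyl_weyl)
  qed
  then show thesis using avy avz by (intro that)
qed

text \<open>One edge is moved to the standard one; \<open>line_near_std\<close> with
  \<open>m = 0\<close> and \<open>n = 1\<close> then supplies the matrix that straightens the
  rest.\<close>

lemma line_transitive:
  assumes "line \<gamma>"
  obtains M where "invertible M" "\<And>i. \<gamma> i = vact M (bvert 0 i)"
proof -
  obtain M where M: "invertible M" "vact M (\<gamma> 0) = bvert 0 0" "vact M (\<gamma> 1) = bvert 0 1"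
  proof (rule edge_transitive)
    show "adjacent av (\<gamma> 0) (\<gamma> 1)" using assms unfolding line_def by (metis add_0)
  qed
  have std: "vact M (\<gamma> i) = bvert 0 i" if "- int 0 \<le> i" "i \<le> int 1" for i
  proof -
    have "i = 0 \<or> i = 1" using that by auto
    then show ?thesis using M(2,3) by auto
  qed
  obtain y z where yz: "av y \<le> rad (int 1)" "av z \<le> rad (int 0)"
    and eq: "\<And>i. vact M (\<gamma> i) = vact (mat2 1 y z 1) (bvert 0 i)"
    using line_near_std[OF line_vact[OF M(1) assms] std zero_less_one] by blast
  obtain N where N: "invertible N" "N ** M = mat 1" using invertible_cancel[OF M(1)] by metis
  have "av (y * z) < 1"
    unfolding av_mult using yz av_nonneg[of y] rad_less_iff[of 1 0]
    by (simp add: mult_left_le order_le_less_trans[of _ "av y"])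
  then have "1 * 1 - y * z \<noteq> 0" by (metis av_1 eq_iff_diff_eq_0 less_irrefl mult_1)
  then have "invertible (N ** mat2 1 y z 1)" using N(1) by (intro invertible_mult invertible_mat2)
  moreover have "\<gamma> i = vact (N ** mat2 1 y z 1) (bvert 0 i)" for i
    using eq[of i] vact_cancel[OF N(2), of "\<gamma> i"] by (simp add: vact_mult)
  ultimately show thesis by (rule that)
qed

text \<open>The choice runs over directed edges instead of vertices, because the condition on the
  next vertex involves the last two.\<close>

lemma ex_ray:
  assumes "adjacent av u v"
  obtains \<rho> :: "nat \<Rightarrow> 'a vertex" where "\<rho> 0 = u" "\<rho> 1 = v"
    "\<And>i. adjacent av (\<rho> i) (\<rho> (Suc i))" "\<And>i. \<rho> i \<noteq> \<rho> (i + 2)"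
proof -
  have "\<exists>f. \<forall>n. ((n = 0 \<longrightarrow> f n = (u, v)) \<and> adjacent av (fst (f n)) (snd (f n))) \<and>
      (fst (f (Suc n)) = snd (f n) \<and> snd (f (Suc n)) \<noteq> fst (f n))"
  proof (rule dependent_nat_choice[where P = "\<lambda>n x. (n = 0 \<longrightarrow> x = (u, v)) \<and> adjacent av (fst x) (snd x)"
        and Q = "\<lambda>_ x y. fst y = snd x \<and> snd y \<noteq> fst x"])
    show "\<exists>x. (0 = 0 \<longrightarrow> x = (u, v)) \<and> adjacent av (fst x) (snd x)"
      using assms by auto
  next
    fix x :: "'a vertex \<times> 'a vertex" and n :: nat
    assume "(n = 0 \<longrightarrow> x = (u, v)) \<and> adjacent av (fst x) (snd x)"
    then obtain w where "adjacent av (snd x) w" "w \<noteq> fst x"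
      using adjacent_vertices(2) ex_other_neighbour by metis
    then show "\<exists>y. ((Suc n = 0 \<longrightarrow> y = (u, v)) \<and> adjacent av (fst y) (snd y)) \<and>
        fst y = snd x \<and> snd y \<noteq> fst x"
      by (intro exI[of _ "(snd x, w)"]) simp
  qed
  then obtain f where f: "f 0 = (u, v)" "\<And>n. adjacent av (fst (f n)) (snd (f n))"
    "\<And>n. fst (f (Suc n)) = snd (f n)" "\<And>n. snd (f (Suc n)) \<noteq> fst (f n)" by auto
  show thesis
  proof (rule that[of "\<lambda>n. fst (f n)"])
    show "fst (f i) \<noteq> fst (f (i + 2))" for i
      using f(3)[of "Suc i"] f(4)[of i] by simp
    show "adjacent av (fst (f i)) (fst (f (Suc i)))" for i
      using f(2)[of i] f(3)[of i] by simp
    show "fst (f 1) = v" using f(1) f(3)[of 0] by simp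
  qed (simp add: f(1))
qed

definition glue :: "(int \<Rightarrow> 'a vertex) \<Rightarrow> (int \<Rightarrow> 'a vertex) \<Rightarrow> int \<Rightarrow> 'a vertex" where
  "glue \<gamma> \<delta> i = (if i < 0 then \<gamma> i else \<delta> i)"

text \<open>Being a line is a condition on three consecutive vertices, and only the windows starting
  at -2 and -1 involve both halves.\<close>

lemma line_glue:
  assumes \<gamma>: "line \<gamma>" and \<delta>: "line \<delta>" and "\<gamma> 0 = \<delta> 0" "\<gamma> (- 1) \<noteq> \<delta> 1"
  shows "line (glue \<gamma> \<delta>)"
  unfolding line_def
proof
  fix i :: int
  have *: "adjacent av (\<gamma> i) (\<gamma> (i + 1))" "adjacent av (\<delta> i) (\<delta> (i + 1))"
    "\<gamma> i \<noteq> \<gamma> (i + 2)" "\<delta> i \<noteq> \<delta> (i + 2)"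
    using \<gamma> \<delta> by (simp_all add: line_def)
  consider "i < - 2" | "i = - 2" | "i = - 1" | "0 \<le> i" by linarith
  then show "adjacent av (glue \<gamma> \<delta> i) (glue \<gamma> \<delta> (i + 1)) \<and> glue \<gamma> \<delta> i \<noteq> glue \<gamma> \<delta> (i + 2)"
  proof cases
    case 1
    then show ?thesis using *(1,3) by (simp add: glue_def)
  next
    case 2
    then show ?thesis using *(1,3) assms(3) by (simp add: glue_def)
  next
    case 3
    then show ?thesis using *(1) assms(3,4) by (simp add: glue_def)
  next
    case 4
    then show ?thesis using *(2,4) by (simp add: glue_def)
  qed
qed

text \<open>Two rays start from the edge in its two directions. They overlap in the whole edge, so
  no backtracking can arise where they are joined.\<close>

lemma line_through_edge:
  assumes "adjacent av u v"
  obtains \<gamma> where "line \<gamma>" "\<gamma> 0 = u" "\<gamma> 1 = v"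
proof -
  obtain \<rho> where \<rho>: "\<rho> 0 = u" "\<rho> 1 = v"
    "\<And>i. adjacent av (\<rho> i) (\<rho> (Suc i))" "\<And>i. \<rho> i \<noteq> \<rho> (i + 2)"
    using ex_ray[OF assms] by blast
  obtain \<sigma> where \<sigma>: "\<sigma> 0 = v" "\<sigma> 1 = u"
    "\<And>i. adjacent av (\<sigma> i) (\<sigma> (Suc i))" "\<And>i. \<sigma> i \<noteq> \<sigma> (i + 2)"
    using ex_ray[OF adjacent_sym[OF assms]] by blast
  \<comment> \<open>The argument \<open>1 - i\<close> reflects that \<open>\<sigma>\<close> starts
    at \<open>v\<close>, which sits at position 1.\<close>
  define \<gamma> where "\<gamma> i = (if 0 \<le> i then \<rho> (nat i) else \<sigma> (nat (1 - i)))" for i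
  have "line \<gamma>"
    unfolding line_def
  proof
    fix i :: int
    consider n where "i = int n" | "i = - 1" | n where "i = - int n - 2"
    proof -
      consider "i = int (nat i)" | "i = - 1" | "i = - int (nat (- i - 2)) - 2" by linarith
      then show thesis using that by cases
    qed
    then show "adjacent av (\<gamma> i) (\<gamma> (i + 1)) \<and> \<gamma> i \<noteq> \<gamma> (i + 2)"
    proof cases
      case 1
      then show ?thesis using \<rho>(3)[of n] \<rho>(4)[of n]
        by (simp add: \<gamma>_def nat_add_distrib)
    next
      case 2
      then show ?thesis using \<sigma>(3)[of 1, THEN adjacent_sym] \<sigma>(4)[of 0] \<rho>(1,2) \<sigma>(1,2)
        by (simp add: \<gamma>_def numeral_2_eq_2)
    next
      case 3
      have a: "adjacent av (\<sigma> (n + 3)) (\<sigma> (n + 2))"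
        using \<sigma>(3)[of "n + 2", THEN adjacent_sym] by (simp add: numeral_3_eq_3)
      have b: "\<sigma> (n + 3) \<noteq> \<sigma> (n + 1)"
        using \<sigma>(4)[of "n + 1"] by (simp add: numeral_3_eq_3)
      have "\<gamma> i = \<sigma> (n + 3)" "\<gamma> (i + 1) = \<sigma> (n + 2)" "\<gamma> (i + 2) = \<sigma> (n + 1)"
        using 3 \<rho>(1) \<sigma>(2) by (auto simp: \<gamma>_def nat_add_distrib intro!: arg_cong[of _ _ \<sigma>])
      then show ?thesis using a b by simp
    qed
  qed
  then show thesis using \<rho>(1,2) by (intro that[of \<gamma>]) (simp_all add: \<gamma>_def)
qed

section \<open>Segments of lines\<close>

text \<open>The number counts vertices: a k-path is \<open>seg \<gamma> i (Suc k)\<close>, an edge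
  of the k-th path graph is \<open>seg \<gamma> i (Suc (Suc k))\<close>.\<close>

definition seg :: "(int \<Rightarrow> 'a vertex) \<Rightarrow> int \<Rightarrow> nat \<Rightarrow> 'a vertex list" where
  "seg \<gamma> i n = map (\<lambda>j. \<gamma> (i + int j)) [0..<n]"

lemma length_seg [simp]: "length (seg \<gamma> i n) = n"
  and nth_seg: "j < n \<Longrightarrow> seg \<gamma> i n ! j = \<gamma> (i + int j)"
  by (simp_all add: seg_def)

lemma set_seg: "set (seg \<gamma> i n) = (\<lambda>j. \<gamma> (i + int j)) ` {..<n}"
  by (auto simp: seg_def)

lemma seg_eq_iff: "p = seg \<gamma> i n \<longleftrightarrow> length p = n \<and> (\<forall>j<n. p ! j = \<gamma> (i + int j))"
  by (auto simp: list_eq_iff_nth_eq nth_seg)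

lemma seg_Suc: "seg \<gamma> i (Suc n) = \<gamma> i # seg \<gamma> (i + 1) n"
  by (rule sym) (auto simp: seg_eq_iff nth_Cons nth_seg algebra_simps split: nat.split)

lemma seg_Suc_snoc: "seg \<gamma> i (Suc n) = seg \<gamma> i n @ [\<gamma> (i + int n)]"
  by (simp add: seg_def)

lemma tl_seg: "tl (seg \<gamma> i (Suc n)) = seg \<gamma> (i + 1) n"
  by (simp add: seg_Suc)

lemma butlast_seg: "butlast (seg \<gamma> i (Suc n)) = seg \<gamma> i n"
  by (simp add: seg_Suc_snoc)

lemma seg_shift: "seg (\<lambda>j. \<gamma> (j + c)) i n = seg \<gamma> (i + c) n"
  by (simp add: seg_def algebra_simps)

lemma map_seg: "map f (seg \<gamma> i n) = seg (\<lambda>j. f (\<gamma> j)) i n"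
  by (simp add: seg_def)

lemma seg_cong: "(\<And>j. i \<le> j \<Longrightarrow> j < i + int n \<Longrightarrow> \<gamma> j = \<delta> j) \<Longrightarrow> seg \<gamma> i n = seg \<delta> i n"
  by (auto simp: seg_def)

lemma seg_eqD: "seg \<gamma> i n = seg \<delta> i n \<Longrightarrow> i \<le> j \<Longrightarrow> j < i + int n \<Longrightarrow> \<gamma> j = \<delta> j"
  using nth_seg[of "nat (j - i)" n \<gamma> i] nth_seg[of "nat (j - i)" n \<delta> i] by simp

lemma seg_inject:
  assumes "line \<gamma>" "0 < n"
  shows "seg \<gamma> i n = seg \<gamma> j n \<longleftrightarrow> i = j"
proof
  assume "seg \<gamma> i n = seg \<gamma> j n"
  then have "seg \<gamma> i n ! 0 = seg \<gamma> j n ! 0" by simp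
  then show "i = j" using assms by (simp add: nth_seg line_eq_iff)
qed simp

lemma seg_path:
  assumes "line \<gamma>"
  shows "seg \<gamma> i (Suc k) \<in> paths av k"
proof -
  have "inj_on (\<lambda>j. \<gamma> (i + int j)) {..k}"
    by (rule inj_onI) (use assms in \<open>simp add: line_eq_iff\<close>)
  then have "distinct (seg \<gamma> i (Suc k))"
    by (simp add: seg_def distinct_map atLeast0_lessThan_Suc lessThan_atLeast0[symmetric] lessThan_Suc_atMost del: upt_Suc)
  moreover have "\<gamma> j \<in> vertices av" for j
    using assms adjacent_vertices(1) by (auto simp: line_def)
  moreover have "adjacent av (\<gamma> (i + int j)) (\<gamma> (i + int (Suc j)))" for j
    using assms unfolding line_def by (metis add.assoc of_nat_Suc add.commute)
  ultimately show ?thesis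
    by (auto simp: paths_def set_seg nth_seg)
qed

lemma path_tl: "p \<in> paths av (Suc k) \<Longrightarrow> tl p \<in> paths av k"
  unfolding paths_def by (auto simp: nth_tl distinct_tl dest: list.set_sel(2)[rotated])

lemma path_butlast: "p \<in> paths av (Suc k) \<Longrightarrow> butlast p \<in> paths av k"
  unfolding paths_def by (auto simp: nth_butlast distinct_butlast dest: in_set_butlastD)

text \<open>Every path extends to a line, so statements about paths reduce to lines. The tail lies
  on a line by induction, and a backward half-line through the first edge is glued to it.\<close>

lemma path_eq_seg_Suc:
  assumes "p \<in> paths av (Suc k)"
  obtains \<gamma> where "line \<gamma>" "p = seg \<gamma> 0 (Suc (Suc k))"
  using assms
proof (induction k arbitrary: p thesis)
  case 0
  then obtain u v where p: "p = [u, v]"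
    by (auto simp: paths_def length_Suc_conv)
  then have "adjacent av u v" using 0 by (auto simp: paths_def)
  then obtain \<gamma> where "line \<gamma>" "\<gamma> 0 = u" "\<gamma> 1 = v" by (rule line_through_edge)
  then show ?case using 0(1)[of \<gamma>] p by (simp add: seg_def)
next
  case (Suc k)
  obtain \<gamma> where \<gamma>: "line \<gamma>" "tl p = seg \<gamma> 0 (Suc (Suc k))"
    using Suc.IH path_tl[OF Suc.prems(2)] by blast
  define u where "u = hd p"
  have "p \<noteq> []" using Suc.prems(2) by (auto simp: paths_def)
  then have p: "p = u # seg \<gamma> 0 (Suc (Suc k))"
    unfolding \<gamma>(2)[symmetric] u_def by simp
  have "adjacent av u (\<gamma> 0)"
    using Suc.prems(2) unfolding p paths_def by (auto simp: nth_seg dest: spec[of _ 0])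
  then obtain \<delta> where \<delta>: "line \<delta>" "\<delta> 0 = u" "\<delta> 1 = \<gamma> 0" by (rule line_through_edge)
  have "u \<noteq> \<gamma> 1"
    using Suc.prems(2) unfolding p paths_def by (auto simp: set_seg image_iff dest: bspec[of _ _ 1])
  \<comment> \<open>The shift puts \<open>u\<close> at position -1 and the junction at 0; the next
    step shifts back so that \<open>u\<close> starts the segment.\<close>
  then have "line (glue (\<lambda>i. \<delta> (i + 1)) \<gamma>)"
    using \<delta> \<gamma>(1) by (intro line_glue line_shift) auto
  then have "line (\<lambda>i. glue (\<lambda>i. \<delta> (i + 1)) \<gamma> (i + (- 1)))" by (rule line_shift)
  moreover have "p = seg (\<lambda>i. glue (\<lambda>i. \<delta> (i + 1)) \<gamma> (i + (- 1))) 0 (Suc (Suc (Suc k)))"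
    unfolding p seg_shift seg_Suc[of _ _ "Suc (Suc k)"]
    using \<delta>(2) by (auto simp: glue_def intro!: seg_cong)
  ultimately show ?case by (rule Suc.prems(1))
qed

lemma path_eq_seg:
  assumes "p \<in> paths av k"
  obtains \<gamma> where "line \<gamma>" "p = seg \<gamma> 0 (Suc k)"
proof (cases k)
  case 0
  then obtain s where s: "p = [s]" "s \<in> vertices av"
    using assms by (auto simp: paths_def length_Suc_conv)
  then obtain t where "adjacent av s t" using ex_other_neighbour by blast
  then obtain \<gamma> where "line \<gamma>" "\<gamma> 0 = s" by (rule line_through_edge)
  then show thesis using s 0 by (intro that[of \<gamma>]) (simp_all add: seg_def)
next
  case (Suc l)
  then show thesis using assms path_eq_seg_Suc that by metis
qed

lemma path_eq_seg_at:
  assumes "p \<in> paths av k"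
  obtains \<gamma> where "line \<gamma>" "p = seg \<gamma> i (Suc k)"
proof -
  obtain \<gamma> where "line \<gamma>" "p = seg \<gamma> 0 (Suc k)" using assms by (rule path_eq_seg)
  then show thesis
    using seg_shift[of \<gamma> "- i" i "Suc k"]
    by (intro that[of "\<lambda>j. \<gamma> (j + (- i))"] line_shift) simp_all
qed

text \<open>Uniqueness of geodesics. If the first steps differed, the reversal of
  \<open>\<gamma>\<close> glued to \<open>\<delta>\<close> would be a line meeting the common
  endpoint twice, against injectivity.\<close>

lemma line_segment_unique:
  assumes "line \<gamma>" "line \<delta>" "\<gamma> 0 = \<delta> 0" "\<gamma> (int m) = \<delta> (int n)"
  shows "m = n \<and> (\<forall>i. 0 \<le> i \<longrightarrow> i \<le> int m \<longrightarrow> \<gamma> i = \<delta> i)"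
  using assms
proof (induction m arbitrary: \<gamma> \<delta> n)
  case 0
  then have "\<delta> (int n) = \<delta> 0" by simp
  then show ?case using 0 by (simp add: line_eq_iff)
next
  case (Suc m)
  have n: "n \<noteq> 0"
  proof
    assume "n = 0"
    then have "\<gamma> (int (Suc m)) = \<gamma> 0" using Suc.prems by simp
    then show False using Suc.prems(1) by (simp add: line_eq_iff)
  qed
  have "\<gamma> 1 = \<delta> 1"
  proof (rule ccontr)
    assume "\<gamma> 1 \<noteq> \<delta> 1"
    then have l: "line (glue (\<lambda>i. \<gamma> (- i)) \<delta>)"
      using Suc.prems by (intro line_glue line_uminus) auto
    have "glue (\<lambda>i. \<gamma> (- i)) \<delta> (- int (Suc m)) = glue (\<lambda>i. \<gamma> (- i)) \<delta> (int n)"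
      using Suc.prems(4) by (simp add: glue_def add.commute)
    then show False unfolding line_eq_iff[OF l] by simp
  qed
  then have IH: "m = n - 1 \<and> (\<forall>i. 0 \<le> i \<longrightarrow> i \<le> int m \<longrightarrow> \<gamma> (i + 1) = \<delta> (i + 1))"
    using Suc.prems n by (intro Suc.IH line_shift) (auto simp: of_nat_diff add.commute)
  moreover have "\<gamma> i = \<delta> i" if "0 \<le> i" "i \<le> int (Suc m)" for i
  proof (cases "i = 0")
    case False
    then have "0 \<le> i - 1" "i - 1 \<le> int m" using that by auto
    then have "\<gamma> ((i - 1) + 1) = \<delta> ((i - 1) + 1)" using IH by blast
    then show ?thesis by simp
  qed (use Suc.prems in simp)
  moreover have "Suc m = n" using IH n by simp
  ultimately show ?case by blast
qed

end

section \<open>Exactness\<close>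

lemma Sum_any_shift_int: "Sum_any (\<lambda>i. F (i + c)) = Sum_any (F :: int \<Rightarrow> 'b::comm_monoid_add)"
  by (rule sym, rule Sum_any.reindex_cong[of "\<lambda>i. i + c"]) (auto simp: bij_plus_right)

lemma finite_shift_int: "finite {i. F i \<noteq> (0::'b::zero)} \<Longrightarrow> finite {i. F (i + c) \<noteq> 0}" for c :: int
  using finite_vimageI[of "{i. F i \<noteq> 0}" "\<lambda>i. i + c"] by (simp add: vimage_def inj_on_def)

lemma Sum_any_diff:
  fixes F G :: "'b \<Rightarrow> 'c::ab_group_add"
  assumes "finite {i. F i \<noteq> 0}" "finite {i. G i \<noteq> 0}"
  shows "Sum_any (\<lambda>i. F i - G i) = Sum_any F - Sum_any G"
proof -
  have fin: "finite {i. F i - G i \<noteq> 0}"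
    by (rule finite_subset[of _ "{i. F i \<noteq> 0} \<union> {i. G i \<noteq> 0}"]) (use assms in auto)
  have "Sum_any (\<lambda>i. (F i - G i) + G i) = Sum_any (\<lambda>i. F i - G i) + Sum_any G"
    by (rule Sum_any.distrib[OF fin assms(2)])
  then show ?thesis by (simp add: algebra_simps)
qed

context nonarch_local_field
begin

text \<open>Forgets exactly the choice of origin: two lines have the same image iff they differ by a
  shift, by \<open>apt_shift\<close> and \<open>apt_eqD\<close>.\<close>

definition apt :: "(int \<Rightarrow> 'a vertex) \<Rightarrow> 'a oriented_apartment" where
  "apt \<gamma> = (range \<gamma>, range (\<lambda>i. (\<gamma> i, \<gamma> (i + 1))))"

lemma oriented_apartments_eq: "oriented_apartments av = apt ` {\<gamma>. line \<gamma>}"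
  unfolding oriented_apartments_def apt_def line_iff_inj by blast

lemma apt_mem: "line \<gamma> \<Longrightarrow> apt \<gamma> \<in> oriented_apartments av"
  by (simp add: oriented_apartments_eq)

lemma apt_paths:
  assumes \<gamma>: "line \<gamma>"
  shows "apartment_paths av k (apt \<gamma>) = range (\<lambda>i. seg \<gamma> i (Suc k))"
proof (intro equalityI subsetI)
  fix p assume "p \<in> apartment_paths av k (apt \<gamma>)"
  then have p: "length p = Suc k" "set p \<subseteq> range \<gamma>"
    and e: "\<And>j. j < k \<Longrightarrow> (p ! j, p ! Suc j) \<in> range (\<lambda>i. (\<gamma> i, \<gamma> (i + 1)))"
    by (auto simp: apartment_paths_def apt_def paths_def)
  then have "p ! 0 \<in> range \<gamma>" by (auto intro: nth_mem)
  then obtain i where i: "p ! 0 = \<gamma> i" by blast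
  have "p ! j = \<gamma> (i + int j)" if "j < Suc k" for j
    using that
  proof (induction j)
    case (Suc j)
    then obtain l where l: "p ! j = \<gamma> l" "p ! Suc j = \<gamma> (l + 1)" using e[of j] by auto
    then have "\<gamma> l = \<gamma> (i + int j)" using Suc by simp
    then have "l = i + int j" by (simp add: line_eq_iff[OF \<gamma>])
    then show ?case using l(2) by (simp add: ac_simps)
  qed (use i in simp)
  then have "p = seg \<gamma> i (Suc k)" using p by (simp add: seg_eq_iff)
  then show "p \<in> range (\<lambda>i. seg \<gamma> i (Suc k))" by blast
next
  fix p assume "p \<in> range (\<lambda>i. seg \<gamma> i (Suc k))"
  then obtain i where p: "p = seg \<gamma> i (Suc k)" by blast
  have "(\<gamma> (i + int j), \<gamma> (i + int (Suc j))) \<in> range (\<lambda>i. (\<gamma> i, \<gamma> (i + 1)))" for j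
    by (rule range_eqI[of _ _ "i + int j"]) (simp add: ac_simps)
  then show "p \<in> apartment_paths av k (apt \<gamma>)"
    using seg_path[OF \<gamma>, of i k] by (auto simp: p apartment_paths_def apt_def set_seg nth_seg)
qed

lemma finite_seg_support:
  assumes "line \<gamma>" "\<omega> \<in> path_funs av k"
  shows "finite {i. \<omega> (seg \<gamma> i (Suc k)) \<noteq> 0}"
proof -
  have "inj (\<lambda>i. seg \<gamma> i (Suc k))" using assms(1) by (simp add: inj_def seg_inject)
  then have "finite ((\<lambda>i. seg \<gamma> i (Suc k)) -` {p. \<omega> p \<noteq> 0})"
    using assms(2) by (intro finite_vimageI) (simp_all add: path_funs_def)
  then show ?thesis by (simp add: vimage_def)
qed

text \<open>Edges of the apartment are indexed by their starting position, injectively. In this form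
  the transform can be shifted and split at an integer.\<close>

lemma radon_apt:
  assumes \<gamma>: "line \<gamma>"
  shows "radon av k \<omega> (apt \<gamma>) = Sum_any (\<lambda>i. \<omega> (seg \<gamma> i (Suc (Suc k))))"
proof -
  let ?s = "\<lambda>i. seg \<gamma> i (Suc (Suc k))"
  have "inj_on ?s {i. \<omega> (?s i) \<noteq> 0}" using \<gamma> by (simp add: inj_on_def seg_inject)
  moreover have "{a. a \<in> apartment_paths av (Suc k) (apt \<gamma>) \<and> \<omega> a \<noteq> 0} = ?s ` {i. \<omega> (?s i) \<noteq> 0}"
    unfolding apt_paths[OF \<gamma>] by blast
  ultimately show ?thesis
    using apt_mem[OF \<gamma>] by (simp add: radon_def Sum_any.expand_set sum.reindex)
qed

lemma radon_outside: "A \<notin> oriented_apartments av \<Longrightarrow> radon av k \<omega> A = 0"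
  by (simp add: radon_def)

lemma radon_eqI:
  assumes "\<And>\<gamma>. line \<gamma> \<Longrightarrow> radon av k \<omega> (apt \<gamma>) = g (apt \<gamma>)"
    and "\<And>A. A \<notin> oriented_apartments av \<Longrightarrow> g A = 0"
  shows "radon av k \<omega> = g"
proof
  fix A show "radon av k \<omega> A = g A"
    using assms by (cases "A \<in> oriented_apartments av") (auto simp: oriented_apartments_eq radon_def)
qed

section \<open>Coboundaries have vanishing Radon transform\<close>

lemma finite_butlast_preimage:
  assumes "finite S" shows "finite {a \<in> paths av (Suc k). butlast a \<in> S}"
proof (rule finite_subset)
  show "{a \<in> paths av (Suc k). butlast a \<in> S} \<subseteq> (\<Union>s\<in>S. (\<lambda>t. s @ [t]) ` {t. adjacent av (last s) t})"
  proof
    fix a assume a: "a \<in> {a \<in> paths av (Suc k). butlast a \<in> S}"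
    then obtain \<gamma> where \<gamma>: "line \<gamma>" "a = seg \<gamma> 0 (Suc (Suc k))" by (auto elim: path_eq_seg)
    have "adjacent av (\<gamma> (int k)) (\<gamma> (int k + 1))" using \<gamma>(1) by (simp add: line_def)
    then have "adjacent av (last (butlast a)) (\<gamma> (int (Suc k)))"
      unfolding \<gamma>(2) butlast_seg by (simp add: seg_Suc_snoc add.commute)
    moreover have "a = butlast a @ [\<gamma> (int (Suc k))]"
      unfolding \<gamma>(2) butlast_seg by (simp add: seg_Suc_snoc)
    ultimately show "a \<in> (\<Union>s\<in>S. (\<lambda>t. s @ [t]) ` {t. adjacent av (last s) t})"
      using a by blast
  qed
qed (use assms finite_neighbours in auto)

lemma finite_tl_preimage:
  assumes "finite S" shows "finite {a \<in> paths av (Suc k). tl a \<in> S}"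
proof (rule finite_subset)
  show "{a \<in> paths av (Suc k). tl a \<in> S} \<subseteq> (\<Union>s\<in>S. (\<lambda>t. t # s) ` {t. adjacent av (hd s) t})"
  proof
    fix a assume a: "a \<in> {a \<in> paths av (Suc k). tl a \<in> S}"
    then obtain \<gamma> where \<gamma>: "line \<gamma>" "a = seg \<gamma> 0 (Suc (Suc k))" by (auto elim: path_eq_seg)
    have "adjacent av (\<gamma> 1) (\<gamma> 0)" using \<gamma>(1) unfolding line_def by (metis add_0 adjacent_sym)
    then have "adjacent av (hd (tl a)) (\<gamma> 0)"
      unfolding \<gamma>(2) tl_seg by (simp add: seg_Suc)
    moreover have "a = \<gamma> 0 # tl a"
      unfolding \<gamma>(2) tl_seg by (simp add: seg_Suc)
    ultimately show "a \<in> (\<Union>s\<in>S. (\<lambda>t. t # s) ` {t. adjacent av (hd s) t})"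
      using a by blast
  qed
qed (use assms finite_neighbours in auto)

lemma coboundary_mem:
  assumes "f \<in> C0c av k" shows "coboundary av k f \<in> C1c av k"
proof -
  let ?S = "{p. f p \<noteq> 0}"
  have "{a. coboundary av k f a \<noteq> 0} \<subseteq>
      {a \<in> paths av (Suc k). tl a \<in> ?S} \<union> {a \<in> paths av (Suc k). butlast a \<in> ?S}"
    by (auto simp: coboundary_def split: if_splits)
  moreover have "finite ?S" using assms by (simp add: path_funs_def)
  then have "finite ({a \<in> paths av (Suc k). tl a \<in> ?S} \<union> {a \<in> paths av (Suc k). butlast a \<in> ?S})"
    by (intro finite_UnI finite_tl_preimage finite_butlast_preimage)
  ultimately have "finite {a. coboundary av k f a \<noteq> 0}" by (rule finite_subset)
  then show ?thesis by (auto simp: path_funs_def coboundary_def)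
qed

text \<open>The sum telescopes: along a line, the head of each edge is the tail of the next.\<close>

lemma radon_coboundary:
  assumes f: "f \<in> C0c av k" shows "radon av k (coboundary av k f) = (\<lambda>_. 0)"
proof (rule radon_eqI)
  fix \<gamma> assume \<gamma>: "line \<gamma>"
  let ?F = "\<lambda>i. f (seg \<gamma> i (Suc k))"
  have fin: "finite {i. ?F i \<noteq> 0}" by (rule finite_seg_support[OF \<gamma> f])
  have "radon av k (coboundary av k f) (apt \<gamma>) = Sum_any (\<lambda>i. ?F (i + 1) - ?F i)"
    by (simp add: radon_apt[OF \<gamma>] coboundary_def seg_path[OF \<gamma>] tl_seg butlast_seg)
  also have "\<dots> = 0"
    using Sum_any_diff[OF finite_shift_int[OF fin, of 1] fin] Sum_any_shift_int[of ?F 1] by simp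
  finally show "radon av k (coboundary av k f) (apt \<gamma>) = 0" .
qed simp

text \<open>The last window counted, at -1, has \<open>seg \<gamma> 0 (Suc k)\<close> as its head,
  and the first one counted by \<open>forw_sum\<close> has it as its tail. So the two sums split the
  line at that k-path.\<close>

definition back_sum :: "nat \<Rightarrow> ('a vertex list \<Rightarrow> complex) \<Rightarrow> (int \<Rightarrow> 'a vertex) \<Rightarrow> complex" where
  "back_sum k \<omega> \<gamma> = Sum_any (\<lambda>i. if i < 0 then \<omega> (seg \<gamma> i (Suc (Suc k))) else 0)"

definition forw_sum :: "nat \<Rightarrow> ('a vertex list \<Rightarrow> complex) \<Rightarrow> (int \<Rightarrow> 'a vertex) \<Rightarrow> complex" where
  "forw_sum k \<omega> \<gamma> = Sum_any (\<lambda>i. if i < 0 then 0 else \<omega> (seg \<gamma> i (Suc (Suc k))))"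

lemma back_plus_forw:
  assumes \<gamma>: "line \<gamma>" and \<omega>: "\<omega> \<in> C1c av k"
  shows "back_sum k \<omega> \<gamma> + forw_sum k \<omega> \<gamma> = radon av k \<omega> (apt \<gamma>)"
proof -
  let ?F = "\<lambda>i. \<omega> (seg \<gamma> i (Suc (Suc k)))"
  have fin: "finite {i. ?F i \<noteq> 0}" by (rule finite_seg_support[OF \<gamma> \<omega>])
  have "Sum_any (\<lambda>i. (if i < 0 then ?F i else 0) + (if i < 0 then 0 else ?F i)) =
      back_sum k \<omega> \<gamma> + forw_sum k \<omega> \<gamma>"
    unfolding back_sum_def forw_sum_def
    by (rule Sum_any.distrib; rule finite_subset[OF _ fin]) auto
  also have "(\<lambda>i. (if i < 0 then ?F i else 0) + (if i < 0 then 0 else ?F i)) = ?F" by auto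
  finally show ?thesis by (simp add: radon_apt[OF \<gamma>])
qed

text \<open>Moving the origin by one moves just the window at 0 to the backward side. This is the
  identity saying that the backward sum is a primitive of \<open>\<omega>\<close>.\<close>

lemma back_sum_shift:
  assumes \<gamma>: "line \<gamma>" and \<omega>: "\<omega> \<in> C1c av k"
  shows "back_sum k \<omega> (\<lambda>j. \<gamma> (j + 1)) = back_sum k \<omega> \<gamma> + \<omega> (seg \<gamma> 0 (Suc (Suc k)))"
proof -
  let ?F = "\<lambda>i. \<omega> (seg \<gamma> i (Suc (Suc k)))"
  have fin: "finite {i. ?F i \<noteq> 0}" by (rule finite_seg_support[OF \<gamma> \<omega>])
  have "back_sum k \<omega> (\<lambda>j. \<gamma> (j + 1)) = Sum_any (\<lambda>i. if i + 1 < 1 then ?F (i + 1) else 0)"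
    by (simp add: back_sum_def seg_shift cong: if_cong)
  also have "\<dots> = Sum_any (\<lambda>i. if i < 1 then ?F i else 0)"
    by (rule Sum_any_shift_int[of "\<lambda>i. if i < 1 then ?F i else 0" 1])
  also have "(\<lambda>i. if i < 1 then ?F i else 0) =
      (\<lambda>i. (if i < 0 then ?F i else 0) + (if i = 0 then ?F 0 else 0))" by auto
  also have "Sum_any \<dots> = back_sum k \<omega> \<gamma> + Sum_any (\<lambda>i::int. if i = 0 then ?F 0 else 0)"
    unfolding back_sum_def
    by (rule Sum_any.distrib; rule finite_subset[OF _ finite.insertI[OF fin, of 0]]) (auto split: if_splits)
  also have "Sum_any (\<lambda>i::int. if i = 0 then ?F 0 else 0) = ?F 0" by simp
  finally show ?thesis .
qed

lemma back_sum_eq_0D: "back_sum k \<omega> \<gamma> \<noteq> 0 \<Longrightarrow> \<exists>i<0. \<omega> (seg \<gamma> i (Suc (Suc k))) \<noteq> 0"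
proof (rule ccontr)
  assume ne: "back_sum k \<omega> \<gamma> \<noteq> 0" and "\<not> (\<exists>i<0. \<omega> (seg \<gamma> i (Suc (Suc k))) \<noteq> 0)"
  then have "(\<lambda>i. if i < 0 then \<omega> (seg \<gamma> i (Suc (Suc k))) else 0) = (\<lambda>_. 0)" by auto
  then show False using ne[unfolded back_sum_def] by (simp only: Sum_any.neutral)
qed

lemma forw_sum_eq_0D: "forw_sum k \<omega> \<gamma> \<noteq> 0 \<Longrightarrow> \<exists>i\<ge>0. \<omega> (seg \<gamma> i (Suc (Suc k))) \<noteq> 0"
proof (rule ccontr)
  assume ne: "forw_sum k \<omega> \<gamma> \<noteq> 0" and "\<not> (\<exists>i\<ge>0. \<omega> (seg \<gamma> i (Suc (Suc k))) \<noteq> 0)"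
  then have "(\<lambda>i. if i < 0 then 0 else \<omega> (seg \<gamma> i (Suc (Suc k)))) = (\<lambda>_. 0)" by auto
  then show False using ne[unfolded forw_sum_def] by (simp only: Sum_any.neutral)
qed

text \<open>A third line leaving the common segment sees both backward half-lines with the same total
  sum; for \<open>k = 0\<close> this needs three neighbours.\<close>

lemma back_sum_unique:
  assumes \<gamma>: "line \<gamma>" and \<delta>: "line \<delta>" and eq: "seg \<gamma> 0 (Suc k) = seg \<delta> 0 (Suc k)"
    and \<omega>: "\<omega> \<in> C1c av k" and R: "radon av k \<omega> = (\<lambda>_. 0)"
  shows "back_sum k \<omega> \<gamma> = back_sum k \<omega> \<delta>"
proof -
  have eq0: "\<gamma> 0 = \<delta> 0" using seg_eqD[OF eq, of 0] by simp
  obtain \<epsilon> where \<epsilon>: "line \<epsilon>" "seg \<epsilon> 0 (Suc k) = seg \<gamma> 0 (Suc k)" "\<gamma> (- 1) \<noteq> \<epsilon> 1" "\<delta> (- 1) \<noteq> \<epsilon> 1"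
  proof (cases k)
    case 0
    have "\<gamma> 0 \<in> vertices av" using \<gamma> adjacent_vertices(1) by (auto simp: line_def)
    then obtain t where t: "adjacent av (\<gamma> 0) t" "t \<noteq> \<gamma> (- 1)" "t \<noteq> \<delta> (- 1)"
      using ex_other_neighbour by metis
    then obtain \<epsilon> where "line \<epsilon>" "\<epsilon> 0 = \<gamma> 0" "\<epsilon> 1 = t" by (blast elim: line_through_edge)
    then show thesis using t 0 by (intro that[of \<epsilon>]) (auto simp: seg_def)
  next
    \<comment> \<open>The common path now has an edge, so \<open>\<gamma>\<close> itself can serve
      as the third line: neither backward half turns back into \<open>\<gamma> 1\<close>.\<close>
    case (Suc l)
    then have "\<gamma> 1 = \<delta> 1" using seg_eqD[OF eq, of 1] by simp
    moreover have "\<gamma> (- 1) \<noteq> \<gamma> 1" "\<delta> (- 1) \<noteq> \<delta> 1" using \<gamma> \<delta> by (simp_all add: line_eq_iff)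
    ultimately show thesis using \<gamma> by (intro that[of \<gamma>]) simp_all
  qed
  have *: "back_sum k \<omega> \<eta> = - forw_sum k \<omega> \<epsilon>"
    if \<eta>: "line \<eta>" "seg \<epsilon> 0 (Suc k) = seg \<eta> 0 (Suc k)" "\<eta> (- 1) \<noteq> \<epsilon> 1" for \<eta>
  proof -
    have "\<eta> 0 = \<epsilon> 0" using seg_eqD[OF \<eta>(2), of 0] by simp
    then have l: "line (glue \<eta> \<epsilon>)" using \<eta> \<epsilon>(1) by (intro line_glue) auto
    \<comment> \<open>A window starting before 0 reaches at most position \<open>k\<close>, and up
      to there \<open>\<eta>\<close> and \<open>\<epsilon>\<close> agree.\<close>
    have "seg (glue \<eta> \<epsilon>) i (Suc (Suc k)) = seg \<eta> i (Suc (Suc k))" if "i < 0" for i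
      using that seg_eqD[OF \<eta>(2)] by (intro seg_cong) (auto simp: glue_def)
    then have "back_sum k \<omega> (glue \<eta> \<epsilon>) = back_sum k \<omega> \<eta>"
      unfolding back_sum_def by (intro arg_cong[of _ _ Sum_any]) auto
    moreover have "seg (glue \<eta> \<epsilon>) i (Suc (Suc k)) = seg \<epsilon> i (Suc (Suc k))" if "\<not> i < 0" for i
      using that by (intro seg_cong) (auto simp: glue_def)
    then have "forw_sum k \<omega> (glue \<eta> \<epsilon>) = forw_sum k \<omega> \<epsilon>"
      unfolding forw_sum_def by (intro arg_cong[of _ _ Sum_any]) auto
    ultimately show ?thesis
      using back_plus_forw[OF l \<omega>] R by (simp add: eq_neg_iff_add_eq_0)
  qed
  show ?thesis
    using *[OF \<gamma> \<epsilon>(2,3)] *[OF \<delta> _ \<epsilon>(4)] \<epsilon>(2) eq by simp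
qed

text \<open>By uniqueness of geodesics all these segments lie on one fixed line between
  \<open>u\<close> and \<open>v\<close>, so only their starting position varies.\<close>

lemma finite_segments_between:
  "finite {seg \<gamma> (int n) l | \<gamma> m n. line \<gamma> \<and> \<gamma> 0 = u \<and> \<gamma> (int m) = v \<and> 0 < l \<and> n + l \<le> Suc m}"
  (is "finite ?S")
proof (cases "?S = {}")
  case True
  then show ?thesis by (simp only: finite.emptyI)
next
  case False
  then obtain \<delta> M where \<delta>: "line \<delta>" "\<delta> 0 = u" "\<delta> (int M) = v" by blast
  have "?S \<subseteq> (\<lambda>n. seg \<delta> (int n) l) ` {..M}"
  proof
    fix s assume "s \<in> ?S"
    then obtain \<gamma> m n where s: "s = seg \<gamma> (int n) l" "line \<gamma>" "\<gamma> 0 = u" "\<gamma> (int m) = v" "0 < l" "n + l \<le> Suc m"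
      by blast
    then have "m = M" "\<And>i. 0 \<le> i \<Longrightarrow> i \<le> int m \<Longrightarrow> \<gamma> i = \<delta> i"
      using line_segment_unique[of \<gamma> \<delta> m M] \<delta> by auto
    then have "s = seg \<delta> (int n) l" "n \<le> M" using s by (auto intro!: seg_cong)
    then show "s \<in> (\<lambda>n. seg \<delta> (int n) l) ` {..M}" by blast
  qed
  then show ?thesis by (rule finite_subset) simp
qed

lemma radon_kernel:
  assumes \<omega>: "\<omega> \<in> C1c av k" and R: "radon av k \<omega> = (\<lambda>_. 0)"
  shows "\<omega> \<in> coboundary av k ` C0c av k"
proof -
  \<comment> \<open>The line chosen through \<open>s\<close> does not matter, by
    \<open>back_sum_unique\<close>.\<close>
  define f where "f s = (if s \<in> paths av k
    then back_sum k \<omega> (SOME \<gamma>. line \<gamma> \<and> seg \<gamma> 0 (Suc k) = s) else 0)" for s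
  have f0: "f (seg \<gamma> 0 (Suc k)) = back_sum k \<omega> \<gamma>" if \<gamma>: "line \<gamma>" for \<gamma>
  proof -
    define \<delta> where "\<delta> = (SOME \<delta>. line \<delta> \<and> seg \<delta> 0 (Suc k) = seg \<gamma> 0 (Suc k))"
    have "line \<delta> \<and> seg \<delta> 0 (Suc k) = seg \<gamma> 0 (Suc k)"
      unfolding \<delta>_def using \<gamma> by (rule_tac someI[of _ \<gamma>]) simp
    then have "back_sum k \<omega> \<delta> = back_sum k \<omega> \<gamma>" using \<gamma> \<omega> R by (intro back_sum_unique) auto
    then show ?thesis using seg_path[OF \<gamma>] by (simp add: f_def \<delta>_def)
  qed
  have f1: "f (seg \<gamma> 1 (Suc k)) = back_sum k \<omega> (\<lambda>j. \<gamma> (j + 1))" if "line \<gamma>" for \<gamma>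
    using f0[OF line_shift[OF that, of 1]] by (simp add: seg_shift)
  have "coboundary av k f = \<omega>"
  proof
    fix a show "coboundary av k f a = \<omega> a"
    proof (cases "a \<in> paths av (Suc k)")
      case True
      then obtain \<gamma> where \<gamma>: "line \<gamma>" "a = seg \<gamma> 0 (Suc (Suc k))" by (rule path_eq_seg)
      have "coboundary av k f a = f (tl a) - f (butlast a)" using True by (simp add: coboundary_def)
      also have "\<dots> = f (seg \<gamma> 1 (Suc k)) - f (seg \<gamma> 0 (Suc k))"
        unfolding \<gamma>(2) tl_seg butlast_seg by simp
      finally show ?thesis
        using \<gamma> f0[OF \<gamma>(1)] f1[OF \<gamma>(1)] back_sum_shift[OF \<gamma>(1) \<omega>] by simp
    qed (use \<omega> in \<open>auto simp: coboundary_def path_funs_def\<close>)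
  qed
  moreover have "f \<in> C0c av k"
  proof -
    let ?S = "{a. \<omega> a \<noteq> 0}"
    let ?B = "\<lambda>u v. {seg \<gamma> (int n) (Suc k) | \<gamma> m n.
      line \<gamma> \<and> \<gamma> 0 = u \<and> \<gamma> (int m) = v \<and> 0 < Suc k \<and> n + Suc k \<le> Suc m}"
    have "{s. f s \<noteq> 0} \<subseteq> (\<Union>a\<in>?S. \<Union>b\<in>?S. ?B (hd a) (last b))"
    proof
      fix s assume "s \<in> {s. f s \<noteq> 0}"
      then have fs: "f s \<noteq> 0" by simp
      then have "s \<in> paths av k" by (auto simp: f_def split: if_splits)
      then obtain \<gamma> where \<gamma>: "line \<gamma>" "s = seg \<gamma> 0 (Suc k)" by (rule path_eq_seg)
      have b: "back_sum k \<omega> \<gamma> \<noteq> 0" using fs f0[OF \<gamma>(1)] \<gamma>(2) by simp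
      then have "forw_sum k \<omega> \<gamma> \<noteq> 0" using back_plus_forw[OF \<gamma>(1) \<omega>] R by auto
      then obtain j where j: "0 \<le> j" "seg \<gamma> j (Suc (Suc k)) \<in> ?S" using forw_sum_eq_0D by blast
      obtain i where i: "i < 0" "seg \<gamma> i (Suc (Suc k)) \<in> ?S" using back_sum_eq_0D[OF b] by blast
      \<comment> \<open>The backward sum is nonzero and the total is zero, so both half-lines meet
        the support. Recentring at the earlier window puts \<open>s\<close> on a geodesic from
        \<open>hd a\<close> to \<open>last b\<close> for two supporting paths \<open>a\<close> and
        \<open>b\<close>.\<close>
      let ?\<delta> = "\<lambda>l. \<gamma> (l + i)"
      have "s = seg ?\<delta> (int (nat (- i))) (Suc k)" using i by (simp add: \<gamma>(2) seg_shift)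
      moreover have "?\<delta> 0 = hd (seg \<gamma> i (Suc (Suc k)))" by (simp add: seg_Suc)
      moreover have "?\<delta> (int (nat (j + int (Suc k) - i))) = last (seg \<gamma> j (Suc (Suc k)))"
        using i j by (simp add: seg_Suc_snoc)
      moreover have "nat (- i) + Suc k \<le> Suc (nat (j + int (Suc k) - i))" using i j by linarith
      ultimately have "s \<in> ?B (hd (seg \<gamma> i (Suc (Suc k)))) (last (seg \<gamma> j (Suc (Suc k))))"
        using line_shift[OF \<gamma>(1), of i] zero_less_Suc[of k] by (intro CollectI exI conjI)
      then show "s \<in> (\<Union>a\<in>?S. \<Union>b\<in>?S. ?B (hd a) (last b))" using i(2) j(2) by blast
    qed
    moreover have "finite (\<Union>a\<in>?S. \<Union>b\<in>?S. ?B (hd a) (last b))"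
      using \<omega> by (intro finite_UN_I finite_segments_between) (simp_all add: path_funs_def)
    ultimately have "finite {s. f s \<noteq> 0}" by (rule finite_subset)
    then show ?thesis by (auto simp: path_funs_def f_def split: if_splits)
  qed
  ultimately show ?thesis by blast
qed

theorem coboundary_image:
  "coboundary av k ` C0c av k = {\<omega> \<in> C1c av k. radon av k \<omega> = (\<lambda>_. 0)}"
  using coboundary_mem radon_coboundary radon_kernel by blast

end

section \<open>The group PGL(2) and its action\<close>

lemma carrier_GL2 [simp]: "carrier GL2 = {A. invertible A}"
  and mult_GL2 [simp]: "A \<otimes>\<^bsub>GL2\<^esub> B = A ** B"
  and one_GL2 [simp]: "\<one>\<^bsub>GL2\<^esub> = mat 1"
  by (simp_all add: GL2_def)

lemma invertible_mat_1: "invertible (mat 1 :: 'a::field^2^2)"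
  unfolding invertible_def by (intro exI[of _ "mat 1"]) simp

lemma group_GL2: "group (GL2 :: ('a::field^2^2) monoid)"
proof (rule groupI)
  fix A :: "'a^2^2" assume "A \<in> carrier GL2"
  then obtain B where "invertible B" "B ** A = mat 1" using invertible_cancel[of A] by auto
  then show "\<exists>B\<in>carrier GL2. B \<otimes>\<^bsub>GL2\<^esub> A = \<one>\<^bsub>GL2\<^esub>" by auto
qed (simp_all add: invertible_mult invertible_mat_1 matrix_mul_assoc)

lemma mat_mult_mat: "mat c ** mat d = (mat (c * d) :: 'a::field^2^2)"
  by (rule mat2_eqI) (simp_all add: matrix_mult_2)

lemma mat_commute: "mat c ** A = A ** (mat c :: 'a^2^2)" for A :: "'a::field^2^2"
  by (rule mat2_eqI) (simp_all add: matrix_mult_2 mult.commute)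

lemma invertible_mat:
  assumes "c \<noteq> (0::'a::field)" shows "invertible (mat c :: 'a^2^2)"
  unfolding invertible_def
  by (intro exI[of _ "mat (inverse c)"]) (use assms in \<open>simp add: mat_mult_mat\<close>)

lemma r_coset_scalars: "scalars #>\<^bsub>GL2\<^esub> A = {mat c ** A | c. c \<noteq> 0}"
  by (auto simp: r_coset_def scalars_def)

lemma normal_scalars: "(scalars :: ('a::field^2^2) set) \<lhd> GL2"
proof -
  interpret group "GL2 :: ('a^2^2) monoid" by (rule group_GL2)
  have "subgroup (scalars :: ('a^2^2) set) GL2"
  proof (rule subgroupI)
    show "(scalars :: ('a^2^2) set) \<subseteq> carrier GL2" by (auto simp: scalars_def invertible_mat)
    show "(scalars :: ('a^2^2) set) \<noteq> {}" unfolding scalars_def by (auto intro: exI[of _ 1])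
    fix A :: "'a^2^2" assume "A \<in> scalars"
    then obtain c where c: "A = mat c" "c \<noteq> 0" by (auto simp: scalars_def)
    have "inv\<^bsub>GL2\<^esub> A = mat (inverse c)"
      using c by (intro inv_equality) (simp_all add: mat_mult_mat invertible_mat)
    then show "inv\<^bsub>GL2\<^esub> A \<in> scalars" using c by (auto simp: scalars_def)
    fix B :: "'a^2^2" assume "B \<in> scalars"
    then show "A \<otimes>\<^bsub>GL2\<^esub> B \<in> scalars" using c by (auto simp: scalars_def mat_mult_mat)
  qed
  moreover have "scalars #>\<^bsub>GL2\<^esub> A = A <#\<^bsub>GL2\<^esub> scalars" for A :: "'a^2^2"
    unfolding r_coset_scalars by (auto simp: l_coset_def scalars_def mat_commute[of _ A])
  ultimately show ?thesis by (intro normalI) auto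
qed

definition proj :: "'a::field^2^2 \<Rightarrow> ('a^2^2) set" where
  "proj A = scalars #>\<^bsub>GL2\<^esub> A"

lemma proj_eq: "proj A = {mat c ** A | c. c \<noteq> 0}"
  by (simp add: proj_def r_coset_scalars)

lemma group_PGL2: "group (PGL2 :: ('a::field^2^2) set monoid)"
  unfolding PGL2_def by (rule normal.factorgroup_is_group[OF normal_scalars])

lemma carrier_PGL2: "carrier PGL2 = proj ` {A. invertible A}"
  by (simp add: PGL2_def carrier_FactGroup proj_def)

lemma proj_mult: "invertible A \<Longrightarrow> invertible B \<Longrightarrow> proj A \<otimes>\<^bsub>PGL2\<^esub> proj B = proj (A ** B)"
  unfolding proj_def PGL2_def using normal.rcos_sum[OF normal_scalars, of A B] by simp

lemma one_PGL2: "\<one>\<^bsub>PGL2\<^esub> = proj (mat 1)"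
  by (auto simp: PGL2_def proj_eq scalars_def)

lemma proj_inv:
  assumes "invertible A" "invertible B" "B ** A = mat 1"
  shows "inv\<^bsub>PGL2\<^esub> (proj A) = proj B"
proof -
  interpret group "PGL2 :: ('a^2^2) set monoid" by (rule group_PGL2)
  show ?thesis using assms by (intro inv_equality) (simp_all add: proj_mult one_PGL2 carrier_PGL2)
qed

lemma torus_eq: "torus = {proj (mat2 a 0 0 d) | a d. a * d \<noteq> (0::'a::field)}"
proof (intro equalityI subsetI)
  fix g :: "('a^2^2) set" assume "g \<in> torus"
  then obtain A where A: "g = proj A" "invertible A" "A $ 1 $ 2 = 0" "A $ 2 $ 1 = 0"
    by (auto simp: torus_def proj_def)
  obtain B where "A ** B = mat 1" using invertible_cancel[OF A(2)] by metis
  then have "(A ** B) $ 1 $ 1 = 1" "(A ** B) $ 2 $ 2 = 1" by simp_all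
  then have "A $ 1 $ 1 * A $ 2 $ 2 \<noteq> 0" using A(3,4) by (auto simp: matrix_mult_2)
  moreover have "g = proj (mat2 (A $ 1 $ 1) 0 0 (A $ 2 $ 2))"
    unfolding A(1) using A(3,4) by (intro arg_cong[of _ _ proj] mat2_eqI) simp_all
  ultimately show "g \<in> {proj (mat2 a 0 0 d) | a d. a * d \<noteq> 0}" by blast
next
  fix g :: "('a^2^2) set" assume "g \<in> {proj (mat2 a 0 0 d) | a d. a * d \<noteq> 0}"
  then obtain a d where "g = proj (mat2 a 0 0 d)" "a * d \<noteq> 0" by blast
  then show "g \<in> torus" unfolding torus_def proj_def
    using invertible_mat2[of a d 0 0] by (intro CollectI exI[of _ "mat2 a 0 0 d"]) simp
qed

lemma vact_mat:
  assumes "c \<noteq> 0" shows "vact (mat c) (homothety_class L) = homothety_class L"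
proof -
  have "(*v) (mat c) ` L = (*s) c ` L"
    by (intro image_cong refl vector_eqI_2) (simp_all add: mult_vec_2)
  then show ?thesis using assms by (simp add: vact_homothety_class homothety_class_scale)
qed

context nonarch_local_field
begin

section \<open>The action on vertices and oriented apartments\<close>

lemma vact_mat_vertex: "c \<noteq> 0 \<Longrightarrow> s \<in> vertices av \<Longrightarrow> vact (mat c) s = s"
  by (auto simp: vertices_def vact_mat)

text \<open>Scalars fix every vertex, so the union over the coset collapses to a single
  term.\<close>

lemma vertex_act_proj:
  assumes M: "invertible M" and s: "s \<in> vertices av"
  shows "vertex_act (proj M) s = vact M s"
proof -
  have "vact (mat c ** M) s = vact M s" if "c \<noteq> 0" for c
    using that vact_vertex[OF M s] by (simp add: vact_mult vact_mat_vertex)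
  then have "(\<Union>A\<in>proj M. vact A s) = (\<Union>A\<in>proj M. vact M s)"
    by (intro SUP_cong) (auto simp: proj_eq)
  moreover have "mat 1 ** M \<in> proj M" unfolding proj_eq by (intro CollectI exI[of _ 1]) simp
  ultimately show ?thesis by (auto simp: vertex_act_def vact_def)
qed

lemma line_vertex: "line \<gamma> \<Longrightarrow> \<gamma> i \<in> vertices av"
  using adjacent_vertices(1) by (auto simp: line_def)

lemma apartment_act_proj:
  assumes "invertible M" "line \<gamma>"
  shows "apartment_act (proj M) (apt \<gamma>) = apt (\<lambda>i. vact M (\<gamma> i))"
  using assms by (simp add: apartment_act_def apt_def image_image vertex_act_proj line_vertex)

lemma std_apartment_apt: "std_apartment av = apt (bvert 0)"
proof -
  have 1: "{std_vertex av a | a. a \<noteq> 0} = range (bvert 0)"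
  proof (intro equalityI subsetI)
    fix s assume "s \<in> {std_vertex av a | a. a \<noteq> 0}"
    then show "s \<in> range (bvert 0)" by (auto elim!: av_eq_rad simp: std_vertex_bvert)
  next
    fix s assume "s \<in> range (bvert 0)"
    then obtain i where "s = bvert 0 i" by blast
    then have "s = std_vertex av (unif powi i)" by (simp add: std_vertex_bvert[OF av_unif_powi])
    then show "s \<in> {std_vertex av a | a. a \<noteq> 0}" using unif_powi_nonzero by blast
  qed
  have wa: "std_vertex av (w * a) = bvert 0 (i + 1)" if "av a = rad i" "uniformizer av w" for a w i
    using that by (intro std_vertex_bvert) (simp add: av_mult av_uniformizer rad_add rad_1)
  have 2: "{(std_vertex av a, std_vertex av (w * a)) | a w. a \<noteq> 0 \<and> uniformizer av w} =
      range (\<lambda>i. (bvert 0 i, bvert 0 (i + 1)))"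
  proof (intro equalityI subsetI)
    fix e assume "e \<in> {(std_vertex av a, std_vertex av (w * a)) | a w. a \<noteq> 0 \<and> uniformizer av w}"
    then show "e \<in> range (\<lambda>i. (bvert 0 i, bvert 0 (i + 1)))"
      by (auto elim!: av_eq_rad simp: std_vertex_bvert wa)
  next
    fix e assume "e \<in> range (\<lambda>i. (bvert 0 i, bvert 0 (i + 1)))"
    then obtain i where "e = (bvert 0 i, bvert 0 (i + 1))" by blast
    then have "e = (std_vertex av (unif powi i), std_vertex av (unif * unif powi i))"
      by (simp add: std_vertex_bvert[OF av_unif_powi] wa[OF av_unif_powi uniformizer_unif])
    then show "e \<in> {(std_vertex av a, std_vertex av (w * a)) | a w. a \<noteq> 0 \<and> uniformizer av w}"
      using unif_powi_nonzero uniformizer_unif by blast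
  qed
  show ?thesis by (simp add: std_apartment_def apt_def 1 2)
qed

text \<open>The orbit map of the standard oriented apartment on matrices; the topology is studied
  through it.\<close>

definition mapt :: "'a^2^2 \<Rightarrow> 'a oriented_apartment" where
  "mapt M = apt (\<lambda>i. vact M (bvert 0 i))"

lemma mapt_eq: "invertible M \<Longrightarrow> apartment_act (proj M) (std_apartment av) = mapt M"
  by (simp add: std_apartment_apt mapt_def apartment_act_proj line_std)

lemma mapt_mult: "invertible M \<Longrightarrow> invertible N \<Longrightarrow> apartment_act (proj M) (mapt N) = mapt (M ** N)"
  by (simp add: mapt_def apartment_act_proj line_vact line_std vact_mult)

lemma mapt_mem: "invertible M \<Longrightarrow> mapt M \<in> oriented_apartments av"
  by (simp add: mapt_def apt_mem line_vact line_std)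

lemma oriented_apartments_mapt: "oriented_apartments av = mapt ` {M. invertible M}"
proof (intro equalityI subsetI)
  fix A assume "A \<in> oriented_apartments av"
  then obtain \<gamma> where \<gamma>: "line \<gamma>" "A = apt \<gamma>" by (auto simp: oriented_apartments_eq)
  obtain M where "invertible M" "\<gamma> = (\<lambda>i. vact M (bvert 0 i))"
    using line_transitive[OF \<gamma>(1)] by (metis ext)
  then have "A = mapt M" using \<gamma>(2) by (simp add: mapt_def)
  then show "A \<in> mapt ` {M. invertible M}" using \<open>invertible M\<close> by blast
qed (auto simp: mapt_mem)

lemma apt_shift: "apt (\<lambda>i. \<gamma> (i + c)) = apt \<gamma>"
proof -
  have "range (\<lambda>i. g (i + c)) = range g" for g :: "int \<Rightarrow> 'b"
  proof (intro equalityI subsetI)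
    fix x assume "x \<in> range g"
    then obtain i where "x = g ((i - c) + c)" by auto
    then show "x \<in> range (\<lambda>i. g (i + c))" by blast
  qed auto
  from this[of \<gamma>] this[of "\<lambda>i. (\<gamma> i, \<gamma> (i + 1))"] show ?thesis by (simp add: apt_def ac_simps)
qed

text \<open>Matching the directed edge at 0 determines the shift; since directed edges have unique
  successors and predecessors on a line, it propagates both ways.\<close>

lemma apt_eqD:
  assumes \<gamma>: "line \<gamma>" and \<delta>: "line \<delta>" and eq: "apt \<gamma> = apt \<delta>"
  obtains c where "\<And>i. \<delta> i = \<gamma> (i + c)"
proof -
  have e: "\<exists>l. \<delta> i = \<gamma> l \<and> \<delta> (i + 1) = \<gamma> (l + 1)" for i
  proof -
    have "(\<delta> i, \<delta> (i + 1)) \<in> range (\<lambda>i. (\<gamma> i, \<gamma> (i + 1)))" using eq by (auto simp: apt_def)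
    then show ?thesis by blast
  qed
  obtain c where c: "\<delta> 0 = \<gamma> c" using e[of 0] by blast
  have "\<delta> i = \<gamma> (i + c)" for i
  proof (induction i rule: int_induct[of _ 0])
    case (step1 i)
    then obtain l where "\<gamma> (i + c) = \<gamma> l" "\<delta> (i + 1) = \<gamma> (l + 1)" using e[of i] by auto
    then show ?case using line_eq_iff[OF \<gamma>] by (auto simp: ac_simps)
  next
    case (step2 i)
    then obtain l where "\<delta> (i - 1) = \<gamma> l" "\<gamma> (i + c) = \<gamma> (l + 1)" using e[of "i - 1"] by auto
    moreover then have "l = i - 1 + c" using line_eq_iff[OF \<gamma>] by auto
    ultimately show ?case by simp
  qed (simp add: c)
  then show thesis by (rule that)
qed

text \<open>Up to a scalar the matrix is the dilation by \<open>a / d\<close>, which shifts radii by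
  the exponent of that quotient.\<close>

lemma vact_diag:
  assumes "a * d \<noteq> 0"
  obtains j where "\<And>i. vact (mat2 a 0 0 d) (bvert 0 i) = bvert 0 (i + j)"
proof -
  obtain j where j: "av (a / d) = rad j" using av_eq_rad[of "a / d"] assms by auto
  have "mat2 a 0 0 d = mat d ** mat2 (a / d) 0 0 1"
    using assms by (intro mat2_eqI) (simp_all add: matrix_mult_2)
  then have "vact (mat2 a 0 0 d) (bvert 0 i) = bvert 0 (i + j)" for i
    using assms vact_affine[OF j, of 0 0 i] by (simp add: vact_mult vact_mat_vertex bvert_vertex add.commute)
  then show thesis by (rule that)
qed

text \<open>A matrix translating the standard line fixes its two ends, hence is diagonal.\<close>

lemma diag_if_translates:
  assumes tr: "\<And>i. vact D (bvert 0 i) = bvert 0 (i + c)"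
  shows "D $ 1 $ 2 = 0" "D $ 2 $ 1 = 0"
proof -
  let ?a = "av (D $ 1 $ 1)" and ?b = "av (D $ 1 $ 2)" and ?c = "av (D $ 2 $ 1)" and ?d = "av (D $ 2 $ 2)"
  \<comment> \<open>The generators of \<open>lat 0 i\<close> bound the off-diagonal entries by the
    homothety factor \<open>e\<close>; preimages of the generators of the target bound
    \<open>e\<close> from above. After eliminating \<open>e\<close>, the first inequality forces
    \<open>?b\<close> to 0 as \<open>i\<close> grows. The second forces \<open>?c\<close> to 0 as
    \<open>i\<close> decreases, since its left side grows quadratically in \<open>rad i\<close> and
    its right side only linearly.\<close>
  have key: "?b \<le> rad (i + c) * max (?c * rad i) ?d \<and> ?c * rad i * rad (i + c) \<le> max (?a * rad i) ?b" for i
  proof -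
    have "homothety_class ((*v) D ` lat 0 i) = homothety_class (lat 0 (i + c))"
      using tr[of i] by (simp add: bvert_def vact_homothety_class)
    then obtain e where e: "e \<noteq> 0" "(*v) D ` lat 0 i = (*s) e ` lat 0 (i + c)"
      by (rule homothety_class_eqE)
    have up: "av ((D *v x) $ 1) \<le> av e * rad (i + c) \<and> av ((D *v x) $ 2) \<le> av e"
      if "x \<in> lat 0 i" for x
    proof -
      have "D *v x \<in> (*s) e ` lat 0 (i + c)" using that e(2) by blast
      then show ?thesis by (auto simp: lat_def av_mult av_nonneg mult_left_mono mult_left_le)
    qed
    have b: "?b \<le> av e * rad (i + c)"
      using up[of "vector [0, 1]"] by (simp add: lat_def mult_vec_2)
    have c: "?c * rad i \<le> av e"
      using up[of "vector [unif powi i, 0]"] by (simp add: lat_def mult_vec_2 av_unif_powi av_mult)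
    have lo: "\<exists>x\<in>lat 0 i. y = D *v x" if "y \<in> (*s) e ` lat 0 (i + c)" for y
      using that unfolding e(2)[symmetric] by blast
    have x: "av (x $ 1) \<le> rad i" "av (x $ 2) \<le> 1" if "x \<in> lat 0 i" for x
      using that by (simp_all add: lat_def)
    have "e *s vector [0, 1] \<in> (*s) e ` lat 0 (i + c)" by (intro imageI) (simp add: lat_def)
    then obtain x where "x \<in> lat 0 i" "e *s vector [0, 1] = D *v x" using lo by blast
    then have "av e = av (D $ 2 $ 1 * x $ 1 + D $ 2 $ 2 * x $ 2)" "x \<in> lat 0 i"
      by (metis mult_vec_2 mult.right_neutral vector_2(2) vector_smult_component, simp)
    then have e1: "av e \<le> max (?c * rad i) ?d"
      using av_ultrametric[of "D $ 2 $ 1 * x $ 1" "D $ 2 $ 2 * x $ 2"] x[of x]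
        mult_left_mono[of "av (x $ 1)" "rad i" ?c] mult_left_mono[of "av (x $ 2)" 1 ?d]
      by (auto simp: av_mult av_nonneg max_def split: if_splits)
    have "e *s vector [unif powi (i + c), 0] \<in> (*s) e ` lat 0 (i + c)"
      by (intro imageI) (simp add: lat_def av_unif_powi)
    then obtain x' where "x' \<in> lat 0 i" "e *s vector [unif powi (i + c), 0] = D *v x'" using lo by blast
    then have "av e * rad (i + c) = av (D $ 1 $ 1 * x' $ 1 + D $ 1 $ 2 * x' $ 2)" "x' \<in> lat 0 i"
      by (metis mult_vec_2 av_mult av_unif_powi vector_2(1) vector_smult_component, simp)
    then have e2: "av e * rad (i + c) \<le> max (?a * rad i) ?b"
      using av_ultrametric[of "D $ 1 $ 1 * x' $ 1" "D $ 1 $ 2 * x' $ 2"] x[of x']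
        mult_left_mono[of "av (x' $ 1)" "rad i" ?a] mult_left_mono[of "av (x' $ 2)" 1 ?b]
      by (auto simp: av_mult av_nonneg max_def split: if_splits)
    have "?b \<le> rad (i + c) * max (?c * rad i) ?d"
      unfolding mult.commute[of "rad (i + c)"] by (rule order_trans[OF b mult_right_mono[OF e1 rad_nonneg]])
    moreover have "?c * rad i * rad (i + c) \<le> max (?a * rad i) ?b"
      by (rule order_trans[OF mult_right_mono[OF c rad_nonneg] e2])
    ultimately show ?thesis by blast
  qed
  show "D $ 1 $ 2 = 0"
  proof (rule ccontr)
    assume "D $ 1 $ 2 \<noteq> 0"
    then have b: "0 < ?b" by (simp add: av_pos_iff)
    \<comment> \<open>The summand 1 keeps \<open>K\<close> positive for the division below.\<close>
    define K where "K = max ?c ?d + 1"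
    have K: "0 < K" using av_nonneg[of "D $ 2 $ 1"] by (simp add: K_def max_def)
    then have "0 < ?b / (rad c * K)" using b by simp
    then obtain n where n: "rad (int n) < ?b / (rad c * K)" using rad_arbitrarily_small by blast
    have "?c * rad (int n) \<le> ?c" by (simp add: av_nonneg mult_left_le)
    then have "max (?c * rad (int n)) ?d \<le> K" by (simp add: K_def max_def split: if_splits)
    then have "rad (int n + c) * max (?c * rad (int n)) ?d \<le> rad (int n + c) * K"
      by (rule mult_left_mono) simp
    with key[of "int n"] have "?b \<le> rad (int n + c) * K" by (blast intro: order_trans)
    then have "?b \<le> rad (int n) * (rad c * K)" by (simp add: rad_add mult.assoc)
    then show False using n K by (simp add: field_simps)
  qed
  show "D $ 2 $ 1 = 0"
  proof (rule ccontr)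
    assume "D $ 2 $ 1 \<noteq> 0"
    then have c: "0 < ?c" by (simp add: av_pos_iff)
    define K where "K = max ?a ?b"
    obtain n where n: "K / (?c * rad c) < rad (- int n)" using rad_arbitrarily_large by blast
    let ?r = "rad (- int n)"
    have r: "1 \<le> ?r" by simp
    have "?b \<le> ?b * ?r" using r av_nonneg mult_left_mono[of 1 ?r ?b] by simp
    moreover have "?a * ?r \<le> K * ?r" "?b * ?r \<le> K * ?r"
      by (rule mult_right_mono; simp add: K_def)+
    ultimately have "max (?a * ?r) ?b \<le> K * ?r" by linarith
    with key[of "- int n"] have "?c * ?r * rad (- int n + c) \<le> K * ?r"
      by (blast intro: order_trans)
    then have "(?c * rad c * ?r) * ?r \<le> K * ?r" unfolding rad_add by (simp only: ac_simps)
    then have "?c * rad c * ?r \<le> K" by (rule mult_right_le_imp_le) simp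
    then show False using n c by (simp add: field_simps)
  qed
qed

text \<open>The orbit-stabiliser statement behind the identification with G/T. If \<open>N\<close>
  and \<open>M\<close> give the same apartment, the inverse of \<open>M\<close> times
  \<open>N\<close> translates the standard line and is therefore diagonal.\<close>

lemma mapt_fibre:
  assumes M: "invertible M"
  shows "{g \<in> carrier PGL2. apartment_act g (std_apartment av) = mapt M} = proj M <#\<^bsub>PGL2\<^esub> torus"
proof (intro equalityI subsetI)
  fix g assume "g \<in> proj M <#\<^bsub>PGL2\<^esub> torus"
  then obtain a d where ad: "a * d \<noteq> 0" "g = proj M \<otimes>\<^bsub>PGL2\<^esub> proj (mat2 a 0 0 d)"
    by (auto simp: l_coset_def torus_eq)
  have D: "invertible (mat2 a 0 0 d)" using ad(1) by (intro invertible_mat2) simp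
  obtain j where "\<And>i. vact (mat2 a 0 0 d) (bvert 0 i) = bvert 0 (i + j)" using vact_diag[OF ad(1)] by blast
  then have "mapt (M ** mat2 a 0 0 d) = mapt M"
    using apt_shift[of "\<lambda>i. vact M (bvert 0 i)" j] by (simp add: mapt_def vact_mult)
  then show "g \<in> {g \<in> carrier PGL2. apartment_act g (std_apartment av) = mapt M}"
    using ad(2) M D by (simp add: proj_mult mapt_eq invertible_mult carrier_PGL2)
next
  fix g assume "g \<in> {g \<in> carrier PGL2. apartment_act g (std_apartment av) = mapt M}"
  then obtain N where N: "invertible N" "g = proj N" "mapt N = mapt M"
    by (auto simp: carrier_PGL2 mapt_eq)
  obtain K where K: "invertible K" "M ** K = mat 1" "K ** M = mat 1" using invertible_cancel[OF M] by metis
  obtain c where c: "\<And>i. vact N (bvert 0 i) = vact M (bvert 0 (i + c))"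
    using apt_eqD[of "\<lambda>i. vact M (bvert 0 i)" "\<lambda>i. vact N (bvert 0 i)"] M N
    by (auto simp: mapt_def line_vact line_std)
  have KN: "invertible (K ** N)" using K N by (intro invertible_mult)
  have "vact (K ** N) (bvert 0 i) = bvert 0 (i + c)" for i
    by (simp add: vact_mult c vact_cancel[OF K(3)])
  from diag_if_translates[OF this] have "proj (K ** N) \<in> torus"
    unfolding torus_def proj_def using KN by auto
  moreover have "g = proj M \<otimes>\<^bsub>PGL2\<^esub> proj (K ** N)"
    using N(2) M KN K(2) by (simp add: proj_mult matrix_mul_assoc)
  ultimately show "g \<in> proj M <#\<^bsub>PGL2\<^esub> torus" by (auto simp: l_coset_def)
qed

section \<open>The topology on oriented apartments\<close>

definition near :: "real \<Rightarrow> 'a^2^2 \<Rightarrow> 'a^2^2 \<Rightarrow> bool" where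
  "near e M N \<longleftrightarrow> (\<forall>i j. av (N $ i $ j - M $ i $ j) < e)"

lemma near_2: "near e M N \<longleftrightarrow> av (N $ 1 $ 1 - M $ 1 $ 1) < e \<and> av (N $ 1 $ 2 - M $ 1 $ 2) < e \<and>
    av (N $ 2 $ 1 - M $ 2 $ 1) < e \<and> av (N $ 2 $ 2 - M $ 2 $ 2) < e"
  by (auto simp: near_def forall_2)

lemma near_mono: "near d M N \<Longrightarrow> d \<le> e \<Longrightarrow> near e M N"
  unfolding near_def by (meson order_less_le_trans)

lemma entries_bounded:
  fixes M :: "'a^2^2"
  obtains c where "0 < c" "\<And>i j. av (M $ i $ j) < c"
proof -
  let ?S = "insert 0 ((\<lambda>(i, j). av (M $ i $ j)) ` UNIV)"
  have "av (M $ i $ j) \<le> Max ?S" for i j by (intro Max_ge) auto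
  moreover have "0 \<le> Max ?S" by (intro Max_ge) auto
  ultimately show thesis by (intro that[of "Max ?S + 1"]) (simp_all add: add.commute add_strict_increasing)
qed

text \<open>Each entry of the difference is a sum of two products, and by the ultrametric inequality
  no factor 2 is lost.\<close>

lemma near_mult_left:
  assumes "0 < e"
  obtains d where "0 < d" "\<And>N N'. near d N N' \<Longrightarrow> near e (M ** N) (M ** N')"
proof -
  obtain c where c: "0 < c" "\<And>i j. av (M $ i $ j) < c" using entries_bounded by blast
  have "near e (M ** N) (M ** N')" if N: "near (e / c) N N'" for N N'
    unfolding near_def
  proof (intro allI)
    fix i j
    have "av (M $ i $ l * (N' $ l $ j - N $ l $ j)) < c * (e / c)" for l
      unfolding av_mult using N c assms av_nonneg by (intro mult_strict_mono) (auto simp: near_def)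
    then have t: "av (M $ i $ l * (N' $ l $ j - N $ l $ j)) < e" for l using c by simp
    have "av (M $ i $ 1 * (N' $ 1 $ j - N $ 1 $ j) + M $ i $ 2 * (N' $ 2 $ j - N $ 2 $ j)) < e"
      by (rule av_add_less[OF t t])
    then show "av ((M ** N') $ i $ j - (M ** N) $ i $ j) < e"
      by (simp add: matrix_mult_2 algebra_simps)
  qed
  then show thesis using assms c by (intro that[of "e / c"]) auto
qed

lemma near_mult_right:
  assumes "0 < e"
  obtains d where "0 < d" "\<And>N N'. near d N N' \<Longrightarrow> near e (N ** M) (N' ** M)"
proof -
  obtain c where c: "0 < c" "\<And>i j. av (M $ i $ j) < c" using entries_bounded by blast
  have "near e (N ** M) (N' ** M)" if N: "near (e / c) N N'" for N N'
    unfolding near_def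
  proof (intro allI)
    fix i j
    have "av ((N' $ i $ l - N $ i $ l) * M $ l $ j) < (e / c) * c" for l
      unfolding av_mult using N c assms av_nonneg by (intro mult_strict_mono) (auto simp: near_def)
    then have t: "av ((N' $ i $ l - N $ i $ l) * M $ l $ j) < e" for l using c by simp
    have "av ((N' $ i $ 1 - N $ i $ 1) * M $ 1 $ j + (N' $ i $ 2 - N $ i $ 2) * M $ 2 $ j) < e"
      by (rule av_add_less[OF t t])
    then show "av ((N' ** M) $ i $ j - (N ** M) $ i $ j) < e"
      by (simp add: matrix_mult_2 algebra_simps)
  qed
  then show thesis using assms c by (intro that[of "e / c"]) auto
qed

section \<open>Unwinding the topology of G/T\<close>

lemma topspace_field_topology [simp]: "topspace (field_topology av) = UNIV"
  unfolding field_topology_def using Metric_space.topspace_mtopology[OF metric_space_av] .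

lemma openin_field_topology:
  "openin (field_topology av) U \<longleftrightarrow> (\<forall>x\<in>U. \<exists>e>0. \<forall>y. av (y - x) < e \<longrightarrow> y \<in> U)"
proof -
  interpret M: Metric_space UNIV "\<lambda>x y. av (x - y)" by (rule metric_space_av)
  show ?thesis
    unfolding field_topology_def M.openin_mtopology subset_eq M.in_mball
    by (simp add: Ball_def) (metis av_minus_commute)
qed

text \<open>Turns the pulled-back product topology into an epsilon criterion; with finitely many
  entries one radius serves for all.\<close>

lemma openin_GL2_topology:
  "openin (GL2_topology av) U \<longleftrightarrow> U \<subseteq> {M. invertible M} \<and>
     (\<forall>M\<in>U. \<exists>e>0. \<forall>N. invertible N \<longrightarrow> near e M N \<longrightarrow> N \<in> U)"
proof -
  define F :: "'a^2^2 \<Rightarrow> 2 \<times> 2 \<Rightarrow> 'a" where "F = (\<lambda>A (i, j). A $ i $ j)"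
  let ?P = "product_topology (\<lambda>_::2\<times>2. field_topology av) UNIV"
  have F: "F M (i, j) = M $ i $ j" for M i j by (simp add: F_def)
  have top: "openin (GL2_topology av) U \<longleftrightarrow> (\<exists>V. openin ?P V \<and> U = F -` V \<inter> {M. invertible M})"
    unfolding GL2_topology_def openin_pullback_topology F_def by simp
  show ?thesis
  proof
    assume "openin (GL2_topology av) U"
    then obtain V where V: "openin ?P V" "U = F -` V \<inter> {M. invertible M}" unfolding top by blast
    have "\<exists>e>0. \<forall>N. invertible N \<longrightarrow> near e M N \<longrightarrow> N \<in> U" if "M \<in> U" for M
    proof -
      have "F M \<in> V" using that V by blast
      then obtain W where W: "\<And>i. openin (field_topology av) (W i)" "F M \<in> Pi\<^sub>E UNIV W" "Pi\<^sub>E UNIV W \<subseteq> V"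
        using V(1) unfolding openin_product_topology_alt by (metis UNIV_I)
      have "\<forall>i. \<exists>e>0. \<forall>y. av (y - F M i) < e \<longrightarrow> y \<in> W i"
      proof
        fix i
        have "F M i \<in> W i" using W(2) by auto
        then show "\<exists>e>0. \<forall>y. av (y - F M i) < e \<longrightarrow> y \<in> W i"
          using W(1)[of i] unfolding openin_field_topology by blast
      qed
      then obtain e where e: "\<And>i. 0 < e i" "\<And>i y. av (y - F M i) < e i \<Longrightarrow> y \<in> W i" by metis
      let ?e = "Min (range e)"
      have "0 < ?e" using e(1) by (subst Min_gr_iff) auto
      moreover have "N \<in> U" if N: "invertible N" "near ?e M N" for N
      proof -
        have "F N i \<in> W i" for i
        proof (rule e(2))
          obtain a b where i: "i = (a, b)" by (cases i)
          have "av (F N i - F M i) < ?e" using N(2) by (simp add: i F near_def)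
          also have "?e \<le> e i" by (intro Min_le) auto
          finally show "av (F N i - F M i) < e i" .
        qed
        then have "F N \<in> V" using W(3) by (auto simp: PiE_UNIV_domain)
        then show ?thesis using N(1) V(2) by blast
      qed
      ultimately show ?thesis by blast
    qed
    then show "U \<subseteq> {M. invertible M} \<and> (\<forall>M\<in>U. \<exists>e>0. \<forall>N. invertible N \<longrightarrow> near e M N \<longrightarrow> N \<in> U)"
      using V(2) by blast
  next
    assume U: "U \<subseteq> {M. invertible M} \<and> (\<forall>M\<in>U. \<exists>e>0. \<forall>N. invertible N \<longrightarrow> near e M N \<longrightarrow> N \<in> U)"
    then obtain e where e: "\<And>M. M \<in> U \<Longrightarrow> 0 < e M"
      "\<And>M N. M \<in> U \<Longrightarrow> invertible N \<Longrightarrow> near (e M) M N \<Longrightarrow> N \<in> U" by metis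
    define B where "B M = Pi\<^sub>E UNIV (\<lambda>i. {y. av (y - F M i) < e M})" for M
    have "openin ?P (B M)" for M
      unfolding B_def
    proof (subst openin_PiE_gen, intro disjI2 conjI ballI)
      fix i :: "2 \<times> 2"
      show "openin (field_topology av) {y. av (y - F M i) < e M}"
        unfolding openin_field_topology
      proof (intro ballI)
        fix x assume x: "x \<in> {y. av (y - F M i) < e M}"
        then have "0 < e M" using av_nonneg[of "x - F M i"] by simp
        moreover have "av (y - F M i) < e M" if "av (y - x) < e M" for y
          using av_add_less[OF that, of "x - F M i"] x by simp
        ultimately show "\<exists>e'>0. \<forall>y. av (y - x) < e' \<longrightarrow> y \<in> {y. av (y - F M i) < e M}" by blast
      qed
    qed simp
    then have "openin ?P (\<Union>M\<in>U. B M)" by blast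
    moreover have "U = F -` (\<Union>M\<in>U. B M) \<inter> {M. invertible M}"
    proof (intro equalityI subsetI)
      fix M assume "M \<in> U"
      moreover from this have "F M \<in> B M" using e(1) by (simp add: B_def PiE_UNIV_domain)
      ultimately show "M \<in> F -` (\<Union>M\<in>U. B M) \<inter> {M. invertible M}" using U by blast
    next
      fix N assume "N \<in> F -` (\<Union>M\<in>U. B M) \<inter> {M. invertible M}"
      then obtain M where M: "M \<in> U" "F N \<in> B M" "invertible N" by blast
      then have "av (F N (i, j) - F M (i, j)) < e M" for i j by (auto simp: B_def PiE_UNIV_domain)
      then have "near (e M) M N" by (simp add: near_def F)
      then show "N \<in> U" using e(2) M by blast
    qed
    ultimately show "openin (GL2_topology av) U" unfolding top by blast
  qed
qed

lemma topspace_GL2_topology: "topspace (GL2_topology av) = {M. invertible M}"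
proof (intro equalityI)
  show "topspace (GL2_topology av) \<subseteq> {M. invertible M}"
    using openin_topspace[of "GL2_topology av"] unfolding openin_GL2_topology by blast
  have "openin (GL2_topology av) {M. invertible M}"
    unfolding openin_GL2_topology by (auto intro: exI[of _ 1])
  then show "{M. invertible M} \<subseteq> topspace (GL2_topology av)" by (rule openin_subset)
qed

lemma PGL2_topology_proj: "PGL2_topology av = quotient_topology (GL2_topology av) proj"
  by (simp add: PGL2_topology_def proj_def[abs_def])

lemma topspace_PGL2_topology: "topspace (PGL2_topology av) = carrier PGL2"
  using quotient_map_quotient_topology[of "GL2_topology av" proj]
  by (simp add: quotient_map_def PGL2_topology_proj topspace_GL2_topology carrier_PGL2)

text \<open>Composing the two quotient maps and the transport along fibres leaves a quotient
  topology for \<open>mapt\<close>; \<open>mapt_fibre\<close> makes the composite well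
  behaved.\<close>

lemma openin_apartment_topology_GL2:
  "openin (apartment_topology av) W \<longleftrightarrow>
     W \<subseteq> oriented_apartments av \<and> openin (GL2_topology av) {M. invertible M \<and> mapt M \<in> W}"
proof -
  define f where "f A = {g \<in> carrier PGL2. apartment_act g (std_apartment av) = A}" for A
  define q where "q g = g <#\<^bsub>PGL2\<^esub> torus" for g :: "('a^2^2) set"
  have f: "f (mapt M) = q (proj M)" if "invertible M" for M
    using that by (simp add: f_def q_def mapt_fibre)
  have GT: "openin (G_mod_T_topology av) U \<longleftrightarrow>
      U \<subseteq> q ` carrier PGL2 \<and> openin (GL2_topology av) {M. invertible M \<and> q (proj M) \<in> U}" for U
  proof -
    have "openin (PGL2_topology av) {g \<in> carrier PGL2. q g \<in> U} \<longleftrightarrow>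
        openin (GL2_topology av) {M. invertible M \<and> proj M \<in> {g \<in> carrier PGL2. q g \<in> U}}"
      unfolding PGL2_topology_proj openin_quotient_topology topspace_GL2_topology carrier_PGL2
      by (simp add: subset_eq)
    also have "{M. invertible M \<and> proj M \<in> {g \<in> carrier PGL2. q g \<in> U}} = {M. invertible M \<and> q (proj M) \<in> U}"
      by (auto simp: carrier_PGL2)
    finally show ?thesis
      by (simp add: G_mod_T_topology_def openin_quotient_topology topspace_PGL2_topology q_def)
  qed
  have top: "openin (apartment_topology av) W \<longleftrightarrow>
      (\<exists>U. openin (G_mod_T_topology av) U \<and> W = f -` U \<inter> oriented_apartments av)"
    unfolding apartment_topology_def openin_pullback_topology f_def ..
  show ?thesis
  proof
    assume "openin (apartment_topology av) W"
    then obtain U where U: "openin (G_mod_T_topology av) U" "W = f -` U \<inter> oriented_apartments av"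
      unfolding top by blast
    have "{M. invertible M \<and> mapt M \<in> W} = {M. invertible M \<and> q (proj M) \<in> U}"
      unfolding U(2) using f mapt_mem by auto
    then show "W \<subseteq> oriented_apartments av \<and> openin (GL2_topology av) {M. invertible M \<and> mapt M \<in> W}"
      using U GT by auto
  next
    assume W: "W \<subseteq> oriented_apartments av \<and> openin (GL2_topology av) {M. invertible M \<and> mapt M \<in> W}"
    \<comment> \<open>By transitivity the fibre over an oriented apartment is nonempty, and any
      member of it determines the apartment.\<close>
    have inj: "A = B" if "A \<in> oriented_apartments av" "f A = f B" for A B
    proof -
      obtain M where M: "invertible M" "A = mapt M" using \<open>A \<in> _\<close> by (auto simp: oriented_apartments_mapt)
      then have "proj M \<in> f A" by (auto simp: f_def mapt_eq carrier_PGL2)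
      then show ?thesis using that(2) by (auto simp: f_def)
    qed
    have "W = f -` (f ` W) \<inter> oriented_apartments av" using W inj by blast
    moreover have "openin (G_mod_T_topology av) (f ` W)"
      unfolding GT
    proof
      show "f ` W \<subseteq> q ` carrier PGL2"
      proof
        fix x assume "x \<in> f ` W"
        then obtain A where A: "A \<in> W" "x = f A" by (rule imageE)
        then have "A \<in> oriented_apartments av" using W by (simp add: subset_eq)
        then obtain M where "invertible M" "x = f (mapt M)"
          unfolding oriented_apartments_mapt using A(2) by (metis imageE mem_Collect_eq)
        then have "x = q (proj M)" "proj M \<in> carrier PGL2" by (simp_all add: f carrier_PGL2)
        then show "x \<in> q ` carrier PGL2" by (rule image_eqI)
      qed
      have "q (proj M) \<in> f ` W \<longleftrightarrow> mapt M \<in> W" if "invertible M" for M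
        unfolding f[OF that, symmetric] using inj[OF mapt_mem[OF that]] by auto
      then have "{M. invertible M \<and> q (proj M) \<in> f ` W} = {M. invertible M \<and> mapt M \<in> W}" by blast
      then show "openin (GL2_topology av) {M. invertible M \<and> q (proj M) \<in> f ` W}" using W by simp
    qed
    ultimately show "openin (apartment_topology av) W" unfolding top by blast
  qed
qed

lemma openin_apartment_topology:
  "openin (apartment_topology av) W \<longleftrightarrow> W \<subseteq> oriented_apartments av \<and>
     (\<forall>M. invertible M \<longrightarrow> mapt M \<in> W \<longrightarrow>
       (\<exists>e>0. \<forall>N. invertible N \<longrightarrow> near e M N \<longrightarrow> mapt N \<in> W))"
  unfolding openin_apartment_topology_GL2 openin_GL2_topology by auto

lemma topspace_apartment_topology: "topspace (apartment_topology av) = oriented_apartments av"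
proof (intro equalityI)
  show "topspace (apartment_topology av) \<subseteq> oriented_apartments av"
    using openin_topspace[of "apartment_topology av"] unfolding openin_apartment_topology by blast
  have "openin (apartment_topology av) (oriented_apartments av)"
    unfolding openin_apartment_topology using mapt_mem by (auto intro: exI[of _ 1])
  then show "oriented_apartments av \<subseteq> topspace (apartment_topology av)" by (rule openin_subset)
qed

lemma openin_translate:
  assumes M: "invertible M" and W: "openin (apartment_topology av) W"
  shows "openin (apartment_topology av) {A \<in> oriented_apartments av. apartment_act (proj M) A \<in> W}"
  unfolding openin_apartment_topology
proof (intro conjI allI impI)
  fix N assume N: "invertible N" "mapt N \<in> {A \<in> oriented_apartments av. apartment_act (proj M) A \<in> W}"
  then have "invertible (M ** N)" "mapt (M ** N) \<in> W" using M by (simp_all add: invertible_mult mapt_mult)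
  then obtain e where e: "0 < e" "\<And>K. invertible K \<Longrightarrow> near e (M ** N) K \<Longrightarrow> mapt K \<in> W"
    using W unfolding openin_apartment_topology by blast
  obtain d where d: "0 < d" "\<And>N N'. near d N N' \<Longrightarrow> near e (M ** N) (M ** N')"
    using near_mult_left[OF e(1)] by blast
  have "mapt K \<in> {A \<in> oriented_apartments av. apartment_act (proj M) A \<in> W}"
    if "invertible K" "near d N K" for K
    using that e(2)[of "M ** K"] d(2) M by (simp add: invertible_mult mapt_mult mapt_mem)
  then show "\<exists>e>0. \<forall>K. invertible K \<longrightarrow> near e N K \<longrightarrow>
      mapt K \<in> {A \<in> oriented_apartments av. apartment_act (proj M) A \<in> W}" using d(1) by blast
qed blast

text \<open>Such a matrix has integral entries and a determinant of absolute value 1, so it and its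
  inverse both preserve \<open>lat 0 0\<close>.\<close>

lemma near_1_stabilizes:
  assumes "near 1 (mat 1) D" shows "vact D (bvert 0 0) = bvert 0 0"
proof -
  let ?a = "D $ 1 $ 1" and ?b = "D $ 1 $ 2" and ?c = "D $ 2 $ 1" and ?d = "D $ 2 $ 2"
  define e where "e = ?a * ?d - ?b * ?c"
  have bc: "av ?b < 1" "av ?c < 1" using assms by (simp_all add: near_2)
  have ad: "av ?a = 1" "av ?d = 1"
    using assms av_add_eq[of "?a - 1" 1] av_add_eq[of "?d - 1" 1] by (simp_all add: near_2)
  have "av ?b * av ?c \<le> av ?b * 1" using bc av_nonneg by (intro mult_left_mono) simp_all
  then have "av (?b * ?c) < 1" using bc by (simp add: av_mult)
  then have e: "av e = 1" using av_add_eq[of "- (?b * ?c)" "?a * ?d"] ad by (simp add: e_def av_mult)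
  then have e0: "e \<noteq> 0" by auto
  have fwd: "A *v x \<in> lat 0 0" if "\<And>i j. av (A $ i $ j) \<le> 1" "x \<in> lat 0 0" for A :: "'a^2^2" and x
    using that by (auto simp: lat_def mult_vec_2 av_mult av_nonneg mult_le_one intro!: av_add_le)
  have D: "av (D $ i $ j) \<le> 1" for i j
    using bc ad exhaust_2[of i] exhaust_2[of j] by auto
  let ?E = "mat2 (?d / e) (- ?b / e) (- ?c / e) (?a / e)"
  have E: "av (?E $ i $ j) \<le> 1" for i j
    using bc ad e exhaust_2[of i] exhaust_2[of j] by (auto simp: av_divide)
  have "D ** ?E = mat 1"
  proof (rule mat2_eqI)
    have "?a * ?d = e + ?b * ?c" by (simp add: e_def)
    then show "(D ** ?E) $ 1 $ 1 = (mat 1 :: 'a^2^2) $ 1 $ 1" "(D ** ?E) $ 2 $ 2 = (mat 1 :: 'a^2^2) $ 2 $ 2"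
      using e0 by (simp_all add: matrix_mult_2 field_simps)
  qed (simp_all add: matrix_mult_2 mult.commute)
  then have "x = D *v (?E *v x)" for x by (simp add: matrix_vector_mul_assoc)
  then have "(*v) D ` lat 0 0 = lat 0 0"
    using fwd[OF D] fwd[OF E] by (intro equalityI subsetI image_eqI) blast+
  then show ?thesis by (simp add: bvert_def vact_homothety_class)
qed

text \<open>Vertex stabilisers are open: with \<open>s\<close> the image of the unit ball under
  \<open>B\<close>, the quotient of \<open>N ** B\<close> by \<open>M ** B\<close> is close to 1
  when \<open>N\<close> is close to \<open>M\<close>.\<close>

lemma vact_locally_constant:
  assumes M: "invertible M" and s: "s \<in> vertices av"
  obtains e where "0 < e" "\<And>N. near e M N \<Longrightarrow> vact N s = vact M s"
proof -
  obtain B where B: "invertible B" "s = vact B (bvert 0 0)" using s by (rule vertex_transitive)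
  obtain K where K: "invertible K" "(M ** B) ** K = mat 1" "K ** (M ** B) = mat 1"
    using invertible_cancel[OF invertible_mult[OF M B(1)]] by metis
  obtain d where d: "0 < d" "\<And>N N'. near d N N' \<Longrightarrow> near 1 (K ** N) (K ** N')"
    using near_mult_left[of 1] by (metis zero_less_one)
  obtain e where e: "0 < e" "\<And>N N'. near e N N' \<Longrightarrow> near d (N ** B) (N' ** B)"
    using near_mult_right[OF d(1)] by blast
  have "vact N s = vact M s" if "near e M N" for N
  proof -
    have "near 1 (mat 1) (K ** (N ** B))" using d(2)[OF e(2)[OF that]] K(3) by simp
    from near_1_stabilizes[OF this] have "vact K (vact N s) = bvert 0 0" by (simp add: vact_mult B(2))
    then have "vact (M ** B) (vact K (vact N s)) = vact M s" by (simp add: vact_mult B(2))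
    then show ?thesis using vact_cancel[OF K(2)] by simp
  qed
  then show thesis using e(1) that by blast
qed

text \<open>The cylinder sets of the apartment space. They are open, those of paths are also closed
  and compact, and the segments of a line give a neighbourhood base at its apartment.\<close>

definition cyl :: "'a vertex list \<Rightarrow> 'a oriented_apartment set" where
  "cyl p = {apt \<gamma> | \<gamma>. line \<gamma> \<and> (\<exists>i. p = seg \<gamma> i (length p))}"

lemma cyl_subset: "cyl p \<subseteq> oriented_apartments av"
  by (auto simp: cyl_def apt_mem)

lemma cyl_iff:
  assumes \<gamma>: "line \<gamma>" and p: "length p = Suc k"
  shows "apt \<gamma> \<in> cyl p \<longleftrightarrow> (\<exists>i. p = seg \<gamma> i (Suc k))"
proof
  assume "apt \<gamma> \<in> cyl p"
  then obtain \<delta> i where \<delta>: "line \<delta>" "apt \<gamma> = apt \<delta>" "p = seg \<delta> i (Suc k)" by (auto simp: cyl_def p)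
  then have "p \<in> apartment_paths av k (apt \<gamma>)" by (simp add: apt_paths)
  then show "\<exists>i. p = seg \<gamma> i (Suc k)" by (auto simp: apt_paths[OF \<gamma>])
qed (use \<gamma> p in \<open>auto simp: cyl_def\<close>)

lemma cyl_seg: "line \<gamma> \<Longrightarrow> apt \<gamma> \<in> cyl (seg \<gamma> i n)"
  by (auto simp: cyl_def)

text \<open>Only finitely many vertices matter, and each has a locally constant image under matrices
  near \<open>M\<close>.\<close>

lemma openin_cyl: "openin (apartment_topology av) (cyl p)"
  unfolding openin_apartment_topology
proof (intro conjI allI impI cyl_subset)
  fix M assume M: "invertible M" "mapt M \<in> cyl p"
  show "\<exists>e>0. \<forall>N. invertible N \<longrightarrow> near e M N \<longrightarrow> mapt N \<in> cyl p"
  proof (cases p)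
    case Nil
    then have "mapt N \<in> cyl p" if "invertible N" for N
      using that line_vact[OF that line_std] by (auto simp: cyl_def mapt_def seg_def)
    then show ?thesis by (intro exI[of _ 1]) simp
  next
    case (Cons a p')
    then have lp: "length p = Suc (length p')" by simp
    obtain i where i: "p = seg (\<lambda>i. vact M (bvert 0 i)) i (Suc (length p'))"
      using M cyl_iff[OF line_vact[OF M(1) line_std] lp] by (auto simp: mapt_def)
    have "\<forall>j. \<exists>e>0. \<forall>N. near e M N \<longrightarrow> vact N (bvert 0 j) = vact M (bvert 0 j)"
      using vact_locally_constant[OF M(1) bvert_vertex] by metis
    then obtain e where e: "\<And>j. 0 < e j" "\<And>j N. near (e j) M N \<Longrightarrow> vact N (bvert 0 j) = vact M (bvert 0 j)"
      by metis
    let ?J = "{i..i + int (Suc (length p'))}"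
    let ?e = "Min (e ` ?J)"
    have "0 < ?e" using e(1) by (subst Min_gr_iff) auto
    moreover have "mapt N \<in> cyl p" if N: "invertible N" "near ?e M N" for N
    proof -
      have "vact N (bvert 0 j) = vact M (bvert 0 j)" if "j \<in> ?J" for j
        using that by (intro e(2) near_mono[OF N(2)] Min_le) auto
      then have "p = seg (\<lambda>i. vact N (bvert 0 i)) i (Suc (length p'))"
        unfolding i by (intro seg_cong) simp
      then show ?thesis using cyl_iff[OF line_vact[OF N(1) line_std] lp] by (auto simp: mapt_def)
    qed
    ultimately show ?thesis by blast
  qed
qed

text \<open>An apartment sharing a window of radius \<open>n\<close> with \<open>mapt M\<close> is
  \<open>mapt (M ** mat2 1 y z 1)\<close> with \<open>y\<close> and \<open>z\<close> of size at most
  \<open>rad (int n)\<close>, hence comes from a matrix near \<open>M\<close>.\<close>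

lemma cyl_base:
  assumes \<gamma>: "line \<gamma>" and W: "openin (apartment_topology av) W" "apt \<gamma> \<in> W"
  obtains n where "cyl (seg \<gamma> (- int n) (Suc (2 * n))) \<subseteq> W"
proof -
  obtain M where M: "invertible M" "\<gamma> = (\<lambda>i. vact M (bvert 0 i))"
    using line_transitive[OF \<gamma>] by (metis ext)
  obtain K where K: "invertible K" "M ** K = mat 1" "K ** M = mat 1" using invertible_cancel[OF M(1)] by metis
  have "mapt M \<in> W" using W(2) M(2) by (simp add: mapt_def)
  then obtain e where e: "0 < e" "\<And>N. invertible N \<Longrightarrow> near e M N \<Longrightarrow> mapt N \<in> W"
    using W(1) M(1) unfolding openin_apartment_topology by blast
  obtain d where d: "0 < d" "\<And>N N'. near d N N' \<Longrightarrow> near e (M ** N) (M ** N')"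
    using near_mult_left[OF e(1)] by blast
  \<comment> \<open>The bound \<open>d\<close> gives closeness; the bound 1 makes \<open>n\<close>
    positive and \<open>mat2 1 y z 1\<close> invertible.\<close>
  obtain n where n: "rad (int n) < min d 1" using rad_arbitrarily_small[of "min d 1"] d(1) by auto
  then have n0: "0 < n" by (cases n) auto
  have "cyl (seg \<gamma> (- int n) (Suc (2 * n))) \<subseteq> W"
  proof
    fix A assume "A \<in> cyl (seg \<gamma> (- int n) (Suc (2 * n)))"
    then obtain \<eta>' i where \<eta>': "line \<eta>'" "A = apt \<eta>'" "seg \<gamma> (- int n) (Suc (2 * n)) = seg \<eta>' i (Suc (2 * n))"
      by (auto simp: cyl_def)
    define \<eta> where "\<eta> = (\<lambda>j. \<eta>' (j + (i + int n)))"
    have \<eta>: "line \<eta>" "A = apt \<eta>" "seg \<gamma> (- int n) (Suc (2 * n)) = seg \<eta> (- int n) (Suc (2 * n))"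
      using \<eta>' by (simp_all add: \<eta>_def line_shift apt_shift seg_shift)
    have std: "vact K (\<eta> j) = bvert 0 j" if "- int n \<le> j" "j \<le> int n" for j
    proof -
      have "\<eta> j = vact M (bvert 0 j)" using seg_eqD[OF \<eta>(3), of j] that by (simp add: M(2))
      then show ?thesis by (simp add: vact_cancel[OF K(3)])
    qed
    obtain y z where yz: "av y \<le> rad (int n)" "av z \<le> rad (int n)"
      "\<And>i. vact K (\<eta> i) = vact (mat2 1 y z 1) (bvert 0 i)"
      using line_near_std[OF line_vact[OF K(1) \<eta>(1)] std n0] by blast
    let ?h = "mat2 1 y z 1"
    have "\<eta> i = vact (M ** ?h) (bvert 0 i)" for i
      using arg_cong[OF yz(3)[of i], of "vact M"] vact_cancel[OF K(2)] by (simp add: vact_mult)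
    then have "\<eta> = (\<lambda>i. vact (M ** ?h) (bvert 0 i))" by (rule ext)
    then have A: "A = mapt (M ** ?h)" using \<eta>(2) by (simp add: mapt_def)
    have "av y * av z \<le> av y * 1" using yz n av_nonneg by (intro mult_left_mono) simp_all
    then have "av (y * z) < 1" using yz n by (simp add: av_mult)
    then have "1 * 1 - y * z \<noteq> 0" by (metis av_1 eq_iff_diff_eq_0 less_irrefl mult_1)
    then have inv: "invertible (M ** ?h)" using M(1) by (intro invertible_mult invertible_mat2)
    have "near d (mat 1) ?h" using yz n d(1) by (simp add: near_2)
    from d(2)[OF this] have "near e M (M ** ?h)" by simp
    then show "A \<in> W" using e(2)[OF inv] A by simp
  qed
  then show thesis by (rule that)
qed

text \<open>Positions of one vertex on two lines through a common origin agree up to sign; reversing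
  lines reduces this to nonnegative positions.\<close>

lemma line_dist_unique:
  assumes "line \<gamma>" "line \<delta>" "\<gamma> 0 = \<delta> 0" "\<gamma> i = \<delta> j"
  shows "\<bar>i\<bar> = \<bar>j\<bar>"
proof -
  define \<gamma>' where "\<gamma>' = (if 0 \<le> i then \<gamma> else (\<lambda>l. \<gamma> (- l)))"
  define \<delta>' where "\<delta>' = (if 0 \<le> j then \<delta> else (\<lambda>l. \<delta> (- l)))"
  have "line \<gamma>'" "line \<delta>'" using assms by (simp_all add: \<gamma>'_def \<delta>'_def line_uminus)
  moreover have "\<gamma>' 0 = \<delta>' 0" "\<gamma>' (int (nat \<bar>i\<bar>)) = \<delta>' (int (nat \<bar>j\<bar>))"
    using assms by (simp_all add: \<gamma>'_def \<delta>'_def)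
  ultimately have "nat \<bar>i\<bar> = nat \<bar>j\<bar>" by (blast dest: line_segment_unique)
  then show ?thesis by simp
qed

lemma cyl_seg_mono:
  assumes "i \<le> j" "j + int m \<le> i + int n"
  shows "cyl (seg \<gamma> i n) \<subseteq> cyl (seg \<gamma> j m)"
proof
  fix A assume "A \<in> cyl (seg \<gamma> i n)"
  then obtain \<delta> l where \<delta>: "line \<delta>" "A = apt \<delta>" "seg \<gamma> i n = seg \<delta> l n" by (auto simp: cyl_def)
  have "seg \<gamma> i n = seg (\<lambda>s. \<delta> (s + (l - i))) i n" using \<delta>(3) by (simp add: seg_shift)
  then have "seg \<gamma> j m = seg (\<lambda>s. \<delta> (s + (l - i))) j m"
    using assms seg_eqD by (intro seg_cong) fastforce
  then have "seg \<gamma> j m = seg \<delta> (j + (l - i)) m" by (simp add: seg_shift)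
  then show "A \<in> cyl (seg \<gamma> j m)" using \<delta>(1,2) by (auto simp: cyl_def)
qed

text \<open>Suppose every window around \<open>\<gamma> 0\<close> continues to an apartment through
  \<open>p\<close>. The position of \<open>p\<close> relative to \<open>\<gamma> 0\<close> is then
  fixed up to sign, so a large enough window already contains \<open>p\<close>.\<close>

lemma closedin_cyl:
  assumes p: "p \<in> paths av k"
  shows "closedin (apartment_topology av) (cyl p)"
proof -
  have lp: "length p = Suc k" using p by (simp add: paths_def)
  have "openin (apartment_topology av) (oriented_apartments av - cyl p)"
  proof (subst openin_subopen, intro ballI)
    fix A assume "A \<in> oriented_apartments av - cyl p"
    then obtain \<gamma> where \<gamma>: "line \<gamma>" "A = apt \<gamma>" "apt \<gamma> \<notin> cyl p" by (auto simp: oriented_apartments_eq)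
    let ?C = "\<lambda>n. cyl (seg \<gamma> (- int n) (Suc (2 * n)))"
    have meet: "\<exists>\<eta> l. line \<eta> \<and> seg \<gamma> (- int n) (Suc (2 * n)) = seg \<eta> (- int n) (Suc (2 * n)) \<and>
        p = seg \<eta> l (Suc k)" if meets: "?C n \<inter> cyl p \<noteq> {}" for n
    proof -
      obtain B where B: "B \<in> ?C n" "B \<in> cyl p" using meets by blast
      then obtain \<eta> i where \<eta>: "line \<eta>" "B = apt \<eta>"
        "seg \<gamma> (- int n) (Suc (2 * n)) = seg \<eta> i (Suc (2 * n))" by (auto simp: cyl_def)
      have l': "line (\<lambda>j. \<eta> (j + (i + int n)))" using \<eta>(1) by (rule line_shift)
      have "B = apt (\<lambda>j. \<eta> (j + (i + int n)))" using \<eta>(2) by (simp add: apt_shift)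
      then obtain l where "p = seg (\<lambda>j. \<eta> (j + (i + int n))) l (Suc k)"
        using B(2) cyl_iff[OF l' lp] by auto
      then show ?thesis using l' \<eta>(3)
        by (intro exI[of _ "\<lambda>j. \<eta> (j + (i + int n))"] exI[of _ l]) (simp add: seg_shift)
    qed
    have "\<exists>n. ?C n \<inter> cyl p = {}"
    proof (rule ccontr)
      assume "\<not> ?thesis"
      then have ne: "?C n \<inter> cyl p \<noteq> {}" for n by blast
      obtain \<eta> l where \<eta>: "line \<eta>" "seg \<gamma> (- int 0) (Suc (2 * 0)) = seg \<eta> (- int 0) (Suc (2 * 0))"
        "p = seg \<eta> l (Suc k)" using meet[OF ne[of 0]] by blast
      \<comment> \<open>A window of this radius contains the k-path at position \<open>l'\<close>
        whenever \<open>l'\<close> equals \<open>l\<close> up to sign.\<close>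
      define n where "n = nat \<bar>l\<bar> + k"
      obtain \<eta>' l' where \<eta>': "line \<eta>'" "seg \<gamma> (- int n) (Suc (2 * n)) = seg \<eta>' (- int n) (Suc (2 * n))"
        "p = seg \<eta>' l' (Suc k)" using meet[OF ne[of n]] by blast
      have "\<eta> 0 = \<eta>' 0" using seg_eqD[OF \<eta>(2), of 0] seg_eqD[OF \<eta>'(2), of 0] by simp
      moreover have "\<eta> l = \<eta>' l'" using seg_eqD[of \<eta> l "Suc k"] \<eta>(3) \<eta>'(3)
        by (metis list.sel(1) seg_Suc)
      ultimately have ll: "\<bar>l\<bar> = \<bar>l'\<bar>" using \<eta>(1) \<eta>'(1) line_dist_unique by blast
      have "seg \<eta>' l' (Suc k) = seg \<gamma> l' (Suc k)"
        using ll seg_eqD[OF \<eta>'(2)] by (intro seg_cong) (force simp: n_def)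
      then have "apt \<gamma> \<in> cyl p" using cyl_seg[OF \<gamma>(1)] \<eta>'(3) by metis
      then show False using \<gamma>(3) by blast
    qed
    then obtain n where n: "?C n \<inter> cyl p = {}" by blast
    show "\<exists>T. openin (apartment_topology av) T \<and> A \<in> T \<and> T \<subseteq> oriented_apartments av - cyl p"
      using n openin_cyl cyl_subset cyl_seg[OF \<gamma>(1)] \<gamma>(2) by (intro exI[of _ "?C n"]) blast
  qed
  then show ?thesis by (simp add: closedin_def topspace_apartment_topology cyl_subset)
qed

text \<open>Koenig's lemma: if \<open>P p\<close> failed, repeated extension at both ends would produce a line
  contradicting \<open>lim\<close>.\<close>

lemma path_extension_induct:
  assumes p: "p \<in> paths av m"
    and step: "\<And>k q. q \<in> paths av k \<Longrightarrow>
      (\<And>r. r \<in> paths av (Suc (Suc k)) \<Longrightarrow> butlast (tl r) = q \<Longrightarrow> P r) \<Longrightarrow> P q"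
    and lim: "\<And>\<gamma>. line \<gamma> \<Longrightarrow> p = seg \<gamma> 0 (Suc m) \<Longrightarrow> \<exists>n. P (seg \<gamma> (- int n) (Suc (m + 2 * n)))"
  shows "P p"
proof (rule ccontr)
  assume notP: "\<not> P p"
  define S where "S \<gamma> n = seg \<gamma> (- int n) (Suc (m + 2 * n))" for \<gamma> n
  obtain \<gamma>0 where \<gamma>0: "line \<gamma>0" "p = S \<gamma>0 0" using path_eq_seg[OF p] by (auto simp: S_def)
  have ext: "\<exists>\<delta>. (line \<delta> \<and> \<not> P (S \<delta> (Suc n))) \<and> S \<delta> n = S \<gamma> n"
    if \<gamma>: "line \<gamma>" "\<not> P (S \<gamma> n)" for \<gamma> n
  proof -
    obtain r where r: "r \<in> paths av (Suc (Suc (m + 2 * n)))" "butlast (tl r) = S \<gamma> n" "\<not> P r"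
      using step[OF seg_path[OF \<gamma>(1)]] \<gamma>(2) unfolding S_def by blast
    obtain \<delta> where \<delta>: "line \<delta>" "r = seg \<delta> (- int (Suc n)) (Suc (Suc (Suc (m + 2 * n))))"
      using path_eq_seg_at[OF r(1)] by blast
    have "r = S \<delta> (Suc n)" using \<delta>(2) by (simp add: S_def)
    moreover have "butlast (tl r) = S \<delta> n"
      unfolding \<delta>(2) tl_seg butlast_seg S_def by simp
    ultimately show ?thesis using \<delta>(1) r by auto
  qed
  have "\<exists>g. \<forall>n. ((line (g n) \<and> \<not> P (S (g n) n)) \<and> (n = 0 \<longrightarrow> g n = \<gamma>0)) \<and> S (g (Suc n)) n = S (g n) n"
  proof (rule dependent_nat_choice)
    show "\<exists>\<gamma>. (line \<gamma> \<and> \<not> P (S \<gamma> 0)) \<and> (0 = 0 \<longrightarrow> \<gamma> = \<gamma>0)" using \<gamma>0 notP by auto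
  next
    fix \<gamma> and n :: nat
    assume "(line \<gamma> \<and> \<not> P (S \<gamma> n)) \<and> (n = 0 \<longrightarrow> \<gamma> = \<gamma>0)"
    then show "\<exists>\<delta>. ((line \<delta> \<and> \<not> P (S \<delta> (Suc n))) \<and> (Suc n = 0 \<longrightarrow> \<delta> = \<gamma>0)) \<and> S \<delta> n = S \<gamma> n"
      using ext[of \<gamma> n] by blast
  qed
  then obtain g where g: "\<And>n. line (g n)" "\<And>n. \<not> P (S (g n) n)" "g 0 = \<gamma>0"
    "\<And>n. S (g (Suc n)) n = S (g n) n" by blast
  \<comment> \<open>Stage \<open>N\<close> settles the positions from \<open>- int N\<close> to
    \<open>int (m + N)\<close>; later stages only change the line outside.\<close>
  have agree: "g n i = g N i" if "N \<le> n" "- int N \<le> i" "i \<le> int (m + N)" for n N i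
    using that(1)
  proof (induction n rule: dec_induct)
    case (step n)
    have "g (Suc n) i = g n i"
      using seg_eqD[OF g(4)[of n, unfolded S_def], of i] step.hyps that(2,3) by simp
    then show ?case using step.IH by simp
  qed simp
  \<comment> \<open>The diagonal line: position \<open>i\<close> is settled from stage
    \<open>nat \<bar>i\<bar>\<close> on.\<close>
  define \<gamma> where "\<gamma> i = g (nat \<bar>i\<bar>) i" for i
  have \<gamma>g: "\<gamma> i = g n i" if "- int n \<le> i" "i \<le> int (m + n)" for i n
  proof -
    have "g (max n (nat \<bar>i\<bar>)) i = g n i" using that by (intro agree) auto
    moreover have "g (max n (nat \<bar>i\<bar>)) i = g (nat \<bar>i\<bar>) i" by (intro agree) auto
    ultimately show ?thesis by (simp add: \<gamma>_def)
  qed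
  have "line \<gamma>"
    unfolding line_def
  proof
    fix i :: int
    let ?n = "nat \<bar>i\<bar> + 2"
    have "\<gamma> i = g ?n i" "\<gamma> (i + 1) = g ?n (i + 1)" "\<gamma> (i + 2) = g ?n (i + 2)"
      by (intro \<gamma>g; simp)+
    then show "adjacent av (\<gamma> i) (\<gamma> (i + 1)) \<and> \<gamma> i \<noteq> \<gamma> (i + 2)"
      using g(1)[of ?n] by (simp add: line_def)
  qed
  moreover have S\<gamma>: "S \<gamma> n = S (g n) n" for n
    unfolding S_def by (intro seg_cong \<gamma>g) auto
  moreover have "p = seg \<gamma> 0 (Suc m)" using S\<gamma>[of 0] \<gamma>0(2) g(3) by (simp add: S_def)
  ultimately show False using lim[of \<gamma>] g(2) unfolding S_def[symmetric] by auto
qed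

lemma finite_path_extensions: "finite {r \<in> paths av (Suc (Suc k)). butlast (tl r) = q}"
proof -
  have "{r \<in> paths av (Suc (Suc k)). butlast (tl r) = q} \<subseteq>
      {r \<in> paths av (Suc (Suc k)). tl r \<in> {a \<in> paths av (Suc k). butlast a \<in> {q}}}"
    using path_tl by blast
  then show ?thesis
    by (rule finite_subset) (intro finite_tl_preimage finite_butlast_preimage finite.intros)
qed

text \<open>The two-sided extensions of \<open>q\<close> split \<open>cyl q\<close> into disjoint
  pieces: an oriented apartment through \<open>q\<close> passes it once, so the extension must start
  one position earlier.\<close>

lemma cyl_extension_unique:
  assumes q: "q \<in> paths av k" and A: "A \<in> cyl q"
  shows "\<exists>!r. r \<in> paths av (Suc (Suc k)) \<and> butlast (tl r) = q \<and> A \<in> cyl r"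
proof -
  have lq: "length q = Suc k" using q by (simp add: paths_def)
  obtain \<gamma> i where \<gamma>: "line \<gamma>" "A = apt \<gamma>" "q = seg \<gamma> i (Suc k)"
    using A by (auto simp: cyl_def lq)
  show ?thesis
  proof (rule ex1I)
    have "butlast (tl (seg \<gamma> (i - 1) (Suc (Suc (Suc k))))) = q"
      unfolding tl_seg butlast_seg \<gamma>(3) by simp
    then show "seg \<gamma> (i - 1) (Suc (Suc (Suc k))) \<in> paths av (Suc (Suc k)) \<and>
        butlast (tl (seg \<gamma> (i - 1) (Suc (Suc (Suc k))))) = q \<and> A \<in> cyl (seg \<gamma> (i - 1) (Suc (Suc (Suc k))))"
      using seg_path[OF \<gamma>(1)] cyl_seg[OF \<gamma>(1)] \<gamma>(2) by blast
  next
    fix r assume r: "r \<in> paths av (Suc (Suc k)) \<and> butlast (tl r) = q \<and> A \<in> cyl r"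
    then have "length r = Suc (Suc (Suc k))" by (simp add: paths_def)
    then obtain j where j: "r = seg \<gamma> j (Suc (Suc (Suc k)))"
      using r \<gamma>(2) cyl_iff[OF \<gamma>(1)] by blast
    have "seg \<gamma> (j + 1) (Suc k) = seg \<gamma> i (Suc k)"
      using r \<gamma>(3) unfolding j tl_seg butlast_seg by simp
    then have "j + 1 = i" using seg_inject[OF \<gamma>(1)] by blast
    then show "r = seg \<gamma> (i - 1) (Suc (Suc (Suc k)))" using j by auto
  qed
qed

lemma cyl_extension_subset:
  assumes "r \<in> paths av (Suc (Suc k))"
  shows "cyl r \<subseteq> cyl (butlast (tl r))"
proof -
  obtain \<gamma> where \<gamma>: "line \<gamma>" "r = seg \<gamma> 0 (Suc (Suc (Suc k)))" using assms by (rule path_eq_seg)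
  show ?thesis unfolding \<gamma>(2) tl_seg butlast_seg by (rule cyl_seg_mono) auto
qed

lemma cyl_seg_base:
  assumes "line \<gamma>" "openin (apartment_topology av) W" "apt \<gamma> \<in> W"
  obtains n where "cyl (seg \<gamma> (- int n) (Suc (m + 2 * n))) \<subseteq> W"
proof -
  obtain n where "cyl (seg \<gamma> (- int n) (Suc (2 * n))) \<subseteq> W" using cyl_base[OF assms] by blast
  moreover have "cyl (seg \<gamma> (- int n) (Suc (m + 2 * n))) \<subseteq> cyl (seg \<gamma> (- int n) (Suc (2 * n)))"
    by (rule cyl_seg_mono) auto
  ultimately show thesis by (intro that[of n]) blast
qed

text \<open>Having a finite subcover passes from the finitely many extensions to the path itself,
  and along any line it holds eventually because one member of the cover contains a whole
  cylinder.\<close>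

lemma compactin_cyl:
  assumes p: "p \<in> paths av m"
  shows "compactin (apartment_topology av) (cyl p)"
  unfolding compactin_def
proof (intro conjI allI impI)
  show "cyl p \<subseteq> topspace (apartment_topology av)" by (simp add: topspace_apartment_topology cyl_subset)
next
  fix \<U> assume \<U>: "Ball \<U> (openin (apartment_topology av)) \<and> cyl p \<subseteq> \<Union> \<U>"
  show "\<exists>\<F>. finite \<F> \<and> \<F> \<subseteq> \<U> \<and> cyl p \<subseteq> \<Union> \<F>"
  proof (rule path_extension_induct[OF p])
    fix k q assume q: "q \<in> paths av k"
      and IH: "\<And>r. r \<in> paths av (Suc (Suc k)) \<Longrightarrow> butlast (tl r) = q \<Longrightarrow>
        \<exists>\<F>. finite \<F> \<and> \<F> \<subseteq> \<U> \<and> cyl r \<subseteq> \<Union> \<F>"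
    let ?E = "{r \<in> paths av (Suc (Suc k)). butlast (tl r) = q}"
    have "\<forall>r\<in>?E. \<exists>\<F>. finite \<F> \<and> \<F> \<subseteq> \<U> \<and> cyl r \<subseteq> \<Union> \<F>" using IH by blast
    from bchoice[OF this] obtain F
      where F: "\<forall>r\<in>?E. finite (F r) \<and> F r \<subseteq> \<U> \<and> cyl r \<subseteq> \<Union> (F r)" by blast
    have "cyl q \<subseteq> (\<Union>r\<in>?E. cyl r)" using cyl_extension_unique[OF q] by blast
    then have "cyl q \<subseteq> \<Union> (\<Union>r\<in>?E. F r)" using F by blast
    moreover have "finite (\<Union>r\<in>?E. F r)" using F finite_path_extensions by blast
    moreover have "(\<Union>r\<in>?E. F r) \<subseteq> \<U>" using F by blast
    ultimately show "\<exists>\<F>. finite \<F> \<and> \<F> \<subseteq> \<U> \<and> cyl q \<subseteq> \<Union> \<F>" by blast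
  next
    fix \<gamma> assume \<gamma>: "line \<gamma>" "p = seg \<gamma> 0 (Suc m)"
    have "apt \<gamma> \<in> cyl p" unfolding \<gamma>(2) by (rule cyl_seg[OF \<gamma>(1)])
    then obtain U where U: "U \<in> \<U>" "apt \<gamma> \<in> U" using \<U> by blast
    obtain n where "cyl (seg \<gamma> (- int n) (Suc (m + 2 * n))) \<subseteq> U"
      using cyl_seg_base[OF \<gamma>(1) _ U(2)] U(1) \<U> by blast
    then show "\<exists>n. \<exists>\<F>. finite \<F> \<and> \<F> \<subseteq> \<U> \<and> cyl (seg \<gamma> (- int n) (Suc (m + 2 * n))) \<subseteq> \<Union> \<F>"
      using U(1) by (intro exI[of _ n] exI[of _ "{U}"]) simp
  qed
qed

section \<open>Locally constant functions with compact support\<close>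

definition loc_const :: "('a oriented_apartment \<Rightarrow> complex) \<Rightarrow> bool" where
  "loc_const f \<longleftrightarrow> (\<forall>A\<in>oriented_apartments av.
     \<exists>U. openin (apartment_topology av) U \<and> A \<in> U \<and> (\<forall>B\<in>U. f B = f A))"

text \<open>A locally constant function has closed support set, which removes the closure operator
  from the definition of \<open>apartment_funs\<close>.\<close>

lemma closedin_support:
  assumes "{A. f A \<noteq> 0} \<subseteq> oriented_apartments av" "loc_const f"
  shows "closedin (apartment_topology av) {A. f A \<noteq> 0}"
proof -
  have "openin (apartment_topology av) (oriented_apartments av - {A. f A \<noteq> 0})"
  proof (subst openin_subopen, intro ballI)
    fix A assume A: "A \<in> oriented_apartments av - {A. f A \<noteq> 0}"
    then obtain U where U: "openin (apartment_topology av) U" "A \<in> U" "\<forall>B\<in>U. f B = f A"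
      using assms(2) unfolding loc_const_def by blast
    have "U \<subseteq> oriented_apartments av" using openin_subset[OF U(1)] by (simp add: topspace_apartment_topology)
    moreover have "f B = 0" if "B \<in> U" for B using U(3) that A by simp
    ultimately show "\<exists>T. openin (apartment_topology av) T \<and> A \<in> T \<and> T \<subseteq> oriented_apartments av - {A. f A \<noteq> 0}"
      using U(1,2) by blast
  qed
  then show ?thesis using assms(1) by (simp add: closedin_def topspace_apartment_topology)
qed

lemma apartment_funs_iff:
  "f \<in> apartment_funs av \<longleftrightarrow> {A. f A \<noteq> 0} \<subseteq> oriented_apartments av \<and> loc_const f \<and>
     compactin (apartment_topology av) {A. f A \<noteq> 0}"
proof -
  have "apartment_topology av closure_of {A. f A \<noteq> 0} = {A. f A \<noteq> 0}"
    if "{A. f A \<noteq> 0} \<subseteq> oriented_apartments av" "loc_const f"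
    by (rule closure_of_closedin[OF closedin_support[OF that]])
  moreover have "f \<in> apartment_funs av \<longleftrightarrow> {A. f A \<noteq> 0} \<subseteq> oriented_apartments av \<and> loc_const f \<and>
      compactin (apartment_topology av) (apartment_topology av closure_of {A. f A \<noteq> 0})"
    unfolding apartment_funs_def loc_const_def by blast
  ultimately show ?thesis by argo
qed

lemma loc_constE:
  assumes "loc_const f" "A \<in> oriented_apartments av"
  obtains U where "openin (apartment_topology av) U" "A \<in> U" "\<And>B. B \<in> U \<Longrightarrow> f B = f A"
  using bspec[OF assms(1)[unfolded loc_const_def] assms(2)] by (elim exE conjE) (rule that, assumption, assumption, erule (1) bspec)

lemma loc_constI:
  assumes "\<And>A. A \<in> oriented_apartments av \<Longrightarrow>
    \<exists>U. openin (apartment_topology av) U \<and> A \<in> U \<and> (\<forall>B\<in>U. f B = f A)"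
  shows "loc_const f"
  unfolding loc_const_def by (intro ballI assms)

lemma loc_const_add:
  assumes f: "loc_const f" and h: "loc_const h"
  shows "loc_const (\<lambda>A. f A + h A)"
proof (rule loc_constI)
  fix A assume A: "A \<in> oriented_apartments av"
  obtain U where U: "openin (apartment_topology av) U" "A \<in> U" "\<And>B. B \<in> U \<Longrightarrow> f B = f A"
    using loc_constE[OF f A] by blast
  obtain V where V: "openin (apartment_topology av) V" "A \<in> V" "\<And>B. B \<in> V \<Longrightarrow> h B = h A"
    using loc_constE[OF h A] by blast
  have "f B + h B = f A + h A" if "B \<in> U \<inter> V" for B
    using that U(3)[of B] V(3)[of B] by simp
  then show "\<exists>U. openin (apartment_topology av) U \<and> A \<in> U \<and> (\<forall>B\<in>U. f B + h B = f A + h A)"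
    using openin_Int[OF U(1) V(1)] U(2) V(2) by blast
qed

lemma loc_const_scale:
  assumes f: "loc_const f" shows "loc_const (\<lambda>A. c * f A)"
proof (rule loc_constI)
  fix A assume "A \<in> oriented_apartments av"
  then obtain U where U: "openin (apartment_topology av) U" "A \<in> U" "\<And>B. B \<in> U \<Longrightarrow> f B = f A"
    using loc_constE[OF f] by blast
  have "c * f B = c * f A" if "B \<in> U" for B using U(3)[OF that] by simp
  then show "\<exists>U. openin (apartment_topology av) U \<and> A \<in> U \<and> (\<forall>B\<in>U. c * f B = c * f A)"
    using U(1,2) by blast
qed

lemma subspace_apartment_funs: "fun_subspace (apartment_funs av)"
  unfolding fun_subspace_def
proof (intro conjI ballI allI)
  have "loc_const (\<lambda>_. 0)"
    using openin_topspace[of "apartment_topology av"]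
    by (intro loc_constI exI[of _ "oriented_apartments av"]) (simp add: topspace_apartment_topology)
  then show "(\<lambda>_. 0) \<in> apartment_funs av" by (simp add: apartment_funs_iff)
next
  fix f h assume fh: "f \<in> apartment_funs av" "h \<in> apartment_funs av"
  let ?g = "\<lambda>A. f A + h A"
  have sub: "{A. ?g A \<noteq> 0} \<subseteq> {A. f A \<noteq> 0} \<union> {A. h A \<noteq> 0}" by auto
  have "loc_const ?g" using fh by (simp add: apartment_funs_iff loc_const_add)
  moreover have "{A. ?g A \<noteq> 0} \<subseteq> oriented_apartments av" using sub fh by (auto simp: apartment_funs_iff)
  moreover have "compactin (apartment_topology av) ({A. f A \<noteq> 0} \<union> {A. h A \<noteq> 0})"
    using fh by (intro compactin_Un) (simp_all add: apartment_funs_iff)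
  ultimately show "?g \<in> apartment_funs av"
    unfolding apartment_funs_iff by (blast intro: closed_compactin[OF _ sub closedin_support])
next
  fix c f assume f: "f \<in> apartment_funs av"
  have "{A. c * f A \<noteq> 0} = (if c = 0 then {} else {A. f A \<noteq> 0})" by auto
  then show "(\<lambda>A. c * f A) \<in> apartment_funs av" using f by (simp add: apartment_funs_iff loc_const_scale)
qed

lemma indicator_apartment_funs:
  assumes p: "p \<in> paths av k"
  shows "(\<lambda>A. if A \<in> cyl p then 1 else 0) \<in> apartment_funs av"
proof -
  have "openin (apartment_topology av) (oriented_apartments av - cyl p)"
    using closedin_cyl[OF p] by (simp add: closedin_def topspace_apartment_topology)
  then have "\<exists>U. openin (apartment_topology av) U \<and> A \<in> U \<and>
      (\<forall>B\<in>U. (if B \<in> cyl p then 1 else 0) = (if A \<in> cyl p then 1 else (0::complex)))"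
    if "A \<in> oriented_apartments av" for A
    using that openin_cyl[of p]
    by (intro exI[of _ "if A \<in> cyl p then cyl p else oriented_apartments av - cyl p"]) simp
  then have "loc_const (\<lambda>A. if A \<in> cyl p then 1 else 0)" by (rule loc_constI)
  moreover have "{A. (if A \<in> cyl p then 1 else 0) \<noteq> (0::complex)} = cyl p" by auto
  ultimately show ?thesis using compactin_cyl[OF p] cyl_subset by (simp add: apartment_funs_iff)
qed

lemma subspace_add: "fun_subspace V \<Longrightarrow> f \<in> V \<Longrightarrow> h \<in> V \<Longrightarrow> (\<lambda>x. f x + h x) \<in> V"
  by (simp add: fun_subspace_def)

lemma subspace_scale: "fun_subspace V \<Longrightarrow> f \<in> V \<Longrightarrow> (\<lambda>x. c * f x) \<in> V"
  by (simp add: fun_subspace_def)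

lemma subspace_sum:
  assumes V: "fun_subspace V" and "finite I" "\<And>i. i \<in> I \<Longrightarrow> f i \<in> V"
  shows "(\<lambda>x. \<Sum>i\<in>I. f i x) \<in> V"
  using assms(2,3)
proof (induction I rule: finite_induct)
  case empty
  then show ?case using V by (simp add: fun_subspace_def)
next
  case (insert i I)
  then have "(\<lambda>x. f i x + (\<Sum>i\<in>I. f i x)) \<in> V" using V by (simp add: fun_subspace_def)
  then show ?case using insert by simp
qed

lemma subspace_diff:
  assumes V: "fun_subspace V" and f: "f \<in> V" and h: "h \<in> V"
  shows "(\<lambda>x. f x - h x) \<in> V"
proof -
  have "(\<lambda>x. f x + (- 1) * h x) \<in> V" by (intro subspace_add subspace_scale assms)
  then show ?thesis by simp
qed

lemma subspace_path_funs: "fun_subspace (path_funs av k)"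
  unfolding fun_subspace_def
proof (intro conjI ballI allI)
  fix f h assume fh: "f \<in> path_funs av k" "h \<in> path_funs av k"
  have "{x. f x + h x \<noteq> 0} \<subseteq> {x. f x \<noteq> 0} \<union> {x. h x \<noteq> 0}" by auto
  then show "(\<lambda>x. f x + h x) \<in> path_funs av k"
    using fh unfolding path_funs_def by (auto intro: finite_subset[OF _ finite_UnI])
next
  fix c f assume f: "f \<in> path_funs av k"
  have "{x. c * f x \<noteq> 0} \<subseteq> {x. f x \<noteq> 0}" by auto
  then show "(\<lambda>x. c * f x) \<in> path_funs av k"
    using f unfolding path_funs_def by (auto intro: finite_subset)
qed (simp add: path_funs_def)

section \<open>Linearity of the Radon transform and its values on Dirac cochains\<close>

lemma radon_add:
  assumes "\<omega> \<in> C1c av k" "\<eta> \<in> C1c av k"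
  shows "radon av k (\<lambda>x. \<omega> x + \<eta> x) = (\<lambda>A. radon av k \<omega> A + radon av k \<eta> A)"
proof (rule radon_eqI)
  fix \<gamma> assume \<gamma>: "line \<gamma>"
  show "radon av k (\<lambda>x. \<omega> x + \<eta> x) (apt \<gamma>) = radon av k \<omega> (apt \<gamma>) + radon av k \<eta> (apt \<gamma>)"
    unfolding radon_apt[OF \<gamma>]
    by (rule Sum_any.distrib; rule finite_seg_support[OF \<gamma>]; rule assms)
qed (simp add: radon_outside)

lemma radon_scale:
  assumes "\<omega> \<in> C1c av k"
  shows "radon av k (\<lambda>x. c * \<omega> x) = (\<lambda>A. c * radon av k \<omega> A)"
proof (rule radon_eqI)
  fix \<gamma> assume \<gamma>: "line \<gamma>"
  show "radon av k (\<lambda>x. c * \<omega> x) (apt \<gamma>) = c * radon av k \<omega> (apt \<gamma>)"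
    unfolding radon_apt[OF \<gamma>]
    by (rule Sum_any_right_distrib[symmetric]) (rule finite_seg_support[OF \<gamma> assms])
qed (simp add: radon_outside)

text \<open>A line traverses \<open>p\<close> at most once, so the sum is 1 or 0.\<close>

lemma radon_delta:
  assumes p: "p \<in> paths av (Suc k)"
  shows "radon av k (\<lambda>x. if x = p then 1 else 0) = (\<lambda>A. if A \<in> cyl p then 1 else 0)"
proof (rule radon_eqI)
  have lp: "length p = Suc (Suc k)" using p by (simp add: paths_def)
  fix \<gamma> assume \<gamma>: "line \<gamma>"
  show "radon av k (\<lambda>x. if x = p then 1 else 0) (apt \<gamma>) = (if apt \<gamma> \<in> cyl p then 1 else 0)"
  proof (cases "apt \<gamma> \<in> cyl p")
    case True
    then obtain i where i: "p = seg \<gamma> i (Suc (Suc k))" using cyl_iff[OF \<gamma> lp] by blast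
    have "seg \<gamma> j (Suc (Suc k)) = p \<longleftrightarrow> j = i" for j
      unfolding i by (simp add: seg_inject[OF \<gamma>])
    then show ?thesis using True by (simp add: radon_apt[OF \<gamma>])
  next
    case False
    then have "seg \<gamma> j (Suc (Suc k)) \<noteq> p" for j using cyl_iff[OF \<gamma> lp] by blast
    then show ?thesis using False by (simp add: radon_apt[OF \<gamma>])
  qed
qed (use cyl_subset in auto)

lemma radon_zero: "radon av k (\<lambda>_. 0) = (\<lambda>_. 0)"
  by (rule radon_eqI) (simp_all add: radon_apt)

lemma delta_path_funs: "p \<in> paths av k \<Longrightarrow> (\<lambda>x. if x = p then 1 else 0) \<in> path_funs av k"
  by (auto simp: path_funs_def)

lemma path_funs_expand:
  assumes "\<omega> \<in> path_funs av k"
  shows "\<omega> = (\<lambda>x. \<Sum>p\<in>{p. \<omega> p \<noteq> 0}. \<omega> p * (if x = p then 1 else 0))"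
proof
  fix x
  have "finite {p. \<omega> p \<noteq> 0}" using assms by (simp add: path_funs_def)
  moreover have "\<omega> p * (if x = p then 1 else 0) = (if x = p then \<omega> p else 0)" for p by simp
  ultimately show "\<omega> x = (\<Sum>p\<in>{p. \<omega> p \<noteq> 0}. \<omega> p * (if x = p then 1 else 0))" by (simp only: sum.delta') simp
qed

lemma radon_sum:
  assumes "finite I" "\<And>i. i \<in> I \<Longrightarrow> \<omega> i \<in> C1c av k"
  shows "radon av k (\<lambda>x. \<Sum>i\<in>I. \<omega> i x) = (\<lambda>A. \<Sum>i\<in>I. radon av k (\<omega> i) A)"
  using assms
proof (induction I rule: finite_induct)
  case empty
  show ?case by (simp add: radon_zero)
next
  case (insert i I)
  have "(\<lambda>x. \<Sum>i\<in>I. \<omega> i x) \<in> C1c av k" using insert by (intro subspace_sum subspace_path_funs) auto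
  then show ?case using insert by (simp add: radon_add)
qed

text \<open>By linearity it suffices to treat Dirac cochains, whose transforms are indicators of
  compact open sets.\<close>

lemma radon_mem:
  assumes \<omega>: "\<omega> \<in> C1c av k" shows "radon av k \<omega> \<in> apartment_funs av"
proof -
  let ?S = "{p. \<omega> p \<noteq> 0}"
  have S: "finite ?S" "\<And>p. p \<in> ?S \<Longrightarrow> p \<in> paths av (Suc k)" using \<omega> by (auto simp: path_funs_def)
  have d: "(\<lambda>x. \<omega> p * (if x = p then 1 else 0)) \<in> C1c av k" if "p \<in> ?S" for p
    by (rule subspace_scale[OF subspace_path_funs delta_path_funs[OF S(2)[OF that]]])
  have "radon av k \<omega> = radon av k (\<lambda>x. \<Sum>p\<in>?S. \<omega> p * (if x = p then 1 else 0))"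
    using path_funs_expand[OF \<omega>] by simp
  also have "\<dots> = (\<lambda>A. \<Sum>p\<in>?S. radon av k (\<lambda>x. \<omega> p * (if x = p then 1 else 0)) A)"
    using S(1) d by (rule radon_sum)
  also have "\<dots> \<in> apartment_funs av"
  proof (rule subspace_sum[OF subspace_apartment_funs S(1)])
    fix p assume "p \<in> ?S"
    then have p: "p \<in> paths av (Suc k)" by (rule S(2))
    have "radon av k (\<lambda>x. \<omega> p * (if x = p then 1 else 0)) = (\<lambda>A. \<omega> p * (if A \<in> cyl p then 1 else 0))"
      using radon_scale[OF delta_path_funs[OF p]] radon_delta[OF p] by simp
    then show "radon av k (\<lambda>x. \<omega> p * (if x = p then 1 else 0)) \<in> apartment_funs av"
      using subspace_scale[OF subspace_apartment_funs indicator_apartment_funs[OF p], of "\<omega> p"] by simp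
  qed
  finally show ?thesis .
qed

text \<open>Pulling a cochain back along \<^term>\<open>butlast\<close> embeds the image of \<open>R\<^sub>k\<close> into that of \<open>R\<^sub>k\<^sub>+\<^sub>1\<close>.\<close>

lemma radon_image_Suc: "radon av k ` C1c av k \<subseteq> radon av (Suc k) ` C1c av (Suc k)"
proof
  fix f assume "f \<in> radon av k ` C1c av k"
  then obtain \<omega> where \<omega>: "\<omega> \<in> C1c av k" "f = radon av k \<omega>" by blast
  define \<eta> where "\<eta> a = (if a \<in> paths av (Suc (Suc k)) then \<omega> (butlast a) else 0)" for a
  have "{a. \<eta> a \<noteq> 0} = {a \<in> paths av (Suc (Suc k)). butlast a \<in> {p. \<omega> p \<noteq> 0}}"
    by (auto simp: \<eta>_def)
  then have "\<eta> \<in> C1c av (Suc k)"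
    using \<omega>(1) finite_butlast_preimage[of "{p. \<omega> p \<noteq> 0}" "Suc k"] by (simp add: path_funs_def)
  moreover have "radon av (Suc k) \<eta> = radon av k \<omega>"
    \<comment> \<open>Both sums run over the same starting positions and agree term by term, since
      \<open>butlast\<close> keeps the start of a window.\<close>
    by (rule radon_eqI) (simp_all add: radon_apt \<eta>_def seg_path butlast_seg radon_outside)
  ultimately show "f \<in> radon av (Suc k) ` C1c av (Suc k)" unfolding \<omega>(2) by (metis imageI)
qed

lemma radon_image_mono: "k \<le> l \<Longrightarrow> radon av k ` C1c av k \<subseteq> radon av l ` C1c av l"
  by (induction l rule: dec_induct) (use radon_image_Suc in blast)+

section \<open>The image of the Radon transform\<close>

definition radon_images :: "('a oriented_apartment \<Rightarrow> complex) set" where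
  "radon_images = (\<Union>k. radon av k ` C1c av k)"

lemma radon_imagesI: "\<omega> \<in> C1c av k \<Longrightarrow> radon av k \<omega> \<in> radon_images"
  unfolding radon_images_def by blast

text \<open>For sums the two levels are first raised to their maximum, the images being
  increasing.\<close>

lemma subspace_radon_images: "fun_subspace radon_images"
  unfolding fun_subspace_def
proof (intro conjI ballI allI)
  have "(\<lambda>_. 0) \<in> C1c av 0" by (simp add: path_funs_def)
  then have "radon av 0 (\<lambda>_. 0) \<in> radon_images" by (rule radon_imagesI)
  then show "(\<lambda>_. 0) \<in> radon_images" by (simp only: radon_zero)
next
  fix f h assume "f \<in> radon_images" "h \<in> radon_images"
  then obtain k l where "f \<in> radon av k ` C1c av k" "h \<in> radon av l ` C1c av l"
    by (auto simp: radon_images_def)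
  then have "f \<in> radon av (max k l) ` C1c av (max k l)" "h \<in> radon av (max k l) ` C1c av (max k l)"
    using radon_image_mono[of k "max k l"] radon_image_mono[of l "max k l"] by auto
  then obtain \<omega> \<eta> where \<omega>: "\<omega> \<in> C1c av (max k l)" "\<eta> \<in> C1c av (max k l)"
    "f = radon av (max k l) \<omega>" "h = radon av (max k l) \<eta>" by blast
  then have "(\<lambda>x. f x + h x) = radon av (max k l) (\<lambda>x. \<omega> x + \<eta> x)" by (simp add: radon_add)
  moreover have "(\<lambda>x. \<omega> x + \<eta> x) \<in> C1c av (max k l)"
    using \<omega> by (intro subspace_add subspace_path_funs)
  ultimately show "(\<lambda>x. f x + h x) \<in> radon_images" by (simp only: radon_imagesI)
next
  fix c f assume "f \<in> radon_images"
  then obtain k \<omega> where \<omega>: "\<omega> \<in> C1c av k" "f = radon av k \<omega>" by (auto simp: radon_images_def)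
  then have "(\<lambda>x. c * f x) = radon av k (\<lambda>x. c * \<omega> x)" by (simp add: radon_scale)
  moreover have "(\<lambda>x. c * \<omega> x) \<in> C1c av k"
    using \<omega> by (intro subspace_scale subspace_path_funs)
  ultimately show "(\<lambda>x. c * f x) \<in> radon_images" by (simp only: radon_imagesI)
qed

lemma indicator_radon_images:
  assumes "p \<in> paths av (Suc k)"
  shows "(\<lambda>A. if A \<in> cyl p then 1 else 0) \<in> radon_images"
  using radon_imagesI[OF delta_path_funs[OF assms]] by (simp only: radon_delta[OF assms])

text \<open>Once a segment is so long that \<open>f\<close> is constant on its cylinder, the
  restriction is a multiple of an indicator; shorter paths are handled by summing over their
  disjoint extensions. Starting from a path with an edge keeps every extension in the range of
  \<open>indicator_radon_images\<close>.\<close>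

lemma restrict_radon_images:
  assumes f: "loc_const f" and p: "p \<in> paths av (Suc m)"
  shows "(\<lambda>A. if A \<in> cyl p then f A else 0) \<in> radon_images"
proof (rule path_extension_induct[OF p])
  fix k q assume q: "q \<in> paths av k"
    and IH: "\<And>r. r \<in> paths av (Suc (Suc k)) \<Longrightarrow> butlast (tl r) = q \<Longrightarrow>
      (\<lambda>A. if A \<in> cyl r then f A else 0) \<in> radon_images"
  let ?E = "{r \<in> paths av (Suc (Suc k)). butlast (tl r) = q}"
  have "(if A \<in> cyl q then f A else 0) = (\<Sum>r\<in>?E. if A \<in> cyl r then f A else 0)" for A
  proof (cases "A \<in> cyl q")
    case True
    from cyl_extension_unique[OF q True] obtain r
      where r: "r \<in> paths av (Suc (Suc k)) \<and> butlast (tl r) = q \<and> A \<in> cyl r"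
        and uniq: "\<forall>r'. r' \<in> paths av (Suc (Suc k)) \<and> butlast (tl r') = q \<and> A \<in> cyl r' \<longrightarrow> r' = r"
      by (rule ex1E)
    have "A \<in> cyl r' \<longleftrightarrow> r' = r" if "r' \<in> ?E" for r' using that r uniq by blast
    then have "(\<Sum>r'\<in>?E. if A \<in> cyl r' then f A else 0) = (\<Sum>r'\<in>?E. if r' = r then f A else 0)"
      by (intro sum.cong) simp_all
    also have "\<dots> = f A" using r finite_path_extensions[of k q] by (simp add: sum.delta)
    finally show ?thesis using True by simp
  next
    case False
    then have "A \<notin> cyl r" if "r \<in> ?E" for r using that cyl_extension_subset by blast
    then show ?thesis using False by simp
  qed
  moreover have "(\<lambda>A. \<Sum>r\<in>?E. if A \<in> cyl r then f A else 0) \<in> radon_images"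
    using IH by (intro subspace_sum subspace_radon_images finite_path_extensions) blast
  ultimately show "(\<lambda>A. if A \<in> cyl q then f A else 0) \<in> radon_images" by presburger
next
  fix \<gamma> assume \<gamma>: "line \<gamma>"
  obtain U where U: "openin (apartment_topology av) U" "apt \<gamma> \<in> U" "\<And>B. B \<in> U \<Longrightarrow> f B = f (apt \<gamma>)"
    using loc_constE[OF f apt_mem[OF \<gamma>]] by blast
  obtain n where n: "cyl (seg \<gamma> (- int n) (Suc (Suc m + 2 * n))) \<subseteq> U"
    using cyl_seg_base[OF \<gamma> U(1,2)] by blast
  let ?q = "seg \<gamma> (- int n) (Suc (Suc m + 2 * n))"
  have "?q \<in> paths av (Suc (m + 2 * n))" using seg_path[OF \<gamma>, of "- int n" "Suc (m + 2 * n)"] by simp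
  then have "(\<lambda>A. f (apt \<gamma>) * (if A \<in> cyl ?q then 1 else 0)) \<in> radon_images"
    by (intro subspace_scale subspace_radon_images indicator_radon_images)
  also have "(\<lambda>A. f (apt \<gamma>) * (if A \<in> cyl ?q then 1 else 0)) = (\<lambda>A. if A \<in> cyl ?q then f A else 0)"
    by (rule ext) (use n U(3) in \<open>simp add: subset_eq\<close>)
  finally show "\<exists>n. (\<lambda>A. if A \<in> cyl (seg \<gamma> (- int n) (Suc (Suc m + 2 * n))) then f A else 0) \<in> radon_images"
    by blast
qed

lemma radon_images_subset: "radon_images \<subseteq> apartment_funs av"
  using radon_mem by (auto simp: radon_images_def)

theorem radon_images_eq: "radon_images = apartment_funs av"
proof (rule equalityI[OF radon_images_subset], rule subsetI)
  \<comment> \<open>The cylinders in a cover may overlap, so the restriction to one of them is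
    subtracted before the remaining ones are treated.\<close>
  have cover: "f \<in> radon_images"
    if "finite F" "F \<subseteq> paths av 1" "f \<in> apartment_funs av" "{A. f A \<noteq> 0} \<subseteq> (\<Union>p\<in>F. cyl p)" for F f
    using that
  proof (induction F arbitrary: f rule: finite_induct)
    case empty
    then have "f = (\<lambda>_. 0)" by auto
    then show ?case using subspace_radon_images by (simp add: fun_subspace_def)
  next
    case (insert p F)
    let ?g = "\<lambda>A. if A \<in> cyl p then f A else 0" and ?h = "\<lambda>A. f A - (if A \<in> cyl p then f A else 0)"
    have p: "p \<in> paths av (Suc 0)" using insert by simp
    have g: "?g \<in> radon_images"
      using insert.prems(2) p by (intro restrict_radon_images) (simp_all add: apartment_funs_iff)
    then have "?h \<in> apartment_funs av"
      using insert.prems(2) radon_images_subset by (intro subspace_diff subspace_apartment_funs) auto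
    moreover have "{A. ?h A \<noteq> 0} \<subseteq> (\<Union>p\<in>F. cyl p)" using insert.prems(3) by auto
    ultimately have "?h \<in> radon_images" using insert by auto
    with g have "(\<lambda>A. ?g A + ?h A) \<in> radon_images" by (intro subspace_add subspace_radon_images)
    then show ?case by simp
  qed
  fix f assume f: "f \<in> apartment_funs av"
  have "{A. f A \<noteq> 0} \<subseteq> \<Union> (cyl ` paths av 1)"
  proof
    fix A assume "A \<in> {A. f A \<noteq> 0}"
    then obtain \<gamma> where "line \<gamma>" "A = apt \<gamma>" using f by (auto simp: apartment_funs_iff oriented_apartments_eq)
    then show "A \<in> \<Union> (cyl ` paths av 1)" using cyl_seg[of \<gamma> 0 "Suc 1"] seg_path[of \<gamma> 0 1] by blast
  qed
  then obtain \<F> where \<F>: "finite \<F>" "\<F> \<subseteq> cyl ` paths av 1" "{A. f A \<noteq> 0} \<subseteq> \<Union> \<F>"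
    using f openin_cyl unfolding apartment_funs_iff compactin_def by (metis (no_types, lifting) imageE)
  then obtain F where "F \<subseteq> paths av 1" "finite F" "\<F> = cyl ` F" by (meson finite_subset_image)
  then show "f \<in> radon_images" using cover[of F f] f \<F>(3) by simp
qed

end

section \<open>Modules and the main theorem\<close>

text \<open>Isolates the formal part of the module axioms; for each concrete space only stability
  under translation needs an argument. The condition \<open>supp\<close> makes extension by zero
  compatible with the unit.\<close>

lemma G_module_translate:
  assumes G: "group G" and V: "fun_subspace V"
    and act: "\<And>g x. g \<in> carrier G \<Longrightarrow> x \<in> S \<Longrightarrow> \<alpha> g x \<in> S"
    and act_one: "\<And>x. x \<in> S \<Longrightarrow> \<alpha> \<one>\<^bsub>G\<^esub> x = x"
    and act_mult: "\<And>g h x. g \<in> carrier G \<Longrightarrow> h \<in> carrier G \<Longrightarrow> x \<in> S \<Longrightarrow> \<alpha> (g \<otimes>\<^bsub>G\<^esub> h) x = \<alpha> g (\<alpha> h x)"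
    and supp: "\<And>f x. f \<in> V \<Longrightarrow> x \<notin> S \<Longrightarrow> f x = 0"
    and closed: "\<And>g f. g \<in> carrier G \<Longrightarrow> f \<in> V \<Longrightarrow> translate G \<alpha> S g f \<in> V"
  shows "G_module G (translate G \<alpha> S) V"
proof -
  interpret group G by (rule G)
  have "fun_linear V V (translate G \<alpha> S g)" if "g \<in> carrier G" for g
    unfolding fun_linear_def using closed[OF that] by (auto simp: translate_def fun_eq_iff)
  moreover have "translate G \<alpha> S \<one>\<^bsub>G\<^esub> f = f" if "f \<in> V" for f
    using supp[OF that] by (auto simp: translate_def act_one fun_eq_iff)
  moreover have "translate G \<alpha> S (g \<otimes>\<^bsub>G\<^esub> h) f = translate G \<alpha> S g (translate G \<alpha> S h f)"
    if "g \<in> carrier G" "h \<in> carrier G" for g h f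
    using that by (auto simp: translate_def fun_eq_iff inv_mult_group act act_mult)
  ultimately show ?thesis unfolding G_module_def using G V by blast
qed

context nonarch_local_field
begin

lemma path_vertices: "p \<in> paths av k \<Longrightarrow> s \<in> set p \<Longrightarrow> s \<in> vertices av"
  by (auto simp: paths_def)

lemma map_vertex_act_proj:
  "invertible M \<Longrightarrow> p \<in> paths av k \<Longrightarrow> map (vertex_act (proj M)) p = map (vact M) p"
  by (simp add: vertex_act_proj path_vertices)

lemma map_vact_path:
  assumes M: "invertible M" and p: "p \<in> paths av k"
  shows "map (vact M) p \<in> paths av k"
proof -
  obtain \<gamma> where "line \<gamma>" "p = seg \<gamma> 0 (Suc k)" using p by (rule path_eq_seg)
  then show ?thesis using seg_path[OF line_vact[OF M]] by (simp add: map_seg)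
qed

lemma map_vertex_act_path:
  "g \<in> carrier PGL2 \<Longrightarrow> p \<in> paths av k \<Longrightarrow> map (vertex_act g) p \<in> paths av k"
  by (auto simp: carrier_PGL2 map_vertex_act_proj map_vact_path simp del: map_eq_conv)

lemma PGL2_inv_closed: "g \<in> carrier PGL2 \<Longrightarrow> inv\<^bsub>PGL2\<^esub> g \<in> carrier PGL2"
  using group.inv_closed[OF group_PGL2] .

lemma G_module_path_funs: "G_module PGL2 (path_rep av k) (path_funs av k)"
  unfolding path_rep_def
proof (rule G_module_translate[OF group_PGL2 subspace_path_funs])
  fix g :: "('a^2^2) set" and x assume "g \<in> carrier PGL2" "x \<in> paths av k"
  then show "map (vertex_act g) x \<in> paths av k" by (rule map_vertex_act_path)
next
  fix x assume "x \<in> paths av k"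
  then show "map (vertex_act \<one>\<^bsub>PGL2\<^esub>) x = x"
    by (simp only: one_PGL2 map_vertex_act_proj[OF invertible_mat_1]) (simp add: map_idI)
next
  fix g h :: "('a^2^2) set" and x assume gh: "g \<in> carrier PGL2" "h \<in> carrier PGL2" and x: "x \<in> paths av k"
  obtain M N where MN: "invertible M" "g = proj M" "invertible N" "h = proj N"
    using gh by (auto simp: carrier_PGL2)
  have "map (vertex_act (g \<otimes>\<^bsub>PGL2\<^esub> h)) x = map (vact (M ** N)) x"
    using MN x by (simp only: proj_mult map_vertex_act_proj invertible_mult)
  also have "\<dots> = map (vact M) (map (vact N) x)" by (simp add: vact_mult)
  also have "\<dots> = map (vertex_act g) (map (vertex_act h) x)"
    unfolding MN(2,4) map_vertex_act_proj[OF MN(3) x]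
    by (rule map_vertex_act_proj[OF MN(1) map_vact_path[OF MN(3) x], symmetric])
  finally show "map (vertex_act (g \<otimes>\<^bsub>PGL2\<^esub> h)) x = map (vertex_act g) (map (vertex_act h) x)" .
next
  fix f x assume "f \<in> path_funs av k" "x \<notin> paths av k"
  then show "f x = 0" by (auto simp: path_funs_def)
next
  fix g :: "('a^2^2) set" and f assume g: "g \<in> carrier PGL2" and f: "f \<in> path_funs av k"
  interpret group "PGL2 :: ('a^2^2) set monoid" by (rule group_PGL2)
  let ?t = "translate PGL2 (\<lambda>g. map (vertex_act g)) (paths av k) g f"
  obtain M where M: "invertible M" "g = proj M" using g by (auto simp: carrier_PGL2)
  obtain N where N: "invertible N" "M ** N = mat 1" "N ** M = mat 1" using invertible_cancel[OF M(1)] by metis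
  have "{x. ?t x \<noteq> 0} \<subseteq> map (vact M) ` {x. f x \<noteq> 0}"
  proof
    fix x assume "x \<in> {x. ?t x \<noteq> 0}"
    then have x: "x \<in> paths av k" "f (map (vertex_act (inv\<^bsub>PGL2\<^esub> g)) x) \<noteq> 0"
      by (auto simp: translate_def split: if_splits)
    then have "f (map (vact N) x) \<noteq> 0"
      using N M by (simp add: proj_inv map_vertex_act_proj del: map_eq_conv)
    moreover have "x = map (vact M) (map (vact N) x)"
      by (simp add: comp_def vact_cancel[OF N(2)])
    ultimately show "x \<in> map (vact M) ` {x. f x \<noteq> 0}" by blast
  qed
  moreover have "finite (map (vact M) ` {x. f x \<noteq> 0})" using f by (simp add: path_funs_def)
  ultimately have "finite {x. ?t x \<noteq> 0}" by (rule finite_subset)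
  then show "?t \<in> path_funs av k" by (auto simp: path_funs_def translate_def)
qed

lemma apartment_act_mem:
  assumes "g \<in> carrier PGL2" "A \<in> oriented_apartments av"
  shows "apartment_act g A \<in> oriented_apartments av"
  using assms by (auto simp: carrier_PGL2 oriented_apartments_mapt mapt_mult invertible_mult)

lemma apartment_act_mult:
  assumes "g \<in> carrier PGL2" "h \<in> carrier PGL2" "A \<in> oriented_apartments av"
  shows "apartment_act (g \<otimes>\<^bsub>PGL2\<^esub> h) A = apartment_act g (apartment_act h A)"
proof -
  obtain M N K where "invertible M" "g = proj M" "invertible N" "h = proj N" "invertible K" "A = mapt K"
    using assms by (auto simp: carrier_PGL2 oriented_apartments_mapt)
  then show ?thesis by (simp add: proj_mult mapt_mult invertible_mult matrix_mul_assoc)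
qed

lemma apartment_act_one: "A \<in> oriented_apartments av \<Longrightarrow> apartment_act \<one>\<^bsub>PGL2\<^esub> A = A"
  by (auto simp: one_PGL2 oriented_apartments_mapt mapt_mult invertible_mat_1)

lemma continuous_apartment_act:
  assumes g: "g \<in> carrier PGL2"
  shows "continuous_map (apartment_topology av) (apartment_topology av) (apartment_act g)"
proof -
  obtain M where M: "invertible M" "g = proj M" using g by (auto simp: carrier_PGL2)
  show ?thesis
    unfolding continuous_map topspace_apartment_topology
    using apartment_act_mem[OF g] openin_translate[OF M(1)] M(2) by auto
qed

lemma G_module_apartment_funs: "G_module PGL2 (apartment_rep av) (apartment_funs av)"
  unfolding apartment_rep_def
proof (rule G_module_translate[OF group_PGL2 subspace_apartment_funs])
  fix f x assume "f \<in> apartment_funs av" "x \<notin> oriented_apartments av"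
  then show "f x = 0" by (auto simp: apartment_funs_iff)
next
  fix g :: "('a^2^2) set" and f assume g: "g \<in> carrier PGL2" and f: "f \<in> apartment_funs av"
  interpret group "PGL2 :: ('a^2^2) set monoid" by (rule group_PGL2)
  let ?h = "inv\<^bsub>PGL2\<^esub> g" and ?t = "translate PGL2 apartment_act (oriented_apartments av) g f"
  have h: "?h \<in> carrier PGL2" using g by simp
  have f': "{A. f A \<noteq> 0} \<subseteq> oriented_apartments av" "loc_const f"
    "compactin (apartment_topology av) {A. f A \<noteq> 0}" using f by (simp_all add: apartment_funs_iff)
  have t: "?t A = f (apartment_act ?h A)" if "A \<in> oriented_apartments av" for A
    using that by (simp add: translate_def)
  have gh: "apartment_act g (apartment_act ?h A) = A" "apartment_act ?h (apartment_act g A) = A"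
    if "A \<in> oriented_apartments av" for A
    using that g h by (simp_all add: apartment_act_one flip: apartment_act_mult)
  have "loc_const ?t"
  proof (rule loc_constI)
    fix A assume A: "A \<in> oriented_apartments av"
    obtain U where U: "openin (apartment_topology av) U" "apartment_act ?h A \<in> U"
      "\<And>B. B \<in> U \<Longrightarrow> f B = f (apartment_act ?h A)"
      using loc_constE[OF f'(2) apartment_act_mem[OF h A]] by blast
    let ?U = "{B \<in> topspace (apartment_topology av). apartment_act ?h B \<in> U}"
    have "openin (apartment_topology av) ?U"
      using continuous_apartment_act[OF h] U(1) unfolding continuous_map by blast
    moreover have "A \<in> ?U" using A U(2) by (simp add: topspace_apartment_topology)
    moreover have "?t B = ?t A" if "B \<in> ?U" for B
      using that U(3) t A by (simp add: topspace_apartment_topology)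
    ultimately show "\<exists>U. openin (apartment_topology av) U \<and> A \<in> U \<and> (\<forall>B\<in>U. ?t B = ?t A)" by blast
  qed
  \<comment> \<open>Writing the new support as the image of the old one under a continuous map gives
    its compactness.\<close>
  moreover have "{A. ?t A \<noteq> 0} = apartment_act g ` {A. f A \<noteq> 0}"
  proof (intro equalityI subsetI)
    fix A assume "A \<in> {A. ?t A \<noteq> 0}"
    then have A: "A \<in> oriented_apartments av" "f (apartment_act ?h A) \<noteq> 0"
      by (auto simp: translate_def split: if_splits)
    then show "A \<in> apartment_act g ` {A. f A \<noteq> 0}"
      by (intro image_eqI[of _ _ "apartment_act ?h A"]) (simp_all add: gh)
  next
    fix A assume "A \<in> apartment_act g ` {A. f A \<noteq> 0}"
    then obtain B where B: "A = apartment_act g B" "f B \<noteq> 0" by blast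
    then have "B \<in> oriented_apartments av" using f'(1) by blast
    then show "A \<in> {A. ?t A \<noteq> 0}" using B t[of A] apartment_act_mem[OF g] by (simp add: gh)
  qed
  moreover have "{A. ?t A \<noteq> 0} \<subseteq> oriented_apartments av" by (auto simp: translate_def)
  moreover have "compactin (apartment_topology av) (apartment_act g ` {A. f A \<noteq> 0})"
    using f'(3) continuous_apartment_act[OF g] by (rule image_compactin)
  ultimately show "?t \<in> apartment_funs av" by (simp add: apartment_funs_iff)
qed (simp_all add: apartment_act_mem apartment_act_mult apartment_act_one)

lemma G_hom_coboundary:
  "G_hom PGL2 (path_rep av k) (C0c av k) (path_rep av (Suc k)) (C1c av k) (coboundary av k)"
  unfolding G_hom_def
proof (intro conjI ballI G_module_path_funs)
  show "fun_linear (C0c av k) (C1c av k) (coboundary av k)"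
    unfolding fun_linear_def
    by (auto simp: coboundary_mem) (auto simp: coboundary_def fun_eq_iff algebra_simps)
next
  fix g :: "('a^2^2) set" and f assume g: "g \<in> carrier PGL2" and "f \<in> C0c av k"
  show "coboundary av k (path_rep av k g f) = path_rep av (Suc k) g (coboundary av k f)"
  proof
    fix a
    show "coboundary av k (path_rep av k g f) a = path_rep av (Suc k) g (coboundary av k f) a"
    proof (cases "a \<in> paths av (Suc k)")
      case True
      then show ?thesis
        using path_tl[OF True] path_butlast[OF True] map_vertex_act_path[OF PGL2_inv_closed[OF g] True]
        by (simp add: coboundary_def path_rep_def translate_def map_tl map_butlast)
    qed (simp add: coboundary_def path_rep_def translate_def)
  qed
qed

lemma G_hom_radon:
  "G_hom PGL2 (path_rep av (Suc k)) (C1c av k) (apartment_rep av) (apartment_funs av) (radon av k)"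
  unfolding G_hom_def
proof (intro conjI ballI G_module_path_funs G_module_apartment_funs)
  show "fun_linear (C1c av k) (apartment_funs av) (radon av k)"
    unfolding fun_linear_def by (auto simp: radon_mem radon_add radon_scale)
next
  fix g :: "('a^2^2) set" and f assume g: "g \<in> carrier PGL2" and f: "f \<in> C1c av k"
  obtain N where N: "invertible N" "inv\<^bsub>PGL2\<^esub> g = proj N"
    using PGL2_inv_closed[OF g] by (auto simp: carrier_PGL2)
  show "radon av k (path_rep av (Suc k) g f) = apartment_rep av g (radon av k f)"
  proof (rule radon_eqI)
    fix \<gamma> assume \<gamma>: "line \<gamma>"
    have "path_rep av (Suc k) g f (seg \<gamma> i (Suc (Suc k))) = f (seg (\<lambda>i. vact N (\<gamma> i)) i (Suc (Suc k)))" for i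
    proof -
      have "map (vertex_act (proj N)) (seg \<gamma> i (Suc (Suc k))) = seg (\<lambda>i. vact N (\<gamma> i)) i (Suc (Suc k))"
        by (subst map_vertex_act_proj[OF N(1) seg_path[OF \<gamma>]]) (rule map_seg)
      then show ?thesis using seg_path[OF \<gamma>, of i "Suc k"]
        by (simp add: path_rep_def translate_def N(2))
    qed
    then show "radon av k (path_rep av (Suc k) g f) (apt \<gamma>) = apartment_rep av g (radon av k f) (apt \<gamma>)"
      using \<gamma> N by (simp add: radon_apt apartment_rep_def translate_def apt_mem apartment_act_proj line_vact)
  qed (simp add: apartment_rep_def translate_def)
qed

section \<open>Cohomology classes as fibres of the Radon transform\<close>

lemma cohomologous_iff:
  assumes "\<omega> \<in> C1c av k" "\<eta> \<in> C1c av k"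
  shows "(\<lambda>a. \<omega> a - \<eta> a) \<in> coboundary av k ` C0c av k \<longleftrightarrow> radon av k \<omega> = radon av k \<eta>"
proof -
  have d: "(\<lambda>a. \<omega> a - \<eta> a) \<in> C1c av k" using assms by (intro subspace_diff subspace_path_funs)
  have "radon av k (\<lambda>a. (\<omega> a - \<eta> a) + \<eta> a) = (\<lambda>A. radon av k (\<lambda>a. \<omega> a - \<eta> a) A + radon av k \<eta> A)"
    using d assms(2) by (rule radon_add)
  then have "radon av k (\<lambda>a. \<omega> a - \<eta> a) = (\<lambda>_. 0) \<longleftrightarrow> radon av k \<omega> = radon av k \<eta>"
    by (simp add: fun_eq_iff)
  then show ?thesis unfolding coboundary_image using d by simp
qed

text \<open>By exactness a cohomology class is a whole fibre of the transform on cochains, which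
  makes \<open>radon_bar\<close> both well defined and injective.\<close>

lemma H1c_eq:
  "H1c av k = {{\<eta> \<in> C1c av k. radon av k \<eta> = radon av k \<omega>} | \<omega>. \<omega> \<in> C1c av k}"
proof -
  have "{(\<omega>, \<eta>). \<omega> \<in> C1c av k \<and> \<eta> \<in> C1c av k \<and> (\<lambda>a. \<omega> a - \<eta> a) \<in> coboundary av k ` C0c av k} `` {\<omega>} =
      {\<eta> \<in> C1c av k. radon av k \<eta> = radon av k \<omega>}" if "\<omega> \<in> C1c av k" for \<omega>
  proof (intro equalityI subsetI)
    fix \<eta> assume "\<eta> \<in> {\<eta> \<in> C1c av k. radon av k \<eta> = radon av k \<omega>}"
    then show "\<eta> \<in> {(\<omega>, \<eta>). \<omega> \<in> C1c av k \<and> \<eta> \<in> C1c av k \<and>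
        (\<lambda>a. \<omega> a - \<eta> a) \<in> coboundary av k ` C0c av k} `` {\<omega>}"
      using that cohomologous_iff[OF that, of \<eta>] by simp
  next
    fix \<eta> assume "\<eta> \<in> {(\<omega>, \<eta>). \<omega> \<in> C1c av k \<and> \<eta> \<in> C1c av k \<and>
        (\<lambda>a. \<omega> a - \<eta> a) \<in> coboundary av k ` C0c av k} `` {\<omega>}"
    then have \<eta>: "\<eta> \<in> C1c av k" "(\<lambda>a. \<omega> a - \<eta> a) \<in> coboundary av k ` C0c av k"
      by (simp_all add: Image_singleton_iff)
    then have "radon av k \<omega> = radon av k \<eta>" using cohomologous_iff[OF that] by blast
    then show "\<eta> \<in> {\<eta> \<in> C1c av k. radon av k \<eta> = radon av k \<omega>}" using \<eta>(1) by simp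
  qed
  then show ?thesis unfolding H1c_def quotient_def by auto
qed

lemma radon_bar_eq:
  assumes "c \<in> H1c av k" "\<omega> \<in> c"
  shows "radon_bar av k c = radon av k \<omega>"
proof -
  have "radon av k ` c = {radon av k \<omega>}" using assms unfolding H1c_eq by auto
  then show ?thesis by (simp add: radon_bar_def)
qed

lemma inj_on_radon_bar: "inj_on (radon_bar av k) (H1c av k)"
proof (rule inj_onI)
  fix c c' assume c: "c \<in> H1c av k" "c' \<in> H1c av k" and eq: "radon_bar av k c = radon_bar av k c'"
  obtain \<omega> \<omega>' where "\<omega> \<in> C1c av k" "c = {\<eta> \<in> C1c av k. radon av k \<eta> = radon av k \<omega>}"
    "\<omega>' \<in> C1c av k" "c' = {\<eta> \<in> C1c av k. radon av k \<eta> = radon av k \<omega>'}"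
    using c unfolding H1c_eq by blast
  moreover from this have "radon_bar av k c = radon av k \<omega>" "radon_bar av k c' = radon av k \<omega>'"
    using c by (simp_all add: radon_bar_eq)
  ultimately show "c = c'" using eq by simp
qed

lemma radon_bar_image: "radon_bar av k ` H1c av k = radon av k ` C1c av k"
proof (intro equalityI subsetI)
  fix f assume "f \<in> radon_bar av k ` H1c av k"
  then obtain c where c: "c \<in> H1c av k" "f = radon_bar av k c" by blast
  then obtain \<omega> where "\<omega> \<in> C1c av k" "\<omega> \<in> c" unfolding H1c_eq by blast
  then show "f \<in> radon av k ` C1c av k" using radon_bar_eq c by auto
next
  fix f assume "f \<in> radon av k ` C1c av k"
  then obtain \<omega> where \<omega>: "\<omega> \<in> C1c av k" "f = radon av k \<omega>" by blast
  let ?c = "{\<eta> \<in> C1c av k. radon av k \<eta> = radon av k \<omega>}"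
  have c: "?c \<in> H1c av k" "\<omega> \<in> ?c" unfolding H1c_eq using \<omega>(1) by auto
  then show "f \<in> radon_bar av k ` H1c av k"
    by (intro image_eqI[OF _ c(1)] trans[OF \<omega>(2) radon_bar_eq[OF c, symmetric]])
qed

end

text \<open>The conjunct on members of classes certifies that \<open>the_elem\<close> in
  \<open>radon_bar\<close> is applied to a singleton, so that injectivity and the union speak of the
  map induced on cohomology.\<close>

theorem mainTheorem3:
  fixes av :: "'a::field \<Rightarrow> real"
  assumes "nonarch_local_field av"
  shows "(\<forall>k.
      G_hom PGL2 (path_rep av k) (C0c av k) (path_rep av (Suc k)) (C1c av k) (coboundary av k) \<and>
      G_hom PGL2 (path_rep av (Suc k)) (C1c av k) (apartment_rep av) (apartment_funs av) (radon av k) \<and>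
      coboundary av k ` C0c av k = {\<omega> \<in> C1c av k. radon av k \<omega> = (\<lambda>_. 0)} \<and>
      (\<forall>c\<in>H1c av k. \<forall>\<omega>\<in>c. radon_bar av k c = radon av k \<omega>) \<and>
      inj_on (radon_bar av k) (H1c av k)) \<and>
    (\<Union>k. radon_bar av k ` H1c av k) = apartment_funs av"
proof -
  interpret nonarch_local_field av by (rule assms)
  have "(\<Union>k. radon_bar av k ` H1c av k) = apartment_funs av"
    unfolding radon_bar_image radon_images_def[symmetric] by (rule radon_images_eq)
  then show ?thesis
    by (intro conjI allI ballI G_hom_coboundary G_hom_radon coboundary_image radon_bar_eq inj_on_radon_bar)
qed

end
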